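(* Let $V>0$ and $T>0$ be fixed, and let $(\sigma^\lambda,j^\lambda)\in\mathrm{CE}(0,T;\Omega_V)$, $\lambda>0$, satisfy $\sup_{\lambda>0}\{\mathrm{Ent}(\sigma^\lambda_0\,|\,\pi)+\mathscr I^\lambda(\sigma^\lambda,j^\lambda)\}\le C$ for some $C>0$, where $\sigma^\lambda_0=\sigma^\lambda|_{t=0}$. Define $$\rho^\lambda(dt\,dx):=\sum_{v\in\{-V,V\}}\sigma^\lambda_t(dx,v)\,dt,\quad \omega^\lambda(dt\,dx):=\sum_{v\in\{-V,V\}}v\,\sigma^\lambda_t(dx,v)\,dt,\quad J^\lambda(dt\,dx):=\sum_{v\in\{-V,V\}}v\,j^{2,\lambda}_t(dx,v)\,dt .$$ Suppose that, as $\lambda\to0$, $\rho^\lambda\to\bar\rho$, $\omega^\lambda\to\bar\omega$ and $J^\lambda\to\bar J$ narrowly in $\mathcal M((0,T)\times\mathbb T)$, and $\rho^\lambda_t\to\bar\rho_t$ narrowly in $\mathcal P(\mathbb T)$ for every $t\in[0,T]$. Then $$\liminf_{\lambda\to0}\mathscr I^\lambda(\sigma^\lambda,j^\lambda)\ge\bar{\mathscr J}(\bar\rho,\bar\omega,\bar J),$$ where $\bar{\mathscr J}(\rho,\omega,J):=0$ if $(\rho,\omega,J)\in\mathrm{ME}(0,T;\mathbb T)$ with $J=0$, and $\bar{\mathscr J}(\rho,\omega,J):=+\infty$ otherwise.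
   Context: $\mathbb T=\mathbb R/\mathbb Z$, $\mathcal L_{\mathbb T}$ Lebesgue measure, $\Omega_V:=\mathbb T\times\{-V,V\}$, $\iota(x,v):=(x,-v)$, $\pi:=\mathcal L_{\mathbb T}\otimes\mathrm{Unif}_{\{-V,V\}}$. $\mathcal P$, $\mathcal M$: probability measures and finite signed Borel measures; narrow topology = duality with bounded continuous functions. $C^{1,0}(\Omega_V)$: functions that are $C^1$ in $x$ for each $v$. $(\sigma,j)\in\mathrm{CE}(0,T;\Omega_V)$ means: $\sigma\in C([0,T];\mathcal P(\Omega_V))$ (narrowly continuous); $(j_t)_{t\in(0,T)}\subset\mathcal M(\Omega_V;\mathbb R^2)$, $j_t=(j^1_t,j^2_t)$, is a measurable family with $\int_0^T\|j_t\|_{\mathrm{TV}}\,dt<\infty$; and for all $\varphi\in C^{1,0}(\Omega_V)$, $0\le s\le t\le T$: $\int\varphi\,d\sigma_t-\int\varphi\,d\sigma_s=\int_s^t\int_{\Omega_V}[\partial_x\varphi\,dj^1_r+(\varphi\circ\iota-\varphi)\,dj^2_r]\,dr$. Components of $j^\lambda$ are $j^{1,\lambda},j^{2,\lambda}$. $\mathrm{Ent}(\mu\,|\,\nu):=\int(f\log f-f+1)\,d\nu$ if $\mu\ll\nu$ with $f=d\mu/d\nu\ge0$, $+\infty$ otherwise. $\mathscr I^\lambda(\sigma,j):=\int_0^T\mathscr L^\lambda(\sigma_t,j_t)\,dt$ if $(\sigma,j)\in\mathrm{CE}(0,T;\Omega_V)$, $+\infty$ otherwise, with $\mathscr L^\lambda(\sigma,j):=\mathrm{Ent}(j^2\,|\,\lambda\sigma)$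 if $j^1=v\,\sigma$, $+\infty$ otherwise. $(\rho,\omega,K)\in\mathrm{ME}(0,T;\mathbb T)$ means: $(\rho,\omega)\in C([0,T];\mathcal P(\mathbb T))\times C([0,T];\mathcal M(\mathbb T))$ (narrowly continuous); $(K_t)_{t\in(0,T)}\subset\mathcal M(\mathbb T)$ is a measurable family with $\int_0^T\|K_t\|_{\mathrm{TV}}\,dt<\infty$; and for all $\varphi,\psi\in C^1(\mathbb T)$, $0\le s\le t\le T$: $\int\varphi\,d\rho_t-\int\varphi\,d\rho_s=\int_s^t\int\partial_x\varphi\,d\omega_r\,dr$ and $\int\psi\,d\omega_t-\int\psi\,d\omega_s=V^2\int_s^t\int\partial_x\psi\,d\rho_r\,dr-2\int_s^t\int\psi\,dK_r\,dr$. A measure of the form $\mu_t(dx)\,dt$ is identified with the family $(\mu_t)$, and the limit measure $\bar\omega$ is identified with its narrowly continuous time-representative. *)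

theory Defs
  imports "HOL-Probability.Probability"
begin

section \<open>The torus \<open>R/Z\<close>\<close>

quotient_type torus = real / "\<lambda>x y. x - y \<in> \<int>" morphisms rep_torus torus_of
proof (rule equivpI)
  show "reflp (\<lambda>x y :: real. x - y \<in> \<int>)"
    by (simp add: reflp_def)
  show "symp (\<lambda>x y :: real. x - y \<in> \<int>)"
    unfolding symp_def by (metis Ints_minus minus_diff_eq)
  show "transp (\<lambda>x y :: real. x - y \<in> \<int>)"
    unfolding transp_def by (metis Ints_add diff_add_cancel add_diff_eq)
qed

instantiation torus :: topological_space
begin

definition open_torus :: "torus set \<Rightarrow> bool"
  where "open_torus U \<longleftrightarrow> open (torus_of -` U)"  \<comment> \<open>quotient topology\<close>

instance
  by standard (auto simp: open_torus_def vimage_Union)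

end

lemma torus_of_eq_iff: "torus_of x = torus_of y \<longleftrightarrow> x - y \<in> \<int>"
  by (rule torus.abs_eq_iff)

lemma torus_of_rep: "torus_of (rep_torus p) = p"
  by (rule Quotient3_abs_rep[OF Quotient3_torus])

lemma continuous_on_torus_of: "continuous_on S torus_of"
proof -
  have "continuous_on UNIV torus_of"
    by (subst continuous_on_open_vimage) (auto simp: open_torus_def)
  then show ?thesis
    by (rule continuous_on_subset) simp
qed

lemma open_image_torus_of:
  assumes "open A"
  shows "open (torus_of ` A)"
proof -
  have "torus_of -` torus_of ` A = (\<Union>k::int. (+) (of_int k) ` A)"
  proof (intro set_eqI iffI)
    fix x assume "x \<in> torus_of -` torus_of ` A"
    then obtain y where y: "y \<in> A" "x - y \<in> \<int>"
      by (auto simp: torus_of_eq_iff)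
    then obtain k :: int where "x - y = of_int k"
      by (auto elim: Ints_cases)
    then have "x = of_int k + y"
      by simp
    with y show "x \<in> (\<Union>k::int. (+) (of_int k) ` A)"
      by blast
  next
    fix x assume "x \<in> (\<Union>k::int. (+) (of_int k) ` A)"
    then obtain k :: int and y where y: "y \<in> A" "x = of_int k + y"
      by blast
    then have "torus_of x = torus_of y"
      by (simp add: torus_of_eq_iff)
    with y show "x \<in> torus_of -` torus_of ` A"
      by auto
  qed
  with assms show ?thesis
    by (auto simp: open_torus_def intro!: open_translation)
qed

instance torus :: second_countable_topology
proof
  obtain B :: "real set set" where B: "countable B" "topological_basis B"
    using ex_countable_basis by blast
  have "topological_basis ((`) torus_of ` B)"
  proof (rule topological_basisI)
    fix U assume "U \<in> (`) torus_of ` B"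
    then show "open U"
      using B topological_basis_open open_image_torus_of by blast
  next
    fix U :: "torus set" and p assume U: "open U" "p \<in> U"
    then have "open (torus_of -` U)" "rep_torus p \<in> torus_of -` U"
      by (auto simp: open_torus_def torus_of_rep)
    then obtain W where "W \<in> B" "rep_torus p \<in> W" "W \<subseteq> torus_of -` U"
      using B topological_basisE by metis
    then show "\<exists>W'\<in>(`) torus_of ` B. p \<in> W' \<and> W' \<subseteq> U"
      by (intro bexI[of _ "torus_of ` W"]) (auto intro: image_eqI[where x = "rep_torus p"] simp: torus_of_rep)
  qed
  then have "countable ((`) torus_of ` B) \<and> open = generate_topology ((`) torus_of ` B)"
    using B topological_basis_imp_subbasis by blast
  then show "\<exists>B::torus set set. countable B \<and> open = generate_topology B"
    by blast
qed

definition lebesgue_torus :: "torus measure"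
  where "lebesgue_torus = distr (restrict_space lborel {0..<1}) borel torus_of"

definition C1_torus :: "(torus \<Rightarrow> real) \<Rightarrow> bool"
  where "C1_torus f \<longleftrightarrow> (\<lambda>x. f (torus_of x)) C1_differentiable_on UNIV"

text \<open>The lift of \<open>f\<close> is 1-periodic, so for differentiable \<open>f\<close> the value does not depend on the
  representative.\<close>

definition deriv_torus :: "(torus \<Rightarrow> real) \<Rightarrow> torus \<Rightarrow> real"
  where "deriv_torus f p = deriv (\<lambda>x. f (torus_of x)) (rep_torus p)"


section \<open>Finite signed and vector-valued measures\<close>

text \<open>A finite signed (or vector-valued) measure on the measurable space \<open>M\<close> is a countably additive
  set function on \<open>sets M\<close>; its values on other sets are irrelevant. The measure part of \<open>M\<close> is
  never used. A finite positive measure \<open>\<mu>\<close> becomes the signed measure \<open>measure \<mu>\<close>.\<close>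

definition vector_measure :: "'a measure \<Rightarrow> ('a set \<Rightarrow> 'b::real_normed_vector) \<Rightarrow> bool"
  where "vector_measure M \<mu> \<longleftrightarrow>
    (\<forall>A::nat \<Rightarrow> 'a set. range A \<subseteq> sets M \<longrightarrow> disjoint_family A \<longrightarrow> (\<lambda>i. \<mu> (A i)) sums \<mu> (\<Union>i. A i))"

definition tv_norm :: "'a measure \<Rightarrow> ('a set \<Rightarrow> 'b::real_normed_vector) \<Rightarrow> ennreal"
  where "tv_norm M \<mu> =
    (SUP P\<in>{P. finite P \<and> disjoint P \<and> P \<subseteq> sets M}. ennreal (\<Sum>A\<in>P. norm (\<mu> A)))"

text \<open>The positive part of the Jordan decomposition; negative values of \<open>\<mu>\<close> are truncated to 0 by
  \<open>ennreal\<close>, which is harmless because of \<open>B = {}\<close>.\<close>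

definition pos_part :: "'a measure \<Rightarrow> ('a set \<Rightarrow> real) \<Rightarrow> 'a measure"
  where "pos_part M \<mu> =
    measure_of (space M) (sets M) (\<lambda>A. SUP B\<in>{B \<in> sets M. B \<subseteq> A}. ennreal (\<mu> B))"

definition signed_integral :: "'a measure \<Rightarrow> ('a set \<Rightarrow> real) \<Rightarrow> ('a \<Rightarrow> real) \<Rightarrow> real"
  where "signed_integral M \<mu> f =
    (LINT x|pos_part M \<mu>. f x) - (LINT x|pos_part M (\<lambda>A. - \<mu> A). f x)"

definition bcont :: "'a::topological_space set \<Rightarrow> ('a \<Rightarrow> real) set"
  where "bcont S = {f. continuous_on S f \<and> bounded (f ` S)}"

definition narrow_tendsto ::
    "'a::topological_space measure \<Rightarrow> ('i \<Rightarrow> 'a set \<Rightarrow> real) \<Rightarrow> ('a set \<Rightarrow> real) \<Rightarrow> 'i filter \<Rightarrow> bool"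
  where "narrow_tendsto M \<mu> \<nu> F \<longleftrightarrow>
    (\<forall>f\<in>bcont (space M). ((\<lambda>i. signed_integral M (\<mu> i) f) \<longlongrightarrow> signed_integral M \<nu> f) F)"

definition narrow_continuous_on ::
    "'a::topological_space measure \<Rightarrow> real set \<Rightarrow> (real \<Rightarrow> 'a set \<Rightarrow> real) \<Rightarrow> bool"
  where "narrow_continuous_on M I \<mu> \<longleftrightarrow>
    (\<forall>f\<in>bcont (space M). continuous_on I (\<lambda>t. signed_integral M (\<mu> t) f))"

definition prob_measure_on :: "'a measure \<Rightarrow> 'a measure \<Rightarrow> bool"
  where "prob_measure_on M \<mu> \<longleftrightarrow> prob_space \<mu> \<and> sets \<mu> = sets M"

text \<open>Measurable families \<open>(\<mu>\<^sub>t)\<close>, \<open>0 < t < T\<close>, of vector measures with integrable total variation.\<close>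

definition integrable_family ::
    "'a measure \<Rightarrow> real \<Rightarrow> (real \<Rightarrow> 'a set \<Rightarrow> 'b::{real_normed_vector}) \<Rightarrow> bool"
  where "integrable_family M T \<mu> \<longleftrightarrow>
    (\<forall>t\<in>{0<..<T}. vector_measure M (\<mu> t)) \<and>
    (\<forall>A\<in>sets M. (\<lambda>t. \<mu> t A) \<in> borel_measurable (restrict_space borel {0<..<T})) \<and>
    (\<integral>\<^sup>+t\<in>{0<..<T}. tv_norm M (\<mu> t) \<partial>lborel) < \<infinity>"


section \<open>Relative entropy\<close>

definition signed_RN_deriv :: "'a measure \<Rightarrow> ('a set \<Rightarrow> real) \<Rightarrow> 'a \<Rightarrow> real"
  where "signed_RN_deriv \<nu> \<mu> =
    (SOME f. integrable \<nu> f \<and> (\<forall>A\<in>sets \<nu>. \<mu> A = (LINT x:A|\<nu>. f x)))"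

text \<open>The integrand is nonnegative, and \<open>ln 0 = 0\<close> gives the convention \<open>0 log 0 = 0\<close>.\<close>

definition Ent :: "('a set \<Rightarrow> real) \<Rightarrow> 'a measure \<Rightarrow> ennreal"
  where "Ent \<mu> \<nu> =
    (let f = signed_RN_deriv \<nu> \<mu> in
     if (\<forall>A\<in>null_sets \<nu>. \<mu> A = 0) \<and> (AE x in \<nu>. 0 \<le> f x)
     then \<integral>\<^sup>+x. ennreal (f x * ln (f x) - f x + 1) \<partial>\<nu>
     else \<infinity>)"


section \<open>Kinetic model\<close>

definition Omega :: "real \<Rightarrow> (torus \<times> real) measure"
  where "Omega V = restrict_space borel (UNIV \<times> {-V, V})"

definition flip :: "torus \<times> real \<Rightarrow> torus \<times> real"
  where "flip z = (fst z, - snd z)"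

definition pi_measure :: "real \<Rightarrow> (torus \<times> real) measure"
  where "pi_measure V = lebesgue_torus \<Otimes>\<^sub>M uniform_count_measure {-V, V}"

lemma sets_pi_measure: "sets (pi_measure V) = sets (Omega V)"
proof -
  have *: "sets (restrict_space borel {-V, V}) = Pow {-V, V}"
  proof (intro equalityI subsetI)
    fix A assume "A \<in> Pow {-V, V}"
    then have A: "finite A" "A = {-V, V} \<inter> A"
      by (auto intro: finite_subset)
    then have "A \<in> sets borel"
      by (intro borel_closed finite_imp_closed)
    with A(2) show "A \<in> sets (restrict_space borel {-V, V})"
      unfolding sets_restrict_space by (rule image_eqI)
  next
    fix A assume "A \<in> sets (restrict_space borel {-V, V})"
    then show "A \<in> Pow {-V, V}"
      unfolding sets_restrict_space by blast
  qed
  let ?P = "borel \<Otimes>\<^sub>M restrict_space borel {-V, V} :: (torus \<times> real) measure"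
  have pi: "sets (pi_measure V) = sets ?P"
    unfolding pi_measure_def
    by (rule sets_pair_measure_cong)
       (simp_all add: lebesgue_torus_def * sets_uniform_count_measure)
  have sp: "space ?P = UNIV \<times> {-V, V}" "space (Omega V) = UNIV \<times> {-V, V}"
    by (simp_all add: space_pair_measure space_restrict_space Omega_def)
  have "(\<lambda>z. (fst z, snd z)) \<in> ?P \<rightarrow>\<^sub>M borel \<Otimes>\<^sub>M borel"
    by (intro measurable_Pair measurable_compose[OF measurable_snd] measurable_restrict_space1) auto
  then have 1: "(\<lambda>z. z) \<in> ?P \<rightarrow>\<^sub>M Omega V"
    unfolding Omega_def borel_prod by (intro measurable_restrict_space2) (auto simp: sp(1))
  have fs: "fst \<in> Omega V \<rightarrow>\<^sub>M borel" "snd \<in> Omega V \<rightarrow>\<^sub>M borel"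
    unfolding Omega_def borel_prod[symmetric] by (auto intro: measurable_restrict_space1)
  then have "(\<lambda>z. (fst z, snd z)) \<in> Omega V \<rightarrow>\<^sub>M ?P"
    by (intro measurable_Pair measurable_restrict_space2) (auto simp: sp(2))
  then have 2: "(\<lambda>z. z) \<in> Omega V \<rightarrow>\<^sub>M ?P"
    by simp
  have "sets (Omega V) = sets ?P"
  proof (intro equalityI subsetI)
    fix A assume A: "A \<in> sets (Omega V)"
    then have "A \<subseteq> space ?P"
      using sets.sets_into_space[OF A] sp by simp
    with measurable_sets[OF 1 A] show "A \<in> sets ?P"
      by (simp add: Int_absorb2)
  next
    fix A assume A: "A \<in> sets ?P"
    then have "A \<subseteq> space (Omega V)"
      using sets.sets_into_space[OF A] sp by simp
    with measurable_sets[OF 2 A] show "A \<in> sets (Omega V)"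
      by (simp add: Int_absorb2)
  qed
  with pi show ?thesis
    by simp
qed

definition C10 :: "real \<Rightarrow> (torus \<times> real \<Rightarrow> real) \<Rightarrow> bool"
  where "C10 V \<phi> \<longleftrightarrow> (\<forall>v\<in>{-V, V}. C1_torus (\<lambda>x. \<phi> (x, v)))"

definition dx :: "(torus \<times> real \<Rightarrow> real) \<Rightarrow> torus \<times> real \<Rightarrow> real"
  where "dx \<phi> z = deriv_torus (\<lambda>x. \<phi> (x, snd z)) (fst z)"

definition CE ::
    "real \<Rightarrow> real \<Rightarrow> (real \<Rightarrow> (torus \<times> real) measure) \<Rightarrow>
     (real \<Rightarrow> (torus \<times> real) set \<Rightarrow> real \<times> real) \<Rightarrow> bool"
  where "CE V T \<sigma> j \<longleftrightarrow>
    (\<forall>t\<in>{0..T}. prob_measure_on (Omega V) (\<sigma> t)) \<and>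
    narrow_continuous_on (Omega V) {0..T} (\<lambda>t. measure (\<sigma> t)) \<and>
    integrable_family (Omega V) T j \<and>
    (\<forall>\<phi> s t. C10 V \<phi> \<longrightarrow> 0 \<le> s \<longrightarrow> s \<le> t \<longrightarrow> t \<le> T \<longrightarrow>
      (LINT z|\<sigma> t. \<phi> z) - (LINT z|\<sigma> s. \<phi> z) =
      (LINT r:{s<..<t}|lborel.
         signed_integral (Omega V) (\<lambda>A. fst (j r A)) (dx \<phi>) +
         signed_integral (Omega V) (\<lambda>A. snd (j r A)) (\<lambda>z. \<phi> (flip z) - \<phi> z)))"

definition lagrangian ::
    "real \<Rightarrow> real \<Rightarrow> (torus \<times> real) measure \<Rightarrow> ((torus \<times> real) set \<Rightarrow> real \<times> real) \<Rightarrow> ennreal"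
  where "lagrangian V l \<sigma> j =
    (if \<forall>A\<in>sets (Omega V). fst (j A) = (LINT z:A|\<sigma>. snd z)
     then Ent (\<lambda>A. snd (j A)) (scale_measure (ennreal l) \<sigma>)
     else \<infinity>)"

definition action ::
    "real \<Rightarrow> real \<Rightarrow> real \<Rightarrow> (real \<Rightarrow> (torus \<times> real) measure) \<Rightarrow>
     (real \<Rightarrow> (torus \<times> real) set \<Rightarrow> real \<times> real) \<Rightarrow> ennreal"
  where "action V T l \<sigma> j =
    (if CE V T \<sigma> j then \<integral>\<^sup>+t\<in>{0<..<T}. lagrangian V l (\<sigma> t) (j t) \<partial>lborel else \<infinity>)"


section \<open>Macroscopic quantities\<close>

definition rho_of :: "real \<Rightarrow> (torus \<times> real) measure \<Rightarrow> torus set \<Rightarrow> real"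
  where "rho_of V \<sigma> A = (\<Sum>v\<in>{-V, V}. measure \<sigma> (A \<times> {v}))"

definition omega_of :: "real \<Rightarrow> (torus \<times> real) measure \<Rightarrow> torus set \<Rightarrow> real"
  where "omega_of V \<sigma> A = (\<Sum>v\<in>{-V, V}. v * measure \<sigma> (A \<times> {v}))"

definition J_of :: "real \<Rightarrow> ((torus \<times> real) set \<Rightarrow> real \<times> real) \<Rightarrow> torus set \<Rightarrow> real"
  where "J_of V j A = (\<Sum>v\<in>{-V, V}. v * snd (j (A \<times> {v})))"

definition ST :: "real \<Rightarrow> (real \<times> torus) measure"
  where "ST T = restrict_space borel ({0<..<T} \<times> UNIV)"

text \<open>The space-time measure \<open>\<mu>\<^sub>t(dx) dt\<close>.\<close>

definition spacetime :: "real \<Rightarrow> (real \<Rightarrow> torus set \<Rightarrow> real) \<Rightarrow> (real \<times> torus) set \<Rightarrow> real"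
  where "spacetime T \<mu> B = (LINT t:{0<..<T}|lborel. \<mu> t {x. (t, x) \<in> B})"

definition ME ::
    "real \<Rightarrow> real \<Rightarrow> (real \<Rightarrow> torus measure) \<Rightarrow> (real \<Rightarrow> torus set \<Rightarrow> real) \<Rightarrow>
     (real \<Rightarrow> torus set \<Rightarrow> real) \<Rightarrow> bool"
  where "ME V T \<rho> \<omega> K \<longleftrightarrow>
    (\<forall>t\<in>{0..T}. prob_measure_on borel (\<rho> t)) \<and>
    narrow_continuous_on borel {0..T} (\<lambda>t. measure (\<rho> t)) \<and>
    (\<forall>t\<in>{0..T}. vector_measure borel (\<omega> t)) \<and>
    narrow_continuous_on borel {0..T} \<omega> \<and>
    integrable_family borel T K \<and>
    (\<forall>\<phi> s t. C1_torus \<phi> \<longrightarrow> 0 \<le> s \<longrightarrow> s \<le> t \<longrightarrow> t \<le> T \<longrightarrow>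
      (LINT x|\<rho> t. \<phi> x) - (LINT x|\<rho> s. \<phi> x) =
      (LINT r:{s<..<t}|lborel. signed_integral borel (\<omega> r) (deriv_torus \<phi>))) \<and>
    (\<forall>\<psi> s t. C1_torus \<psi> \<longrightarrow> 0 \<le> s \<longrightarrow> s \<le> t \<longrightarrow> t \<le> T \<longrightarrow>
      signed_integral borel (\<omega> t) \<psi> - signed_integral borel (\<omega> s) \<psi> =
      V\<^sup>2 * (LINT r:{s<..<t}|lborel. (LINT x|\<rho> r. deriv_torus \<psi> x))
      - 2 * (LINT r:{s<..<t}|lborel. signed_integral borel (K r) \<psi>))"

text \<open>The limit functional. Here \<open>\<rho>\<close> is a family of probability measures defined for every time,
  whereas \<open>\<omega>\<close> and \<open>J\<close> are signed measures on \<open>(0,T) \<times> torus\<close>; they are identified with families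
  \<open>w\<close> (the narrowly continuous representative, by \<^const>\<open>ME\<close>) and \<open>K\<close> such that
  \<open>\<omega> = w\<^sub>t(dx) dt\<close> and \<open>J = K\<^sub>t(dx) dt\<close>.\<close>

definition Jbar ::
    "real \<Rightarrow> real \<Rightarrow> (real \<Rightarrow> torus measure) \<Rightarrow> ((real \<times> torus) set \<Rightarrow> real) \<Rightarrow>
     ((real \<times> torus) set \<Rightarrow> real) \<Rightarrow> ennreal"
  where "Jbar V T \<rho> \<omega> J =
    (if (\<exists>w K. (\<forall>B\<in>sets (ST T). \<omega> B = spacetime T w B) \<and>
               (\<forall>B\<in>sets (ST T). J B = spacetime T K B) \<and> ME V T \<rho> w K) \<and>
        (\<forall>B\<in>sets (ST T). J B = 0)
     then 0 else \<infinity>)"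

end

(*
  Since the limit functional takes only the values 0 and infinity, one has to show that J = 0 and
  that rho and omega solve the wave system. The variational bound
    Ent(j | l sigma) >= a |<j, g>| - l exp (a c)    for |g| <= c and every a > 0
  shows that the jump flux tested with g has time integral at most (C + l T exp (a c)) / a; letting
  first l -> 0 and then a -> infinity kills J and the jump term of the continuity equation. Hence
  t |-> omega^l_t(psi) is, up to a vanishing error, Lipschitz for psi in C^1, and comparing with its
  averages against tent functions the narrow convergence in space-time improves to convergence at
  every time t. The limit functional is represented by a measure w_t by Helly's selection theorem.
*)
theory Submission
  imports Defs
begin

section \<open>The metric of the torus\<close>

lemma torus_cases: obtains x where "p = torus_of x"
  by (metis torus_of_rep)

lemma torus_of_add_int: "torus_of (x + of_int k) = torus_of x"
  by (simp add: torus_of_eq_iff)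

instantiation torus :: metric_space
begin

definition dist_torus :: "torus \<Rightarrow> torus \<Rightarrow> real"
  where "dist_torus p q = (let d = rep_torus p - rep_torus q in \<bar>d - of_int (round d)\<bar>)"

definition uniformity_torus :: "(torus \<times> torus) filter"
  where "uniformity_torus = (INF e\<in>{0 <..}. principal {(x, y). dist x y < e})"

lemma dist_torus_le: "dist (torus_of x) (torus_of y) \<le> \<bar>x - y\<bar>"
proof -
  define d where "d = rep_torus (torus_of x) - rep_torus (torus_of y)"
  have "rep_torus (torus_of x) - x \<in> \<int>" "rep_torus (torus_of y) - y \<in> \<int>"
    by (simp_all add: torus_of_rep flip: torus_of_eq_iff)
  then have "(rep_torus (torus_of x) - x) - (rep_torus (torus_of y) - y) \<in> \<int>"
    by (rule Ints_diff)
  then obtain k where "d - (x - y) = of_int k"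
    by (auto simp: d_def algebra_simps elim: Ints_cases)
  then have "\<bar>x - y\<bar> = \<bar>d - of_int k\<bar>"
    by simp
  with round_diff_minimal[of d k] show ?thesis
    by (simp add: dist_torus_def Let_def d_def abs_minus_commute)
qed

lemma dist_torus_obtain:
  obtains y where "q = torus_of y" "dist (torus_of x) q = \<bar>x - y\<bar>"
proof -
  define d where "d = rep_torus (torus_of x) - rep_torus q"
  define y where "y = x - (d - of_int (round d))"
  have "rep_torus (torus_of x) - x \<in> \<int>"
    by (simp add: torus_of_rep flip: torus_of_eq_iff)
  then obtain k where "rep_torus (torus_of x) - x = of_int k"
    by (auto elim: Ints_cases)
  then have "y = rep_torus q + of_int (round d - k)"
    by (simp add: y_def d_def)
  then have "torus_of y = q"
    by (simp only: torus_of_add_int torus_of_rep)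
  then show ?thesis
    by (intro that[of y]) (simp_all add: y_def dist_torus_def Let_def d_def)
qed

instance
proof
  show "(uniformity :: (torus \<times> torus) filter) = (INF e\<in>{0 <..}. principal {(x, y). dist x y < e})"
    by (rule uniformity_torus_def)
next
  fix p q :: torus
  obtain x where p: "p = torus_of x" by (rule torus_cases)
  obtain y where "q = torus_of y" "dist p q = \<bar>x - y\<bar>"
    unfolding p by (rule dist_torus_obtain)
  with p show "dist p q = 0 \<longleftrightarrow> p = q"
    using dist_torus_le[of x x] by (auto simp: dist_torus_def)
next
  fix p q r :: torus
  obtain z where r: "r = torus_of z" by (rule torus_cases)
  obtain x where p: "p = torus_of x" "dist r p = \<bar>z - x\<bar>"
    unfolding r by (rule dist_torus_obtain)
  obtain y where q: "q = torus_of y" "dist r q = \<bar>z - y\<bar>"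
    unfolding r by (rule dist_torus_obtain)
  have sym: "dist a b \<le> dist b a" for a b :: torus
  proof -
    obtain x where a: "b = torus_of x" by (rule torus_cases)
    obtain y where "a = torus_of y" "dist b a = \<bar>x - y\<bar>"
      unfolding a by (rule dist_torus_obtain)
    then show ?thesis
      using dist_torus_le[of y x] a by (simp add: abs_minus_commute)
  qed
  then have sym: "dist a b = dist b a" for a b :: torus
    by (intro antisym)
  have "dist p q \<le> \<bar>x - y\<bar>"
    unfolding p q by (rule dist_torus_le)
  also have "\<dots> \<le> dist p r + dist q r"
    by (simp add: sym[of _ r] p(2) q(2))
  finally show "dist p q \<le> dist p r + dist q r" .
next
  fix U :: "torus set"
  have "open U \<longleftrightarrow> (\<forall>p\<in>U. \<exists>e>0. \<forall>q. dist p q < e \<longrightarrow> q \<in> U)"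
  proof safe
    fix p assume "open U" "p \<in> U"
    obtain x where p: "p = torus_of x" by (rule torus_cases)
    have "open (torus_of -` U)" "x \<in> torus_of -` U"
      using \<open>open U\<close> \<open>p \<in> U\<close> p by (auto simp: open_torus_def)
    then obtain e where e: "e > 0" "\<And>y. \<bar>x - y\<bar> < e \<Longrightarrow> torus_of y \<in> U"
      by (force simp: open_dist dist_real_def abs_minus_commute)
    show "\<exists>e>0. \<forall>q. dist p q < e \<longrightarrow> q \<in> U"
      using e p by (metis dist_torus_obtain)
  next
    assume *: "\<forall>p\<in>U. \<exists>e>0. \<forall>q. dist p q < e \<longrightarrow> q \<in> U"
    show "open U"
      unfolding open_torus_def open_dist
    proof (intro ballI)
      fix x assume "x \<in> torus_of -` U"
      then obtain e where e: "e > 0" "\<And>q. dist (torus_of x) q < e \<Longrightarrow> q \<in> U"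
        using * by auto
      have "torus_of y \<in> U" if "dist y x < e" for y
        using that dist_torus_le[of x y] by (intro e) (simp add: dist_real_def abs_minus_commute)
      with e show "\<exists>e>0. \<forall>y. dist y x < e \<longrightarrow> y \<in> torus_of -` U"
        by auto
    qed
  qed
  then show "open U \<longleftrightarrow> (\<forall>x\<in>U. \<forall>\<^sub>F (x', y) in uniformity. x' = x \<longrightarrow> y \<in> U)"
    unfolding uniformity_torus_def
    by (subst eventually_INF_base)
       (auto simp: eventually_principal Bex_def subset_eq intro: exI[of _ "min _ _"])
qed

end

lemma compact_UNIV_torus: "compact (UNIV :: torus set)"
proof -
  have "torus_of ` {0..1} = UNIV"
  proof (intro set_eqI iffI UNIV_I)
    fix p
    obtain x where "p = torus_of x" by (rule torus_cases)
    then have "p = torus_of (frac x)"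
      by (simp add: torus_of_eq_iff frac_def)
    then show "p \<in> torus_of ` {0..1}"
      by (auto intro!: imageI simp: frac_ge_0 less_imp_le[OF frac_lt_1])
  qed
  then show ?thesis
    using compact_continuous_image[OF continuous_on_torus_of, of "{0..1}"] by simp
qed

lemma continuous_on_torus_lift:
  fixes f :: "torus \<Rightarrow> 'a::topological_space"
  assumes "continuous_on UNIV (\<lambda>x. f (torus_of x))"
  shows "continuous_on UNIV f"
proof -
  have "open (f -` U)" if "open U" for U
    using assms that by (auto simp: open_torus_def continuous_on_open_vimage vimage_def)
  then show ?thesis
    by (simp add: continuous_on_open_vimage)
qed

lemma bounded_torus:
  fixes f :: "torus \<Rightarrow> real"
  assumes "continuous_on UNIV f"
  obtains K where "K > 0" "\<And>p. \<bar>f p\<bar> \<le> K"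
proof -
  have "bounded (range f)"
    using compact_continuous_image[OF assms compact_UNIV_torus] compact_imp_bounded by blast
  then show ?thesis
    using that unfolding bounded_pos by auto
qed

lemma deriv_torus_of:
  "C1_torus f \<Longrightarrow> deriv_torus f (torus_of x) = deriv (\<lambda>x. f (torus_of x)) x"
proof -
  assume "C1_torus f"
  have "rep_torus (torus_of x) - x \<in> \<int>"
    by (simp add: torus_of_rep flip: torus_of_eq_iff)
  then obtain k where k: "rep_torus (torus_of x) = x + of_int k"
    by (auto simp: algebra_simps elim!: Ints_cases)
  have per: "f (torus_of (y + of_int k)) = f (torus_of y)" for y
    by (simp add: torus_of_add_int)
  have "((\<lambda>x. f (torus_of x)) has_field_derivative D) (at (x + of_int k)) \<longleftrightarrow>
        ((\<lambda>x. f (torus_of x)) has_field_derivative D) (at x)" for D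
    using DERIV_shift[of "\<lambda>x. f (torus_of x)" D x "of_int k"] by (simp add: per)
  then show ?thesis
    by (simp add: deriv_torus_def deriv_def k)
qed

lemma C1_torus_continuous: "C1_torus f \<Longrightarrow> continuous_on UNIV f"
  unfolding C1_torus_def
  by (intro continuous_on_torus_lift C1_differentiable_imp_continuous_on)

lemma C1_torus_continuous_deriv: "C1_torus f \<Longrightarrow> continuous_on UNIV (deriv_torus f)"
proof -
  assume f: "C1_torus f"
  then obtain D where D: "\<And>x. ((\<lambda>x. f (torus_of x)) has_real_derivative D x) (at x)" "continuous_on UNIV D"
    unfolding C1_torus_def C1_differentiable_on_def has_real_derivative_iff_has_vector_derivative by auto
  then have "deriv_torus f (torus_of x) = D x" for x
    by (simp add: deriv_torus_of[OF f] DERIV_imp_deriv)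
  with D(2) show ?thesis
    by (intro continuous_on_torus_lift) simp
qed

lemma C1_torus_dense:
  fixes f :: "torus \<Rightarrow> real"
  assumes "continuous_on UNIV f" "e > 0"
  obtains g where "C1_torus g" "\<And>p. \<bar>f p - g p\<bar> < e"
proof -
  interpret function_ring_on "{f. C1_torus f}" UNIV
  proof
    show "compact (UNIV :: torus set)" by (rule compact_UNIV_torus)
    show "continuous_on UNIV f" if "f \<in> {f. C1_torus f}" for f
      using that by (simp add: C1_torus_continuous)
    show "\<exists>f\<in>{f. C1_torus f}. f p \<noteq> f q" if "p \<noteq> q" for p q
    proof (rule ccontr)
      assume *: "\<not> (\<exists>f\<in>{f. C1_torus f}. f p \<noteq> f q)"
      have per: "sin (2 * pi * rep_torus (torus_of x)) = sin (2 * pi * x)"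
           "cos (2 * pi * rep_torus (torus_of x)) = cos (2 * pi * x)" for x
      proof -
        have "rep_torus (torus_of x) - x \<in> \<int>"
          by (simp add: torus_of_rep flip: torus_of_eq_iff)
        then obtain k where k: "rep_torus (torus_of x) = x + of_int k"
          by (auto simp: algebra_simps elim!: Ints_cases)
        then show "sin (2 * pi * rep_torus (torus_of x)) = sin (2 * pi * x)"
           "cos (2 * pi * rep_torus (torus_of x)) = cos (2 * pi * x)"
          unfolding sin_cos_eq_iff[symmetric] by (auto simp: sin_add cos_add distrib_left)
      qed
      have "C1_torus (\<lambda>p. sin (2 * pi * rep_torus p))" "C1_torus (\<lambda>p. cos (2 * pi * rep_torus p))"
        unfolding C1_torus_def per C1_differentiable_on_def
        by (rule exI[of _ "\<lambda>x. 2 * pi * cos (2 * pi * x)"] exI[of _ "\<lambda>x. - (2 * pi * sin (2 * pi * x))"],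
            auto intro!: derivative_eq_intros continuous_intros
              simp flip: has_real_derivative_iff_has_vector_derivative)+
      with * have "sin (2 * pi * rep_torus p) = sin (2 * pi * rep_torus q)"
        "cos (2 * pi * rep_torus p) = cos (2 * pi * rep_torus q)"
        by auto
      then obtain n where "2 * pi * rep_torus p = 2 * pi * rep_torus q + 2 * pi * of_int n"
        using sin_cos_eq_iff by metis
      then have "rep_torus p = rep_torus q + of_int n"
        by (metis distrib_left mult_cancel_left pi_neq_zero mult_eq_0_iff zero_neq_numeral)
      then have "torus_of (rep_torus p) = torus_of (rep_torus q)"
        by (simp add: torus_of_eq_iff)
      with that show False by (simp add: torus_of_rep)
    qed
  qed (auto simp: C1_torus_def intro: C1_differentiable_on_add C1_differentiable_on_mult)
  show ?thesis
    using Stone_Weierstrass_basic[OF assms] that by auto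
qed

definition unit_rep :: "torus \<Rightarrow> real"
  where "unit_rep p = frac (rep_torus p)"

lemma unit_rep: "torus_of (unit_rep p) = p" "0 \<le> unit_rep p" "unit_rep p < 1"
proof -
  have "torus_of (unit_rep p) = torus_of (rep_torus p)"
    by (simp add: torus_of_eq_iff unit_rep_def frac_def)
  then show "torus_of (unit_rep p) = p" by (simp add: torus_of_rep)
qed (simp_all add: unit_rep_def frac_ge_0 frac_lt_1)

lemma unit_rep_measurable [measurable]: "unit_rep \<in> borel_measurable borel"
  unfolding borel_measurable_iff_le
proof (intro allI)
  fix a :: real
  consider "a < 0" | "a \<ge> 1" | "0 \<le> a" "a < 1" by linarith
  then show "{w \<in> space borel. unit_rep w \<le> a} \<in> sets borel"
  proof cases
    case 3
    have "{w. unit_rep w \<le> a} = torus_of ` {0..a}"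
    proof safe
      fix p assume "unit_rep p \<le> a"
      then show "p \<in> torus_of ` {0..a}"
        by (intro image_eqI[of _ _ "unit_rep p"]) (simp_all add: unit_rep)
    next
      fix x assume x: "x \<in> {0..a}"
      have "torus_of (unit_rep (torus_of x)) = torus_of x" by (simp add: unit_rep)
      then obtain k where "unit_rep (torus_of x) - x = of_int k"
        by (auto simp: torus_of_eq_iff elim: Ints_cases)
      moreover from this have "\<bar>of_int k :: real\<bar> < 1"
        using x 3 unit_rep(2,3)[of "torus_of x"] by auto
      then have "k = 0" by linarith
      ultimately show "unit_rep (torus_of x) \<le> a"
        using x by simp
    qed
    moreover have "closed (torus_of ` {0..a})"
      by (intro compact_imp_closed compact_continuous_image continuous_on_torus_of) simp
    ultimately show ?thesis by simp
  next
    case 1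
    then have "\<And>w. \<not> unit_rep w \<le> a"
      using unit_rep(2) by (meson le_less_trans not_less)
    then show ?thesis by simp
  next
    case 2
    then have "\<And>w. unit_rep w \<le> a"
      using unit_rep(3) by (meson le_less_trans less_imp_le not_less)
    then show ?thesis by simp
  qed
qed

section \<open>Bounded measurable functions and integral functionals\<close>

definition bmeas :: "'a measure \<Rightarrow> ('a \<Rightarrow> real) set"
  where "bmeas M = {f \<in> borel_measurable M. bounded (f ` space M)}"

lemma bmeasI:
  "f \<in> borel_measurable M \<Longrightarrow> (\<And>x. x \<in> space M \<Longrightarrow> \<bar>f x\<bar> \<le> K) \<Longrightarrow> f \<in> bmeas M"
  by (auto simp: bmeas_def bounded_iff intro!: exI[of _ K])

lemma bmeasE:
  assumes "f \<in> bmeas M"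
  obtains K where "f \<in> borel_measurable M" "K > 0" "\<And>x. x \<in> space M \<Longrightarrow> \<bar>f x\<bar> \<le> K"
  using assms unfolding bmeas_def bounded_pos by auto

lemma bmeas_measurable: "f \<in> bmeas M \<Longrightarrow> f \<in> borel_measurable M"
  by (simp add: bmeas_def)

lemma bmeas_const [simp, intro]: "(\<lambda>x. c) \<in> bmeas M"
  by (intro bmeasI[of _ _ "\<bar>c\<bar>"]) auto

lemma bmeas_indicator [intro]: "A \<in> sets M \<Longrightarrow> indicator A \<in> bmeas M"
  by (intro bmeasI[of _ _ 1]) (auto simp: indicator_def)

lemma bmeas_add [intro]: "f \<in> bmeas M \<Longrightarrow> g \<in> bmeas M \<Longrightarrow> (\<lambda>x. f x + g x) \<in> bmeas M"
proof -
  assume "f \<in> bmeas M" "g \<in> bmeas M"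
  then obtain K L where "f \<in> borel_measurable M" "g \<in> borel_measurable M"
    "\<And>x. x \<in> space M \<Longrightarrow> \<bar>f x\<bar> \<le> K" "\<And>x. x \<in> space M \<Longrightarrow> \<bar>g x\<bar> \<le> L"
    by (metis bmeasE)
  then show ?thesis
    by (intro bmeasI[of _ _ "K + L"]) (auto intro: order_trans[OF abs_triangle_ineq] add_mono)
qed

lemma bmeas_mult [intro]: "f \<in> bmeas M \<Longrightarrow> g \<in> bmeas M \<Longrightarrow> (\<lambda>x. f x * g x) \<in> bmeas M"
proof -
  assume "f \<in> bmeas M" "g \<in> bmeas M"
  then obtain K L where "f \<in> borel_measurable M" "g \<in> borel_measurable M" "K > 0"
    "\<And>x. x \<in> space M \<Longrightarrow> \<bar>f x\<bar> \<le> K" "\<And>x. x \<in> space M \<Longrightarrow> \<bar>g x\<bar> \<le> L"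
    by (metis bmeasE)
  then show ?thesis
    by (intro bmeasI[of _ _ "K * L"]) (auto simp: abs_mult intro!: mult_mono)
qed

lemma bmeas_compose:
  assumes "f \<in> bmeas M" "h \<in> N \<rightarrow>\<^sub>M M"
  shows "(\<lambda>x. f (h x)) \<in> bmeas N"
proof -
  obtain K where "f \<in> borel_measurable M" "\<And>x. x \<in> space M \<Longrightarrow> \<bar>f x\<bar> \<le> K"
    using assms(1) by (metis bmeasE)
  then show ?thesis
    using assms(2) by (intro bmeasI[of _ _ K]) (auto dest: measurable_space)
qed

lemma bmeas_cong_sets: "sets M = sets N \<Longrightarrow> bmeas M = bmeas N"
  by (simp add: bmeas_def cong: measurable_cong_sets sets_eq_imp_space_eq)

lemma bcont_bmeas: "f \<in> bcont S \<Longrightarrow> S \<in> sets borel \<Longrightarrow> f \<in> bmeas (restrict_space borel S)"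
  by (auto simp: bcont_def bmeas_def space_restrict_space intro: borel_measurable_continuous_on_restrict)

lemma integrable_bmeas: "finite_measure \<nu> \<Longrightarrow> f \<in> bmeas \<nu> \<Longrightarrow> integrable \<nu> f"
  by (elim bmeasE) (rule finite_measure.integrable_const_bound, auto)

lemma bmeas_induct:
  fixes P :: "('a \<Rightarrow> real) \<Rightarrow> bool"
  assumes f: "f \<in> bmeas M"
    and G: "Int_stable G" "G \<subseteq> Pow (space M)" "sets M = sigma_sets (space M) G"
    and ind: "\<And>A. A \<in> G \<Longrightarrow> P (indicator A)" and one: "P (\<lambda>_. 1)"
    and add: "\<And>f g. f \<in> bmeas M \<Longrightarrow> g \<in> bmeas M \<Longrightarrow> P f \<Longrightarrow> P g \<Longrightarrow> P (\<lambda>x. f x + g x)"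
    and scale: "\<And>c f. f \<in> bmeas M \<Longrightarrow> P f \<Longrightarrow> P (\<lambda>x. c * f x)"
    and lim: "\<And>F f K. f \<in> bmeas M \<Longrightarrow> (\<And>n. F n \<in> bmeas M) \<Longrightarrow> (\<And>n. P (F n)) \<Longrightarrow>
      (\<And>n x. x \<in> space M \<Longrightarrow> \<bar>F n x\<bar> \<le> K) \<Longrightarrow>
      (\<And>x. x \<in> space M \<Longrightarrow> (\<lambda>n::nat. F n x) \<longlonglongrightarrow> f x) \<Longrightarrow> P f"
  shows "P f"
proof -
  have zero: "P (\<lambda>_. 0)"
    using scale[OF bmeas_const one, of 0] by simp
  have Sum: "P (\<lambda>x. \<Sum>i\<in>I. g i x)" "(\<lambda>x. \<Sum>i\<in>I. g i x) \<in> bmeas M"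
    if "finite I" "\<And>i. i \<in> I \<Longrightarrow> P (g i)" "\<And>i. i \<in> I \<Longrightarrow> g i \<in> bmeas M"
    for I :: "'i set" and g
    using that by (induction I rule: finite_induct) (auto simp: zero intro!: add)
  have setP: "P (indicator A)" if "A \<in> sigma_sets (space M) G" for A
    using G(1,2) that
  proof (induction rule: sigma_sets_induct_disjoint)
    case (basic A)
    then show ?case by (rule ind)
  next
    case empty
    with zero show ?case by (simp add: indicator_def)
  next
    case (compl A)
    then have A: "A \<in> sets M" by (simp add: G)
    then have "(\<lambda>x. (-1) * indicator A x :: real) \<in> bmeas M"
      by (intro bmeas_mult bmeas_indicator bmeas_const)
    moreover have "P (\<lambda>x. (-1) * indicator A x)"
      by (rule scale) (use A compl in auto)
    ultimately have 1: "P (\<lambda>x. 1 + (-1) * indicator A x)" "(\<lambda>x. 1 + (-1) * indicator A x :: real) \<in> bmeas M"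
      by - (rule add[OF bmeas_const _ one], assumption+, rule bmeas_add[OF bmeas_const])
    show ?case
      by (rule lim[OF bmeas_indicator 1(2) 1(1), of _ 2]) (use A in \<open>auto simp: indicator_def\<close>)
  next
    case (union A)
    then have A: "A i \<in> sets M" for i by (auto simp: G)
    show ?case
    proof (rule lim[of _ "\<lambda>n x. \<Sum>i<n. indicator (A i) x" 1])
      show "P (\<lambda>x. \<Sum>i<n. indicator (A i) x)" "(\<lambda>x. \<Sum>i<n. indicator (A i) x) \<in> bmeas M" for n
        using union A by (auto intro!: Sum)
      have *: "(\<Sum>i<n. indicator (A i) x :: real) = indicator (\<Union>i<n. A i) x" for n x
        by (rule indicator_UN_disjoint[symmetric]) (use union(1) in \<open>auto simp: disjoint_family_on_def\<close>)
      show "\<bar>\<Sum>i<n. indicator (A i) x\<bar> \<le> (1::real)" for n x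
        unfolding * by (simp add: indicator_def)
      show "(\<lambda>n. \<Sum>i<n. indicator (A i) x) \<longlonglongrightarrow> (indicator (\<Union>i. A i) x :: real)" for x
        unfolding * by (rule LIMSEQ_indicator_UN)
    qed (use A in auto)
  qed
  obtain K where K: "f \<in> borel_measurable M" "\<And>x. x \<in> space M \<Longrightarrow> \<bar>f x\<bar> \<le> K"
    using f by (metis bmeasE)
  then obtain F where F: "\<And>i. simple_function M (F i)"
      "\<And>x. x \<in> space M \<Longrightarrow> (\<lambda>i. F i x) \<longlonglongrightarrow> f x"
      "\<And>i x. x \<in> space M \<Longrightarrow> norm (F i x) \<le> 2 * norm (f x)"
    using borel_measurable_implies_sequence_metric[of f M 0] by (simp add: dist_norm) blast
  have FS: "P (F i)" for i
  proof -
    let ?S = "\<lambda>x. \<Sum>y\<in>F i ` space M. y * indicator (F i -` {y} \<inter> space M) x"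
    have fin: "finite (F i ` space M)"
      using F(1) by (simp add: simple_function_def)
    have m: "F i -` {y} \<inter> space M \<in> sets M" for y
      using F(1) by (simp add: simple_functionD)
    have "P (indicator (F i -` {y} \<inter> space M))" "(indicator (F i -` {y} \<inter> space M) :: _ \<Rightarrow> real) \<in> bmeas M" for y
      using m setP by (simp_all add: bmeas_indicator flip: G(3))
    then have "P (\<lambda>x. y * indicator (F i -` {y} \<inter> space M) x)"
      "(\<lambda>x. y * indicator (F i -` {y} \<inter> space M) x) \<in> bmeas M" for y
      by - (rule scale bmeas_mult[OF bmeas_const]; assumption)+
    then have 1: "P ?S" "?S \<in> bmeas M"
      by - (rule Sum[OF fin]; assumption)+
    have eq: "F i x = ?S x" if "x \<in> space M" for x
      using that fin by (simp add: indicator_def if_distrib sum.delta cong: if_cong)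
    have "\<bar>F i x\<bar> \<le> 2 * K" if "x \<in> space M" for x
      using F(3)[OF that, of i] K(2)[OF that] by simp
    then have b: "F i \<in> bmeas M"
      using F(1) by (intro bmeasI[of _ _ "2 * K"]) (auto intro: borel_measurable_simple_function)
    then obtain L where "\<And>x. x \<in> space M \<Longrightarrow> \<bar>F i x\<bar> \<le> L"
      by (metis bmeasE)
    then show ?thesis
      by (intro lim[OF b 1(2) 1(1), of L]) (simp_all add: eq[symmetric])
  qed
  have FK: "\<bar>F i x\<bar> \<le> 2 * K" if "x \<in> space M" for x i
    using F(3)[OF that, of i] K(2)[OF that] by simp
  show ?thesis
    by (rule lim[OF f _ FS FK F(2)])
       (auto intro!: bmeasI[of _ _ "2 * K"] FK borel_measurable_simple_function F)
qed

lemma bcont_induct: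
  fixes P :: "('a::metric_space \<Rightarrow> real) \<Rightarrow> bool"
  assumes f: "f \<in> bmeas (restrict_space borel S)" and S: "S \<in> sets borel"
    and cont: "\<And>f. f \<in> bcont S \<Longrightarrow> P f"
    and add: "\<And>f g. f \<in> bmeas (restrict_space borel S) \<Longrightarrow> g \<in> bmeas (restrict_space borel S) \<Longrightarrow>
      P f \<Longrightarrow> P g \<Longrightarrow> P (\<lambda>x. f x + g x)"
    and scale: "\<And>c f. f \<in> bmeas (restrict_space borel S) \<Longrightarrow> P f \<Longrightarrow> P (\<lambda>x. c * f x)"
    and lim: "\<And>F f K. f \<in> bmeas (restrict_space borel S) \<Longrightarrow>
      (\<And>n. F n \<in> bmeas (restrict_space borel S)) \<Longrightarrow> (\<And>n. P (F n)) \<Longrightarrow>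
      (\<And>n x. x \<in> S \<Longrightarrow> \<bar>F n x\<bar> \<le> K) \<Longrightarrow>
      (\<And>x. x \<in> S \<Longrightarrow> (\<lambda>n::nat. F n x) \<longlonglongrightarrow> f x) \<Longrightarrow> P f"
  shows "P f"
proof (rule bmeas_induct[OF f])
  let ?G = "(\<inter>) S ` Collect closed"
  have sp: "space (restrict_space borel S) = S"
    by (simp add: space_restrict_space)
  show "Int_stable ?G"
    unfolding Int_stable_def
  proof safe
    fix A B :: "'a set" assume "closed A" "closed B"
    then show "S \<inter> A \<inter> (S \<inter> B) \<in> ?G"
      by (intro image_eqI[where x = "A \<inter> B"]) auto
  qed
  show "?G \<subseteq> Pow (space (restrict_space borel S))"
    by (auto simp: sp)
  have cl: "sets (borel :: 'a measure) = sigma_sets UNIV (Collect closed)"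
    unfolding borel_eq_closed by (rule sets_measure_of) simp
  then show "sets (restrict_space borel S) = sigma_sets (space (restrict_space borel S)) ?G"
    using sigma_sets_Int[of S UNIV "Collect closed"] S by (simp add: sets_restrict_space sp)
  show "P (\<lambda>_. 1)"
    by (rule cont) (auto simp: bcont_def intro: boundedI[of _ 1])
  fix A assume "A \<in> ?G"
  then obtain C where C: "closed C" "A = S \<inter> C" by auto
  show "P (indicator A)"
  proof (cases "C = {}")
    case True
    have "P (\<lambda>_. 0)" by (rule cont) (auto simp: bcont_def intro: boundedI[of _ 1])
    moreover have "indicator A = (\<lambda>_. 0 :: real)"
      using True C by (intro ext) simp
    ultimately show ?thesis by simp
  next
    case False
    define F where "F n x = max 0 (1 - real n * infdist x C)" for n x
    have "F n \<in> bcont S" for n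
      unfolding bcont_def F_def
      by (auto intro!: continuous_intros boundedI[of _ 1] simp: infdist_nonneg)
    then have F: "P (F n)" "F n \<in> bmeas (restrict_space borel S)" for n
      using cont S by (auto intro: bcont_bmeas)
    have "(\<lambda>n. F n x) \<longlonglongrightarrow> indicator A x" if x: "x \<in> S" for x
    proof (cases "x \<in> C")
      case True
      then show ?thesis
        using C x by (simp add: F_def)
    next
      case xC: False
      then have "infdist x C > 0"
        using C(1) False in_closed_iff_infdist_zero infdist_nonneg by (metis less_eq_real_def)
      then obtain N :: nat where N: "1 < real N * infdist x C"
        using ex_less_of_nat_mult by blast
      have "eventually (\<lambda>n. real n * infdist x C \<ge> 1) sequentially"
      proof (rule eventually_sequentiallyI)
        fix n assume "N \<le> n"
        then have "real N * infdist x C \<le> real n * infdist x C"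
          by (intro mult_right_mono) (simp_all add: infdist_nonneg)
        with N show "real n * infdist x C \<ge> 1" by linarith
      qed
      then have "eventually (\<lambda>n. F n x = indicator A x) sequentially"
        by eventually_elim (use xC C in \<open>auto simp: F_def\<close>)
      then show ?thesis
        by (rule tendsto_eventually)
    qed
    moreover have "A \<in> sets (restrict_space borel S)"
      using C by (auto simp: sets_restrict_space)
    ultimately show ?thesis
      by (intro lim[OF bmeas_indicator F(2,1), where K = 1]) (auto simp: F_def infdist_nonneg)
  qed
next
  fix F :: "nat \<Rightarrow> 'a \<Rightarrow> real" and f K
  assume "f \<in> bmeas (restrict_space borel S)" "\<And>n. F n \<in> bmeas (restrict_space borel S)"
    "\<And>n. P (F n)" "\<And>n x. x \<in> space (restrict_space borel S) \<Longrightarrow> \<bar>F n x\<bar> \<le> K"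
    "\<And>x. x \<in> space (restrict_space borel S) \<Longrightarrow> (\<lambda>n. F n x) \<longlonglongrightarrow> f x"
  then show "P f"
    by - (rule lim[of f F K]; simp add: space_restrict_space)
qed (rule add scale; assumption)+

definition sigma_linear :: "'a measure \<Rightarrow> (('a \<Rightarrow> real) \<Rightarrow> real) \<Rightarrow> bool"
  where "sigma_linear M \<Phi> \<longleftrightarrow>
    (\<forall>f\<in>bmeas M. \<forall>g\<in>bmeas M. \<Phi> (\<lambda>x. f x + g x) = \<Phi> f + \<Phi> g) \<and>
    (\<forall>c. \<forall>f\<in>bmeas M. \<Phi> (\<lambda>x. c * f x) = c * \<Phi> f) \<and>
    (\<forall>F f K. (\<forall>n. F n \<in> bmeas M) \<longrightarrow> f \<in> bmeas M \<longrightarrow> (\<forall>n. \<forall>x\<in>space M. \<bar>F n x\<bar> \<le> K) \<longrightarrow>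
      (\<forall>x\<in>space M. (\<lambda>n::nat. F n x) \<longlonglongrightarrow> f x) \<longrightarrow> (\<lambda>n. \<Phi> (F n)) \<longlonglongrightarrow> \<Phi> f)"

context
  fixes M :: "'a measure" and \<Phi> :: "('a \<Rightarrow> real) \<Rightarrow> real"
  assumes sl: "sigma_linear M \<Phi>"
begin

lemma sigma_linear_add: "f \<in> bmeas M \<Longrightarrow> g \<in> bmeas M \<Longrightarrow> \<Phi> (\<lambda>x. f x + g x) = \<Phi> f + \<Phi> g"
  using sl by (simp add: sigma_linear_def)

lemma sigma_linear_scale: "f \<in> bmeas M \<Longrightarrow> \<Phi> (\<lambda>x. c * f x) = c * \<Phi> f"
  using sl by (simp add: sigma_linear_def)

lemma sigma_linear_diff: "f \<in> bmeas M \<Longrightarrow> g \<in> bmeas M \<Longrightarrow> \<Phi> (\<lambda>x. f x - g x) = \<Phi> f - \<Phi> g"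
  using sigma_linear_add[of f "\<lambda>x. (-1) * g x"] sigma_linear_scale[of g "-1"] bmeas_mult[of "\<lambda>_. -1" M g]
  by simp

lemma sigma_linear_lim:
  "(\<And>n. F n \<in> bmeas M) \<Longrightarrow> f \<in> bmeas M \<Longrightarrow> (\<And>n x. x \<in> space M \<Longrightarrow> \<bar>F n x\<bar> \<le> K) \<Longrightarrow>
   (\<And>x. x \<in> space M \<Longrightarrow> (\<lambda>n::nat. F n x) \<longlonglongrightarrow> f x) \<Longrightarrow> (\<lambda>n. \<Phi> (F n)) \<longlonglongrightarrow> \<Phi> f"
  using sl unfolding sigma_linear_def by blast

lemma sigma_linear_zero: "\<Phi> (\<lambda>_. 0) = 0"
  using sigma_linear_scale[of "\<lambda>_. 0" 0] by simp

lemma sigma_linear_cong: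
  assumes "f \<in> bmeas M" "g \<in> bmeas M" "\<And>x. x \<in> space M \<Longrightarrow> f x = g x"
  shows "\<Phi> f = \<Phi> g"
proof -
  obtain K where "\<And>x. x \<in> space M \<Longrightarrow> \<bar>f x\<bar> \<le> K"
    using assms(1) by (metis bmeasE)
  then have "(\<lambda>n. \<Phi> f) \<longlonglongrightarrow> \<Phi> g"
    using assms by (intro sigma_linear_lim[where K = K]) auto
  then show ?thesis
    by (rule LIMSEQ_const_iff[THEN iffD1])
qed

lemma sigma_linear_sum:
  "finite I \<Longrightarrow> (\<And>i. i \<in> I \<Longrightarrow> f i \<in> bmeas M) \<Longrightarrow>
    (\<lambda>x. \<Sum>i\<in>I. f i x) \<in> bmeas M \<and> \<Phi> (\<lambda>x. \<Sum>i\<in>I. f i x) = (\<Sum>i\<in>I. \<Phi> (f i))"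
  by (induction I rule: finite_induct) (auto simp: sigma_linear_add sigma_linear_zero)

lemma sigma_linear_vector_measure: "vector_measure M (\<lambda>A. \<Phi> (indicator A))"
  unfolding vector_measure_def
proof (intro allI impI)
  fix A :: "nat \<Rightarrow> 'a set" assume A: "range A \<subseteq> sets M" "disjoint_family A"
  have *: "(\<Sum>i<n. indicator (A i) x :: real) = indicator (\<Union>i<n. A i) x" for n x
    by (rule indicator_UN_disjoint[symmetric]) (use A(2) in \<open>auto simp: disjoint_family_on_def\<close>)
  have "(\<lambda>n. \<Phi> (\<lambda>x. \<Sum>i<n. indicator (A i) x)) \<longlonglongrightarrow> \<Phi> (indicator (\<Union>i. A i))"
  proof (rule sigma_linear_lim[where K = 1])
    show "(\<lambda>x. \<Sum>i<n. indicator (A i) x :: real) \<in> bmeas M" for n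
      using A by (intro conjunct1[OF sigma_linear_sum]) auto
    show "(\<lambda>n. \<Sum>i<n. indicator (A i) x) \<longlonglongrightarrow> (indicator (\<Union>i. A i) x :: real)" for x
      unfolding * by (rule LIMSEQ_indicator_UN)
    show "\<bar>\<Sum>i<n. indicator (A i) x\<bar> \<le> (1::real)" for n x
      unfolding * by (simp add: indicator_def)
  qed (use A in auto)
  moreover have "\<Phi> (\<lambda>x. \<Sum>i<n. indicator (A i) x) = (\<Sum>i<n. \<Phi> (indicator (A i)))" for n
    using A by (intro conjunct2[OF sigma_linear_sum]) auto
  ultimately show "(\<lambda>i. \<Phi> (indicator (A i))) sums \<Phi> (indicator (\<Union>i. A i))"
    by (simp add: sums_def)
qed

end

lemma sigma_linear_unique:
  assumes "sigma_linear M \<Phi>" "sigma_linear M \<Psi>" "\<And>A. A \<in> sets M \<Longrightarrow> \<Phi> (indicator A) = \<Psi> (indicator A)"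
    and "f \<in> bmeas M"
  shows "\<Phi> f = \<Psi> f"
  using assms(4)
proof (rule bmeas_induct[where G = "sets M"])
  show "Int_stable (sets M)" by (auto simp: Int_stable_def)
  show "sets M \<subseteq> Pow (space M)" by (rule sets.space_closed)
  show "sets M = sigma_sets (space M) (sets M)" by (rule sets.sigma_sets_eq[symmetric])
  show "\<Phi> (\<lambda>_. 1) = \<Psi> (\<lambda>_. 1)"
    using sigma_linear_cong[OF assms(1) bmeas_const[of 1] bmeas_indicator[OF sets.top]]
      sigma_linear_cong[OF assms(2) bmeas_const[of 1] bmeas_indicator[OF sets.top]] assms(3)[OF sets.top]
    by simp
  fix F :: "nat \<Rightarrow> 'a \<Rightarrow> real" and f :: "'a \<Rightarrow> real" and K
  assume *: "f \<in> bmeas M" "\<And>n. F n \<in> bmeas M" "\<And>n. \<Phi> (F n) = \<Psi> (F n)"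
    "\<And>n x. x \<in> space M \<Longrightarrow> \<bar>F n x\<bar> \<le> K"
    "\<And>x. x \<in> space M \<Longrightarrow> (\<lambda>n. F n x) \<longlonglongrightarrow> f x"
  from sigma_linear_lim[OF assms(1) *(2,1,4,5)] sigma_linear_lim[OF assms(2) *(2,1,4,5)]
  show "\<Phi> f = \<Psi> f"
    unfolding *(3) by (rule LIMSEQ_unique)
qed (use assms in \<open>auto simp: sigma_linear_add sigma_linear_scale\<close>)

lemma sigma_linear_unique_bcont:
  fixes \<Phi> \<Psi> :: "('a::metric_space \<Rightarrow> real) \<Rightarrow> real"
  assumes "sigma_linear (restrict_space borel S) \<Phi>" "sigma_linear (restrict_space borel S) \<Psi>"
    and "S \<in> sets borel" "\<And>f. f \<in> bcont S \<Longrightarrow> \<Phi> f = \<Psi> f" and "f \<in> bmeas (restrict_space borel S)"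
  shows "\<Phi> f = \<Psi> f"
  using assms(5,3)
proof (rule bcont_induct)
  fix F :: "nat \<Rightarrow> 'a \<Rightarrow> real" and f :: "'a \<Rightarrow> real" and K
  assume *: "f \<in> bmeas (restrict_space borel S)" "\<And>n. F n \<in> bmeas (restrict_space borel S)"
    "\<And>n. \<Phi> (F n) = \<Psi> (F n)"
    "\<And>n x. x \<in> S \<Longrightarrow> \<bar>F n x\<bar> \<le> K" "\<And>x. x \<in> S \<Longrightarrow> (\<lambda>n. F n x) \<longlonglongrightarrow> f x"
  have 1: "(\<lambda>n. \<Phi> (F n)) \<longlonglongrightarrow> \<Phi> f"
    by (rule sigma_linear_lim[OF assms(1) *(2,1), where K=K]) (auto simp: space_restrict_space *)
  have 2: "(\<lambda>n. \<Psi> (F n)) \<longlonglongrightarrow> \<Psi> f"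
    by (rule sigma_linear_lim[OF assms(2) *(2,1), where K=K]) (auto simp: space_restrict_space *)
  from 1 2 show "\<Phi> f = \<Psi> f"
    unfolding *(3) by (rule LIMSEQ_unique)
qed (use assms in \<open>auto simp: sigma_linear_add sigma_linear_scale\<close>)

lemma sigma_linear_LINT:
  fixes g :: "'b \<Rightarrow> real"
  assumes g: "integrable \<nu> g" and h: "h \<in> \<nu> \<rightarrow>\<^sub>M M"
  shows "sigma_linear M (\<lambda>f. LINT z|\<nu>. g z * f (h z))"
  unfolding sigma_linear_def
proof (intro conjI ballI allI impI)
  have int: "integrable \<nu> (\<lambda>z. g z * f (h z))" if "f \<in> bmeas M" for f
  proof -
    obtain K where K: "f \<in> borel_measurable M" "\<And>x. x \<in> space M \<Longrightarrow> \<bar>f x\<bar> \<le> K"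
      using \<open>f \<in> bmeas M\<close> by (metis bmeasE)
    show ?thesis
    proof (rule Bochner_Integration.integrable_bound)
      show "integrable \<nu> (\<lambda>z. g z * K)" using g by simp
      show "(\<lambda>z. g z * f (h z)) \<in> borel_measurable \<nu>"
        using g K(1) h by measurable
      show "AE z in \<nu>. norm (g z * f (h z)) \<le> norm (g z * K)"
        using measurable_space[OF h] K(2) by (auto simp: abs_mult intro!: mult_left_mono order_trans[OF K(2)])
    qed
  qed
  fix f assume f: "f \<in> bmeas M"
  show "(LINT z|\<nu>. g z * (c * f (h z))) = c * (LINT z|\<nu>. g z * f (h z))" for c
    by (simp add: mult.left_commute)
  show "(LINT z|\<nu>. g z * (f (h z) + f' (h z))) = (LINT z|\<nu>. g z * f (h z)) + (LINT z|\<nu>. g z * f' (h z))"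
    if "f' \<in> bmeas M" for f'
    using int[OF f] int[OF that] by (simp add: distrib_left)
next
  fix F :: "nat \<Rightarrow> _" and f K
  assume *: "\<forall>n. F n \<in> bmeas M" "f \<in> bmeas M" "\<forall>n. \<forall>x\<in>space M. \<bar>F n x\<bar> \<le> K"
    "\<forall>x\<in>space M. (\<lambda>n. F n x) \<longlonglongrightarrow> f x"
  have [measurable]: "f \<in> borel_measurable M" "F n \<in> borel_measurable M" for n
    using * by (auto dest: bmeas_measurable)
  note [measurable] = h borel_measurable_integrable[OF g]
  show "(\<lambda>n. LINT z|\<nu>. g z * F n (h z)) \<longlonglongrightarrow> (LINT z|\<nu>. g z * f (h z))"
  proof (rule integral_dominated_convergence[where w = "\<lambda>z. \<bar>g z\<bar> * K"])
    show "AE x in \<nu>. norm (g x * F n (h x)) \<le> \<bar>g x\<bar> * K" for n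
      using * measurable_space[OF h] by (auto simp: abs_mult intro!: mult_left_mono)
    show "AE x in \<nu>. (\<lambda>n. g x * F n (h x)) \<longlonglongrightarrow> g x * f (h x)"
      using * measurable_space[OF h] by (auto intro!: tendsto_intros)
  qed (use g in auto)
qed

lemma sigma_linear_minus:
  assumes "sigma_linear M \<Phi>" "sigma_linear M \<Psi>"
  shows "sigma_linear M (\<lambda>f. \<Phi> f - \<Psi> f)"
  unfolding sigma_linear_def
proof (intro conjI allI impI)
  fix F :: "nat \<Rightarrow> _" and f K
  assume *: "\<forall>n. F n \<in> bmeas M" "f \<in> bmeas M" "\<forall>n. \<forall>x\<in>space M. \<bar>F n x\<bar> \<le> K"
    "\<forall>x\<in>space M. (\<lambda>n. F n x) \<longlonglongrightarrow> f x"
  show "(\<lambda>n. \<Phi> (F n) - \<Psi> (F n)) \<longlonglongrightarrow> \<Phi> f - \<Psi> f"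
    using * by (intro tendsto_diff sigma_linear_lim[OF assms(1), where K = K]
      sigma_linear_lim[OF assms(2), where K = K]) auto
qed (simp_all add: sigma_linear_add[OF assms(1)] sigma_linear_add[OF assms(2)]
  sigma_linear_scale[OF assms(1)] sigma_linear_scale[OF assms(2)] right_diff_distrib)

section \<open>Signed measures\<close>

lemma vector_measureD:
  "vector_measure M \<mu> \<Longrightarrow> range A \<subseteq> sets M \<Longrightarrow> disjoint_family A \<Longrightarrow>
    (\<lambda>i::nat. \<mu> (A i)) sums \<mu> (\<Union>i. A i)"
  by (simp add: vector_measure_def)

lemma vector_measure_empty: "vector_measure M \<mu> \<Longrightarrow> \<mu> {} = 0"
  using vector_measureD[of M \<mu> "\<lambda>_. {}", THEN sums_summable, THEN summable_LIMSEQ_zero]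
  by (simp add: disjoint_family_on_def LIMSEQ_const_iff)

lemma vector_measure_Un:
  assumes "vector_measure M \<mu>" "A \<in> sets M" "B \<in> sets M" "A \<inter> B = {}"
  shows "\<mu> (A \<union> B) = \<mu> A + \<mu> B"
proof -
  have "disjoint_family (binaryset A B)"
    using assms(4) by (auto simp: disjoint_family_on_def binaryset_def)
  then have "(\<lambda>i. \<mu> (binaryset A B i)) sums \<mu> (A \<union> B)"
    using vector_measureD[OF assms(1), of "binaryset A B"] assms(2,3)
    by (simp add: UN_binaryset_eq range_binaryset_eq)
  moreover have "(\<lambda>i. \<mu> (binaryset A B i)) sums (\<Sum>i\<in>{0, 1}. \<mu> (binaryset A B i))"
    by (rule sums_finite) (auto simp: binaryset_def vector_measure_empty[OF assms(1)])
  ultimately show ?thesis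
    by (auto simp: binaryset_def dest: sums_unique2)
qed

lemma vector_measure_Diff:
  assumes "vector_measure M \<mu>" "A \<in> sets M" "B \<in> sets M" "A \<subseteq> B"
  shows "\<mu> (B - A) = \<mu> B - \<mu> A"
  using vector_measure_Un[OF assms(1,2) sets.Diff[OF assms(3,2)]] assms(4)
  by (simp add: Un_absorb1)

lemma vector_measure_bounded_linear:
  "bounded_linear h \<Longrightarrow> vector_measure M \<mu> \<Longrightarrow> vector_measure M (\<lambda>A. h (\<mu> A))"
  unfolding vector_measure_def by (auto intro: bounded_linear.sums)

lemma vector_measure_cong:
  assumes "vector_measure M \<mu>" "\<And>A. A \<in> sets M \<Longrightarrow> \<mu> A = \<nu> A"
  shows "vector_measure M \<nu>"
  unfolding vector_measure_def
proof (intro allI impI)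
  fix A :: "nat \<Rightarrow> _" assume A: "range A \<subseteq> sets M" "disjoint_family A"
  then have "A i \<in> sets M" "(\<Union>i. A i) \<in> sets M" for i by auto
  with vector_measureD[OF assms(1) A] show "(\<lambda>i. \<nu> (A i)) sums \<nu> (\<Union>i. A i)"
    by (simp add: assms(2))
qed

lemma vector_measure_bounded:
  fixes \<mu> :: "'a set \<Rightarrow> real"
  assumes vm: "vector_measure M \<mu>"
  obtains K where "\<And>A. A \<in> sets M \<Longrightarrow> \<bar>\<mu> A\<bar> \<le> K"
proof -
  define S where "S X \<longleftrightarrow> (\<forall>K. \<exists>B\<in>sets M. B \<subseteq> X \<and> \<bar>\<mu> B\<bar> > K)" for X
  have step: "\<exists>Y. (Y \<in> sets M \<and> S Y) \<and> Y \<subseteq> X \<and> \<bar>\<mu> (X - Y)\<bar> \<ge> 1" if X: "X \<in> sets M \<and> S X" for X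
  proof -
    obtain A where A: "A \<in> sets M" "A \<subseteq> X" "\<bar>\<mu> A\<bar> > 1 + \<bar>\<mu> X\<bar>"
      using X[THEN conjunct2, unfolded S_def, THEN spec, of "1 + \<bar>\<mu> X\<bar>"] by auto
    have d: "\<mu> (X - A) = \<mu> X - \<mu> A"
      using vector_measure_Diff[OF vm A(1) _ A(2)] X by simp
    show ?thesis
    proof (cases "S A")
      case True
      then show ?thesis using A d by (intro exI[of _ A]) auto
    next
      case False
      then obtain K where "\<forall>B\<in>sets M. \<not> (B \<subseteq> A \<and> \<bar>\<mu> B\<bar> > K)"
        unfolding S_def by auto
      then have K: "\<bar>\<mu> B\<bar> \<le> K" if "B \<in> sets M" "B \<subseteq> A" for B
        using that by (simp add: not_less)
      have "S (X - A)"
        unfolding S_def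
      proof (intro allI)
        fix L
        obtain B where B: "B \<in> sets M" "B \<subseteq> X" "\<bar>\<mu> B\<bar> > K + L"
          using X[THEN conjunct2, unfolded S_def, THEN spec, of "K + L"] by auto
        have "\<mu> (B - B \<inter> A) = \<mu> B - \<mu> (B \<inter> A)"
          using vector_measure_Diff[OF vm _ B(1), of "B \<inter> A"] A B by auto
        moreover have "\<bar>\<mu> (B \<inter> A)\<bar> \<le> K"
          using A B by (intro K) auto
        ultimately have "\<bar>\<mu> (B - B \<inter> A)\<bar> > L"
          using B(3) by linarith
        then show "\<exists>C\<in>sets M. C \<subseteq> X - A \<and> \<bar>\<mu> C\<bar> > L"
          using A B by (intro bexI[of _ "B - B \<inter> A"]) auto
      qed
      moreover have "X - (X - A) = A" using A by auto
      ultimately show ?thesis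
        using A X by (intro exI[of _ "X - A"]) auto
    qed
  qed
  have "\<not> S (space M)"
  proof
    assume "S (space M)"
    then obtain Y where Y: "\<And>n::nat. Y n \<in> sets M \<and> S (Y n)"
        "\<And>n. Y (Suc n) \<subseteq> Y n \<and> \<bar>\<mu> (Y n - Y (Suc n))\<bar> \<ge> 1"
      using dependent_nat_choice[of "\<lambda>_ Y. Y \<in> sets M \<and> S Y"
          "\<lambda>_ X Y. Y \<subseteq> X \<and> \<bar>\<mu> (X - Y)\<bar> \<ge> 1"] step by blast
    have dec: "Y n \<subseteq> Y m" if "m \<le> n" for m n
      using that Y(2) by (metis lift_Suc_antimono_le)
    have "disjoint_family (\<lambda>n. Y n - Y (Suc n))"
      unfolding disjoint_family_on_def
    proof (intro ballI impI)
      fix m n :: nat assume "m \<noteq> n"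
      then consider "Suc m \<le> n" | "Suc n \<le> m" by linarith
      then show "(Y m - Y (Suc m)) \<inter> (Y n - Y (Suc n)) = {}"
        by cases (use dec in blast)+
    qed
    then have "(\<lambda>n. \<mu> (Y n - Y (Suc n))) sums \<mu> (\<Union>n. Y n - Y (Suc n))"
      using Y by (intro vector_measureD[OF vm]) auto
    then have "(\<lambda>n. \<mu> (Y n - Y (Suc n))) \<longlonglongrightarrow> 0"
      by (intro summable_LIMSEQ_zero sums_summable)
    then have "eventually (\<lambda>n. \<bar>\<mu> (Y n - Y (Suc n))\<bar> < 1) sequentially"
      by (auto simp: tendsto_iff)
    then show False
      using Y(2) by (auto simp: eventually_sequentially not_less[symmetric])
  qed
  then show ?thesis
    using that sets.sets_into_space unfolding S_def by (metis not_less)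
qed

lemma space_pos_part [simp]: "space (pos_part M \<mu>) = space M"
  by (simp add: pos_part_def space_measure_of_conv)

lemma sets_pos_part [simp]: "sets (pos_part M \<mu>) = sets M"
  by (simp add: pos_part_def sets.space_closed)

lemma emeasure_pos_part_le:
  assumes "\<And>A. A \<in> sets M \<Longrightarrow> \<mu> A \<le> c"
  shows "emeasure (pos_part M \<mu>) X \<le> ennreal c"
proof -
  have "(SUP B\<in>{B \<in> sets M. B \<subseteq> X}. ennreal (\<mu> B)) \<le> ennreal c"
    using assms by (intro SUP_least ennreal_leI) auto
  then show ?thesis
    unfolding pos_part_def by (subst emeasure_measure_of_conv) auto
qed

lemma signed_integral_bound:
  assumes \<mu>: "\<And>A. A \<in> sets M \<Longrightarrow> \<bar>\<mu> A\<bar> \<le> c" and f: "\<And>x. x \<in> space M \<Longrightarrow> \<bar>f x\<bar> \<le> K"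
    and K: "K \<ge> 0"
  shows "\<bar>signed_integral M \<mu> f\<bar> \<le> 2 * c * K"
proof -
  have c: "c \<ge> 0" using \<mu>[of "{}"] by simp
  have bd: "\<bar>LINT x|\<nu>. f x\<bar> \<le> c * K"
    if \<nu>: "space \<nu> = space M" "emeasure \<nu> (space M) \<le> ennreal c" for \<nu>
  proof -
    interpret finite_measure \<nu>
      using \<nu> by (intro finite_measureI) (auto simp: top_unique)
    have m: "measure \<nu> (space \<nu>) \<le> c"
      using \<nu> c by (simp add: measure_def enn2real_leI)
    show ?thesis
    proof (cases "integrable \<nu> f")
      case True
      have "\<bar>LINT x|\<nu>. f x\<bar> \<le> (LINT x|\<nu>. \<bar>f x\<bar>)"
        by (rule integral_abs_bound)
      also have "\<dots> \<le> (LINT x|\<nu>. K)"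
        using True f \<nu> by (intro integral_mono) auto
      also have "\<dots> \<le> c * K"
        using m K by (simp add: mult_right_mono)
      finally show ?thesis .
    qed (use c K in \<open>simp add: not_integrable_integral_eq\<close>)
  qed
  have "\<bar>LINT x|pos_part M \<mu>. f x\<bar> \<le> c * K" "\<bar>LINT x|pos_part M (\<lambda>A. - \<mu> A). f x\<bar> \<le> c * K"
    by (rule bd[OF _ emeasure_pos_part_le], simp, use \<mu> in \<open>force simp: abs_le_iff\<close>)+
  then show ?thesis
    unfolding signed_integral_def by linarith
qed

context
  fixes M :: "'a measure" and \<mu> :: "'a set \<Rightarrow> real"
  assumes vm: "vector_measure M \<mu>"
begin

lemma emeasure_pos_part:
  assumes "A \<in> sets M"
  shows "emeasure (pos_part M \<mu>) A = (SUP B\<in>{B \<in> sets M. B \<subseteq> A}. ennreal (\<mu> B))"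
proof (rule emeasure_measure_of[OF pos_part_def])
  let ?p = "\<lambda>A. SUP B\<in>{B \<in> sets M. B \<subseteq> A}. ennreal (\<mu> B)"
  show "sets M \<subseteq> Pow (space M)" by (rule sets.space_closed)
  show "A \<in> sets (pos_part M \<mu>)" using assms by simp
  have "{B \<in> sets M. B \<subseteq> {}} = {{}}" by auto
  then have empty: "?p {} = 0"
    by (simp only: image_insert image_empty) (simp add: vector_measure_empty[OF vm])
  then show "positive (sets (pos_part M \<mu>)) ?p"
    by (simp add: positive_def)
  have mono: "?p A \<le> ?p B" if "A \<subseteq> B" for A B
    using that by (intro SUP_subset_mono) auto
  have super: "?p A + ?p B \<le> ?p (A \<union> B)" if "A \<inter> B = {}" for A B
  proof -
    have "ennreal (\<mu> A') + ennreal (\<mu> B') \<le> ?p (A \<union> B)"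
      if AB: "A' \<in> sets M" "A' \<subseteq> A" "B' \<in> sets M" "B' \<subseteq> B" for A' B'
    proof -
      define A2 B2 where "A2 = (if \<mu> A' < 0 then {} else A')" and "B2 = (if \<mu> B' < 0 then {} else B')"
      have *: "A2 \<in> sets M" "A2 \<subseteq> A" "B2 \<in> sets M" "B2 \<subseteq> B" "\<mu> A2 \<ge> 0" "\<mu> B2 \<ge> 0"
        "ennreal (\<mu> A') = ennreal (\<mu> A2)" "ennreal (\<mu> B') = ennreal (\<mu> B2)"
        using AB by (auto simp: A2_def B2_def vector_measure_empty[OF vm] ennreal_neg)
      have "ennreal (\<mu> A') + ennreal (\<mu> B') = ennreal (\<mu> (A2 \<union> B2))"
        using * \<open>A \<inter> B = {}\<close> by (subst vector_measure_Un[OF vm]) auto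
      also have "\<dots> \<le> ?p (A \<union> B)"
        using * by (intro SUP_upper) auto
      finally show ?thesis .
    qed
    note pair = this
    have "ennreal (\<mu> A') + ?p B \<le> ?p (A \<union> B)" if A': "A' \<in> sets M" "A' \<subseteq> A" for A'
    proof -
      have "ennreal (\<mu> A') + ?p B = (SUP B'\<in>{B' \<in> sets M. B' \<subseteq> B}. ennreal (\<mu> A') + ennreal (\<mu> B'))"
        by (rule ennreal_SUP_add_right) auto
      also have "\<dots> \<le> ?p (A \<union> B)"
        using pair[OF A'] by (intro SUP_least) simp
      finally show ?thesis .
    qed
    then have "(SUP A'\<in>{A' \<in> sets M. A' \<subseteq> A}. ennreal (\<mu> A') + ?p B) \<le> ?p (A \<union> B)"
      by (intro SUP_least) simp
    also have "(SUP A'\<in>{A' \<in> sets M. A' \<subseteq> A}. ennreal (\<mu> A') + ?p B) = ?p A + ?p B"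
      by (rule ennreal_SUP_add_left) auto
    finally show ?thesis .
  qed
  show "countably_additive (sets (pos_part M \<mu>)) ?p"
    unfolding countably_additive_def
  proof (intro allI impI)
    fix A :: "nat \<Rightarrow> 'a set"
    assume "range A \<subseteq> sets (pos_part M \<mu>)" and disj: "disjoint_family A"
    then have A: "A i \<in> sets M" for i by auto
    show "(\<Sum>i. ?p (A i)) = ?p (\<Union>i. A i)"
    proof (rule antisym)
      have "(\<Sum>i<n. ?p (A i)) \<le> ?p (\<Union>i<n. A i)" for n
      proof (induction n)
        case 0
        then show ?case using empty by simp
      next
        case (Suc n)
        have "A i \<inter> A n = {}" if "i < n" for i
          using that by (intro disjoint_family_onD[OF disj]) auto
        then have disj': "(\<Union>i<n. A i) \<inter> A n = {}"
          by auto
        have "(\<Sum>i<Suc n. ?p (A i)) \<le> ?p (\<Union>i<n. A i) + ?p (A n)"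
          using Suc by (simp add: add_right_mono)
        also have "\<dots> \<le> ?p ((\<Union>i<n. A i) \<union> A n)"
          by (rule super[OF disj'])
        finally show ?case
          by (simp add: lessThan_Suc Un_commute)
      qed
      also have "?p (\<Union>i<n. A i) \<le> ?p (\<Union>i. A i)" for n
        by (intro mono) auto
      finally show "(\<Sum>i. ?p (A i)) \<le> ?p (\<Union>i. A i)"
        by (intro suminf_le_const) auto
      show "?p (\<Union>i. A i) \<le> (\<Sum>i. ?p (A i))"
      proof (rule SUP_least)
        fix B assume "B \<in> {B \<in> sets M. B \<subseteq> (\<Union>i. A i)}"
        then have B: "B \<in> sets M" "(\<Union>i. B \<inter> A i) = B" by auto
        have "(\<lambda>i. \<mu> (B \<inter> A i)) sums \<mu> (\<Union>i. B \<inter> A i)"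
          using A B by (intro vector_measureD[OF vm] disjoint_family_subset[OF disj]) auto
        then have "(\<lambda>n. ennreal (\<Sum>i<n. \<mu> (B \<inter> A i))) \<longlonglongrightarrow> ennreal (\<mu> B)"
          unfolding B(2) sums_def by (rule tendsto_ennrealI)
        moreover have "ennreal (\<Sum>i<n. \<mu> (B \<inter> A i)) \<le> (\<Sum>i. ?p (A i))" for n
        proof -
          have "ennreal (\<Sum>i<n. \<mu> (B \<inter> A i)) \<le> ennreal (\<Sum>i<n. max 0 (\<mu> (B \<inter> A i)))"
            by (intro ennreal_leI sum_mono) auto
          also have "\<dots> = (\<Sum>i<n. ennreal (max 0 (\<mu> (B \<inter> A i))))"
            by (rule sum_ennreal[symmetric]) simp
          also have "\<dots> \<le> (\<Sum>i<n. ?p (A i))"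
            using A B by (intro sum_mono) (auto simp: ennreal_max_0 intro!: SUP_upper)
          also have "\<dots> \<le> (\<Sum>i. ?p (A i))"
            by (intro sum_le_suminf) auto
          finally show ?thesis .
        qed
        ultimately show "ennreal (\<mu> B) \<le> (\<Sum>i. ?p (A i))"
          by (intro LIMSEQ_le_const2[where X = "\<lambda>n. ennreal (\<Sum>i<n. \<mu> (B \<inter> A i))"]) auto
      qed
    qed
  qed
qed

lemma finite_measure_pos_part: "finite_measure (pos_part M \<mu>)"
proof -
  obtain K where "\<And>A. A \<in> sets M \<Longrightarrow> \<bar>\<mu> A\<bar> \<le> K"
    using vector_measure_bounded[OF vm] by blast
  then have "emeasure (pos_part M \<mu>) (space M) \<le> ennreal K"
    by (intro emeasure_pos_part_le) (auto simp: abs_le_iff)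
  then show ?thesis
    by (intro finite_measureI) (auto simp: top_unique)
qed

end

lemma vector_measure_uminus:
  fixes \<mu> :: "'a set \<Rightarrow> real"
  shows "vector_measure M \<mu> \<Longrightarrow> vector_measure M (\<lambda>A. - \<mu> A)"
  by (rule vector_measure_bounded_linear[OF bounded_linear_minus[OF bounded_linear_ident]])

lemma jordan_decomposition:
  fixes \<mu> :: "'a set \<Rightarrow> real"
  assumes vm: "vector_measure M \<mu>" and A: "A \<in> sets M"
  shows "\<mu> A = measure (pos_part M \<mu>) A - measure (pos_part M (\<lambda>A. - \<mu> A)) A"
proof -
  have le: "measure (pos_part M \<nu>) A \<le> \<nu> A + measure (pos_part M (\<lambda>A. - \<nu> A)) A"
    if \<nu>: "vector_measure M \<nu>" for \<nu> :: "'a set \<Rightarrow> real"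
  proof -
    interpret p: finite_measure "pos_part M \<nu>"
      by (rule finite_measure_pos_part[OF \<nu>])
    interpret n: finite_measure "pos_part M (\<lambda>A. - \<nu> A)"
      by (rule finite_measure_pos_part[OF vector_measure_uminus[OF \<nu>]])
    let ?n = "measure (pos_part M (\<lambda>A. - \<nu> A)) A"
    have n: "- \<nu> B \<le> ?n" if "B \<in> sets M" "B \<subseteq> A" for B
    proof -
      have "ennreal (- \<nu> B) \<le> ennreal ?n"
        unfolding n.emeasure_eq_measure[symmetric] emeasure_pos_part[OF vector_measure_uminus[OF \<nu>] A]
        using that by (intro SUP_upper) auto
      then show ?thesis
        by (simp add: ennreal_le_iff)
    qed
    have "ennreal (measure (pos_part M \<nu>) A) \<le> ennreal (\<nu> A + ?n)"
      unfolding p.emeasure_eq_measure[symmetric] emeasure_pos_part[OF \<nu> A]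
    proof (intro SUP_least ennreal_leI)
      fix B assume "B \<in> {B \<in> sets M. B \<subseteq> A}"
      then have "\<nu> (A - B) = \<nu> A - \<nu> B" "- \<nu> (A - B) \<le> ?n"
        using A by (auto intro!: vector_measure_Diff[OF \<nu>] n)
      then show "\<nu> B \<le> \<nu> A + ?n" by linarith
    qed
    moreover have "0 \<le> \<nu> A + ?n"
      using n[OF A] by simp
    ultimately show ?thesis
      by (simp add: ennreal_le_iff)
  qed
  from le[OF vm] le[OF vector_measure_uminus[OF vm]] show ?thesis
    by simp
qed

lemma sigma_linear_signed_integral:
  assumes "vector_measure M \<mu>"
  shows "sigma_linear M (signed_integral M \<mu>)"
proof -
  have "sigma_linear M (\<lambda>f. LINT x|\<nu>. f x)" if "finite_measure \<nu>" "sets \<nu> = sets M" for \<nu>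
    using sigma_linear_LINT[OF integrable_bmeas[OF that(1) bmeas_const[of 1]] measurable_ident_sets[OF that(2)]] by simp
  from this[OF finite_measure_pos_part[OF assms]] this[OF finite_measure_pos_part[OF vector_measure_uminus[OF assms]]]
  have "sigma_linear M (\<lambda>f. (LINT x|pos_part M \<mu>. f x) - (LINT x|pos_part M (\<lambda>A. - \<mu> A). f x))"
    by (intro sigma_linear_minus) simp_all
  then show ?thesis
    by (simp add: signed_integral_def[abs_def])
qed

lemma signed_integral_indicator:
  assumes "vector_measure M \<mu>" "A \<in> sets M"
  shows "signed_integral M \<mu> (indicator A) = \<mu> A"
  using jordan_decomposition[OF assms] assms(2)
  by (simp add: signed_integral_def)

lemma signed_integral_eqI:
  assumes sl: "sigma_linear M \<Phi>" and \<mu>: "\<And>A. A \<in> sets M \<Longrightarrow> \<mu> A = \<Phi> (indicator A)"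
    and f: "f \<in> bmeas M"
  shows "signed_integral M \<mu> f = \<Phi> f"
proof -
  have vm: "vector_measure M \<mu>"
    using sigma_linear_vector_measure[OF sl] by (rule vector_measure_cong) (simp add: \<mu>)
  show ?thesis
    by (rule sigma_linear_unique[OF sigma_linear_signed_integral[OF vm] sl _ f])
       (simp add: signed_integral_indicator[OF vm] \<mu>)
qed

lemma signed_integral_measure:
  assumes "finite_measure \<nu>" "sets \<nu> = sets M" "f \<in> bmeas M"
  shows "signed_integral M (measure \<nu>) f = (LINT x|\<nu>. f x)"
proof -
  interpret finite_measure \<nu> by fact
  show ?thesis
    using sigma_linear_LINT[OF integrable_bmeas[OF assms(1) bmeas_const[of 1]] measurable_ident_sets[OF assms(2)]]
    by (intro signed_integral_eqI assms) (auto simp flip: assms(2))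
qed

lemma vector_measure_measure:
  assumes "finite_measure \<nu>" "sets \<nu> = sets M"
  shows "vector_measure M (measure \<nu>)"
proof -
  interpret finite_measure \<nu> by fact
  show ?thesis
    unfolding vector_measure_def using assms(2) by (auto intro!: finite_measure_UNION)
qed

lemma vector_measure_eqI:
  fixes \<mu> \<nu> :: "'a::metric_space set \<Rightarrow> real"
  assumes "S \<in> sets borel" "vector_measure (restrict_space borel S) \<mu>" "vector_measure (restrict_space borel S) \<nu>"
    and "\<And>f. f \<in> bcont S \<Longrightarrow> signed_integral (restrict_space borel S) \<mu> f = signed_integral (restrict_space borel S) \<nu> f"
    and A: "A \<in> sets (restrict_space borel S)"
  shows "\<mu> A = \<nu> A"
  using sigma_linear_unique_bcont[OF sigma_linear_signed_integral[OF assms(2)]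
      sigma_linear_signed_integral[OF assms(3)] assms(1,4) bmeas_indicator[OF A]]
  by (simp add: signed_integral_indicator assms(2,3) A)

section \<open>Entropy and duality\<close>

lemma real_density:
  fixes N \<nu> :: "'a measure"
  assumes \<nu>: "finite_measure \<nu>" and N: "finite_measure N" "sets N = sets \<nu>" "absolutely_continuous \<nu> N"
  obtains D :: "'a \<Rightarrow> real" where "integrable \<nu> D" "\<And>A. A \<in> sets \<nu> \<Longrightarrow> measure N A = (LINT x:A|\<nu>. D x)"
proof -
  interpret finite_measure \<nu> by fact
  obtain D where D: "D \<in> borel_measurable \<nu>" "AE x in \<nu>. RN_deriv \<nu> N x = ennreal (D x)" "\<And>x. 0 \<le> D x"
    using real_RN_deriv[OF N(1,3,2)] by metis
  have dens: "N = density \<nu> (\<lambda>x. ennreal (D x))"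
    using density_RN_deriv[OF N(3,2)] density_cong[OF _ _ D(2)] D(1) by simp
  have eq: "emeasure N A = (\<integral>\<^sup>+x. ennreal (indicator A x * D x) \<partial>\<nu>)" if "A \<in> sets \<nu>" for A
    using that D(1) by (subst dens, subst emeasure_density)
      (auto intro!: nn_integral_cong split: split_indicator)
  have "(\<integral>\<^sup>+x. ennreal (D x) \<partial>\<nu>) = emeasure N (space \<nu>)"
    by (subst eq) (auto intro!: nn_integral_cong)
  also have "\<dots> < \<infinity>"
    using finite_measure.emeasure_finite[OF N(1)] by (simp add: less_top)
  finally have "integrable \<nu> D"
    using D by (intro integrableI_nonneg) auto
  moreover have "measure N A = (LINT x:A|\<nu>. D x)" if "A \<in> sets \<nu>" for A
    using that D unfolding measure_def eq[OF that] set_lebesgue_integral_def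
    by (subst integral_eq_nn_integral) auto
  ultimately show ?thesis by (rule that)
qed

lemma signed_radon_nikodym:
  assumes \<nu>: "finite_measure \<nu>" "sets \<nu> = sets M" and vm: "vector_measure M \<mu>"
    and ac: "\<forall>A\<in>null_sets \<nu>. \<mu> A = (0::real)"
  shows "\<exists>f. integrable \<nu> f \<and> (\<forall>A\<in>sets \<nu>. \<mu> A = (LINT x:A|\<nu>. f x))"
proof -
  have part: "absolutely_continuous \<nu> (pos_part M \<mu>')"
    if "vector_measure M \<mu>'" "\<forall>A\<in>null_sets \<nu>. \<mu>' A = (0::real)" for \<mu>'
    unfolding absolutely_continuous_def
  proof (intro subsetI null_setsI)
    fix A assume A: "A \<in> null_sets \<nu>"
    then show "A \<in> sets (pos_part M \<mu>')" using \<nu>(2) by auto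
    have "\<mu>' B = 0" if "B \<in> sets M" "B \<subseteq> A" for B
      using null_sets_subset[OF A _ that(2)] that \<nu>(2) \<open>\<forall>A\<in>null_sets \<nu>. \<mu>' A = 0\<close> by auto
    then have "(SUP B\<in>{B \<in> sets M. B \<subseteq> A}. ennreal (\<mu>' B)) \<le> 0"
      by (intro SUP_least) auto
    then show "emeasure (pos_part M \<mu>') A = 0"
      using A \<nu>(2) by (subst emeasure_pos_part[OF \<open>vector_measure M \<mu>'\<close>]) auto
  qed
  obtain D1 where D1: "integrable \<nu> D1" "\<And>A. A \<in> sets \<nu> \<Longrightarrow> measure (pos_part M \<mu>) A = (LINT x:A|\<nu>. D1 x)"
    using real_density[OF \<nu>(1) finite_measure_pos_part[OF vm] _ part[OF vm ac]] \<nu>(2) by auto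
  obtain D2 where D2: "integrable \<nu> D2"
      "\<And>A. A \<in> sets \<nu> \<Longrightarrow> measure (pos_part M (\<lambda>A. - \<mu> A)) A = (LINT x:A|\<nu>. D2 x)"
    using real_density[OF \<nu>(1) finite_measure_pos_part[OF vector_measure_uminus[OF vm]] _
        part[OF vector_measure_uminus[OF vm]]] ac \<nu>(2) by auto
  show ?thesis
  proof (intro exI[of _ "\<lambda>x. D1 x - D2 x"] conjI ballI)
    fix A assume A: "A \<in> sets \<nu>"
    then have "set_integrable \<nu> A D1" "set_integrable \<nu> A D2"
      unfolding set_integrable_def by (intro integrable_mult_indicator D1(1) D2(1); assumption)+
    then show "\<mu> A = (LINT x:A|\<nu>. D1 x - D2 x)"
      using jordan_decomposition[OF vm, of A] A D1(2) D2(2) \<nu>(2) by simp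
  qed (use D1(1) D2(1) in auto)
qed

lemma entropy_integrand_ge:
  fixes f g :: real
  assumes "f \<ge> 0"
  shows "f * g - (exp g - 1) \<le> f * ln f - f + 1"
proof (cases "f = 0")
  case False
  then have f: "f > 0" using assms by simp
  have "f * (1 + (g - ln f)) \<le> f * exp (g - ln f)"
    using f by (intro mult_left_mono exp_ge_add_one_self) auto
  also have "\<dots> = exp g"
    using f by (simp add: exp_diff)
  finally show ?thesis by (simp add: algebra_simps)
qed simp

lemma ennreal_LINT_le:
  fixes k :: "'a \<Rightarrow> real"
  assumes "integrable M k"
  shows "ennreal (LINT x|M. k x) \<le> (\<integral>\<^sup>+x. ennreal (k x) \<partial>M)"
proof -
  have "(LINT x|M. k x) \<le> (LINT x|M. max 0 (k x))"
    using assms by (intro integral_mono) auto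
  then have "ennreal (LINT x|M. k x) \<le> ennreal (LINT x|M. max 0 (k x))"
    by (rule ennreal_leI)
  also have "\<dots> = (\<integral>\<^sup>+x. ennreal (max 0 (k x)) \<partial>M)"
    using assms by (intro nn_integral_eq_integral[symmetric]) auto
  finally show ?thesis by (simp add: ennreal_max_0)
qed

lemma Ent_ge:
  assumes \<nu>: "finite_measure \<nu>" "sets \<nu> = sets M" and vm: "vector_measure M \<mu>" and g: "g \<in> bmeas M"
  shows "ennreal (signed_integral M \<mu> g - (LINT x|\<nu>. exp (g x) - 1)) \<le> Ent \<mu> \<nu>"
proof (cases "(\<forall>A\<in>null_sets \<nu>. \<mu> A = 0) \<and> (AE x in \<nu>. 0 \<le> signed_RN_deriv \<nu> \<mu> x)")
  case False
  then show ?thesis unfolding Ent_def Let_def by (simp only: if_False) simp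
next
  case True
  interpret finite_measure \<nu> by fact
  let ?f = "signed_RN_deriv \<nu> \<mu>"
  have f: "integrable \<nu> ?f" "\<And>A. A \<in> sets \<nu> \<Longrightarrow> \<mu> A = (LINT x:A|\<nu>. ?f x)"
    using someI_ex[OF signed_radon_nikodym[OF \<nu> vm conjunct1[OF True]]]
    unfolding signed_RN_deriv_def by auto
  have sl: "sigma_linear M (\<lambda>h. LINT x|\<nu>. ?f x * h x)"
    using sigma_linear_LINT[OF f(1) measurable_ident_sets[OF \<nu>(2)]] by simp
  have SI: "signed_integral M \<mu> g = (LINT x|\<nu>. ?f x * g x)"
    using f(2) \<nu>(2) by (intro signed_integral_eqI[OF sl _ g])
      (simp add: set_lebesgue_integral_def mult.commute)
  obtain K where K: "g \<in> borel_measurable \<nu>" "\<And>x. x \<in> space \<nu> \<Longrightarrow> \<bar>g x\<bar> \<le> K"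
    using g unfolding bmeas_cong_sets[OF \<nu>(2), symmetric] by (metis bmeasE)
  have i1: "integrable \<nu> (\<lambda>x. ?f x * g x)"
  proof (rule Bochner_Integration.integrable_bound)
    show "integrable \<nu> (\<lambda>x. ?f x * K)" using f(1) by simp
    show "(\<lambda>x. ?f x * g x) \<in> borel_measurable \<nu>"
      using f(1) K(1) by auto
    show "AE x in \<nu>. norm (?f x * g x) \<le> norm (?f x * K)"
      using K(2) by (auto simp: abs_mult intro!: mult_left_mono order_trans[OF K(2)])
  qed
  have i2: "integrable \<nu> (\<lambda>x. exp (g x) - 1)"
  proof (rule integrable_const_bound[of _ "exp K + 1"])
    show "AE x in \<nu>. norm (exp (g x) - 1) \<le> exp K + 1"
    proof (rule AE_I2)
      fix x assume "x \<in> space \<nu>"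
      then have "exp (g x) \<le> exp K"
        using K(2)[of x] by (simp add: abs_le_iff)
      then show "norm (exp (g x) - 1) \<le> exp K + 1"
        using exp_gt_zero[of "g x"] by (simp only: real_norm_def abs_le_iff) linarith
    qed
  qed (use K(1) in auto)
  have "ennreal (signed_integral M \<mu> g - (LINT x|\<nu>. exp (g x) - 1)) =
    ennreal (LINT x|\<nu>. ?f x * g x - (exp (g x) - 1))"
    using i1 i2 by (simp add: SI)
  also have "\<dots> \<le> (\<integral>\<^sup>+x. ennreal (?f x * g x - (exp (g x) - 1)) \<partial>\<nu>)"
    using i1 i2 by (intro ennreal_LINT_le) auto
  also have "\<dots> \<le> (\<integral>\<^sup>+x. ennreal (?f x * ln (?f x) - ?f x + 1) \<partial>\<nu>)"
    using conjunct2[OF True] by (intro nn_integral_mono_AE) (auto elim!: eventually_mono intro!: ennreal_leI entropy_integrand_ge)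
  finally show ?thesis
    using True by (simp add: Ent_def Let_def)
qed

lemma Ent_scale_ge:
  assumes \<sigma>: "prob_space \<sigma>" "sets \<sigma> = sets M" and vm: "vector_measure M \<mu>"
    and g: "g \<in> bmeas M" "\<And>x. x \<in> space M \<Longrightarrow> \<bar>g x\<bar> \<le> c" and "a > 0" "l > 0"
  shows "ennreal (a * \<bar>signed_integral M \<mu> g\<bar> - l * exp (a * c)) \<le> Ent \<mu> (scale_measure (ennreal l) \<sigma>)"
proof -
  interpret prob_space \<sigma> by fact
  let ?\<nu> = "scale_measure (ennreal l) \<sigma>"
  interpret n: finite_measure ?\<nu>
    by (rule finite_measureI) (simp add: space_scale_measure emeasure_space_1 ennreal_mult_eq_top_iff)
  have sets: "sets ?\<nu> = sets M" using \<sigma> by simp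
  have sp: "space \<sigma> = space M" using sets_eq_imp_space_eq[OF \<sigma>(2)] .
  have mass: "measure ?\<nu> (space ?\<nu>) = l"
    using \<open>l > 0\<close> by (simp add: measure_def space_scale_measure emeasure_space_1)
  have one: "ennreal (a * s * signed_integral M \<mu> g - l * exp (a * c)) \<le> Ent \<mu> ?\<nu>" if "\<bar>s\<bar> = 1" for s
  proof -
    have m: "(\<lambda>x. (a * s) * g x) \<in> bmeas M"
      by (intro bmeas_mult bmeas_const g)
    have bd: "exp (a * s * g x) - 1 \<le> exp (a * c)" if "x \<in> space M" for x
    proof -
      have "a * s * g x \<le> \<bar>a * s * g x\<bar>" by simp
      also have "\<dots> = a * \<bar>g x\<bar>"
        using \<open>\<bar>s\<bar> = 1\<close> \<open>a > 0\<close> by (simp add: abs_mult)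
      also have "\<dots> \<le> a * c"
        using g(2)[OF that] \<open>a > 0\<close> by simp
      finally have "exp (a * s * g x) \<le> exp (a * c)" by simp
      then show ?thesis by linarith
    qed
    have "(LINT x|?\<nu>. exp (a * s * g x) - 1) \<le> (LINT x|?\<nu>. exp (a * c))"
    proof (cases "integrable ?\<nu> (\<lambda>x. exp (a * s * g x) - 1)")
      case True
      then show ?thesis
        using bd sp by (intro integral_mono) (auto simp: space_scale_measure)
    next
      case False
      then show ?thesis by (simp add: not_integrable_integral_eq)
    qed
    also have "\<dots> = l * exp (a * c)"
      using mass by simp
    finally have "ennreal (a * s * signed_integral M \<mu> g - l * exp (a * c)) \<le>
      ennreal (signed_integral M \<mu> (\<lambda>x. (a * s) * g x) - (LINT x|?\<nu>. exp ((a * s) * g x) - 1))"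
      by (intro ennreal_leI) (simp add: sigma_linear_scale[OF sigma_linear_signed_integral[OF vm] g(1)])
    also have "\<dots> \<le> Ent \<mu> ?\<nu>"
      by (rule Ent_ge[OF n.finite_measure_axioms sets vm m])
    finally show ?thesis .
  qed
  show ?thesis
    using one[of 1] one[of "-1"] by (cases "signed_integral M \<mu> g \<ge> 0") auto
qed

lemma signed_integral_measurable:
  assumes "\<And>t. t \<in> space N \<Longrightarrow> vector_measure M (\<mu> t)"
    and "\<And>A. A \<in> sets M \<Longrightarrow> (\<lambda>t. \<mu> t A) \<in> borel_measurable N"
    and f: "f \<in> bmeas M"
  shows "(\<lambda>t. signed_integral M (\<mu> t) f) \<in> borel_measurable N"
  using f
proof (rule bmeas_induct[where G = "sets M"])
  show "Int_stable (sets M)" by (auto simp: Int_stable_def)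
  show "sets M \<subseteq> Pow (space M)" by (rule sets.space_closed)
  show "sets M = sigma_sets (space M) (sets M)" by (rule sets.sigma_sets_eq[symmetric])
  note sl = sigma_linear_signed_integral[OF assms(1)]
  have ind: "(\<lambda>t. signed_integral M (\<mu> t) (indicator A)) \<in> borel_measurable N" if "A \<in> sets M" for A
    using assms(2)[OF that] by (subst measurable_cong[OF signed_integral_indicator[OF assms(1) that]])
  then show "A \<in> sets M \<Longrightarrow> (\<lambda>t. signed_integral M (\<mu> t) (indicator A)) \<in> borel_measurable N" for A .
  show "(\<lambda>t. signed_integral M (\<mu> t) (\<lambda>_. 1)) \<in> borel_measurable N"
    using ind[OF sets.top]
    by (subst measurable_cong[OF sigma_linear_cong[OF sl bmeas_const bmeas_indicator[OF sets.top]]]) auto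
  fix f assume f: "f \<in> bmeas M" "(\<lambda>t. signed_integral M (\<mu> t) f) \<in> borel_measurable N"
  show "(\<lambda>t. signed_integral M (\<mu> t) (\<lambda>x. c * f x)) \<in> borel_measurable N" for c
    using f(2) by (subst measurable_cong[OF sigma_linear_scale[OF sl f(1)]]) auto
  show "(\<lambda>t. signed_integral M (\<mu> t) (\<lambda>x. f x + g x)) \<in> borel_measurable N"
    if g: "g \<in> bmeas M" "(\<lambda>t. signed_integral M (\<mu> t) g) \<in> borel_measurable N" for g
    using f(2) g(2) by (subst measurable_cong[OF sigma_linear_add[OF sl f(1) g(1)]]) auto
next
  fix F :: "nat \<Rightarrow> _" and f K
  assume *: "f \<in> bmeas M" "\<And>n. F n \<in> bmeas M"
    "\<And>n. (\<lambda>t. signed_integral M (\<mu> t) (F n)) \<in> borel_measurable N"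
    "\<And>n x. x \<in> space M \<Longrightarrow> \<bar>F n x\<bar> \<le> K" "\<And>x. x \<in> space M \<Longrightarrow> (\<lambda>n. F n x) \<longlonglongrightarrow> f x"
  show "(\<lambda>t. signed_integral M (\<mu> t) f) \<in> borel_measurable N"
    by (rule borel_measurable_LIMSEQ_real[OF sigma_linear_lim[OF sigma_linear_signed_integral[OF assms(1)] *(2,1,4,5)] *(3)])
qed

lemma narrow_continuous_measurable:
  fixes \<mu> :: "real \<Rightarrow> 'a::metric_space set \<Rightarrow> real"
  assumes S: "S \<in> sets borel" and c: "narrow_continuous_on (restrict_space borel S) I \<mu>" and "I' \<subseteq> I"
    and vm: "\<And>t. t \<in> I \<Longrightarrow> vector_measure (restrict_space borel S) (\<mu> t)"
    and f: "f \<in> bmeas (restrict_space borel S)"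
  shows "(\<lambda>t. signed_integral (restrict_space borel S) (\<mu> t) f) \<in> borel_measurable (restrict_space borel I')"
  using f S
proof (rule bcont_induct)
  let ?M = "restrict_space borel S"
  have sl: "sigma_linear ?M (signed_integral ?M (\<mu> t))" if "t \<in> space (restrict_space borel I')" for t
    using that \<open>I' \<subseteq> I\<close> by (intro sigma_linear_signed_integral vm) (auto simp: space_restrict_space)
  show "(\<lambda>t. signed_integral ?M (\<mu> t) f) \<in> borel_measurable (restrict_space borel I')"
    if "f \<in> bcont S" for f
    using c that \<open>I' \<subseteq> I\<close> unfolding narrow_continuous_on_def
    by (intro borel_measurable_continuous_on_restrict) (auto simp: space_restrict_space intro: continuous_on_subset)
  fix f assume f: "f \<in> bmeas ?M" "(\<lambda>t. signed_integral ?M (\<mu> t) f) \<in> borel_measurable (restrict_space borel I')"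
  show "(\<lambda>t. signed_integral ?M (\<mu> t) (\<lambda>x. c * f x)) \<in> borel_measurable (restrict_space borel I')" for c
    using f(2) by (subst measurable_cong[OF sigma_linear_scale[OF sl f(1)]]) auto
  show "(\<lambda>t. signed_integral ?M (\<mu> t) (\<lambda>x. f x + g x)) \<in> borel_measurable (restrict_space borel I')"
    if g: "g \<in> bmeas ?M" "(\<lambda>t. signed_integral ?M (\<mu> t) g) \<in> borel_measurable (restrict_space borel I')" for g
    using f(2) g(2) by (subst measurable_cong[OF sigma_linear_add[OF sl f(1) g(1)]]) auto
next
  let ?M = "restrict_space borel S"
  have sl: "sigma_linear ?M (signed_integral ?M (\<mu> t))" if "t \<in> space (restrict_space borel I')" for t
    using that \<open>I' \<subseteq> I\<close> by (intro sigma_linear_signed_integral vm) (auto simp: space_restrict_space)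
  fix F :: "nat \<Rightarrow> _" and f K
  assume f: "f \<in> bmeas ?M" and *: "\<And>n. F n \<in> bmeas ?M"
    "\<And>n. (\<lambda>t. signed_integral ?M (\<mu> t) (F n)) \<in> borel_measurable (restrict_space borel I')"
    "\<And>n x. x \<in> S \<Longrightarrow> \<bar>F n x\<bar> \<le> K" "\<And>x. x \<in> S \<Longrightarrow> (\<lambda>n. F n x) \<longlonglongrightarrow> f x"
  have "(\<lambda>n. signed_integral ?M (\<mu> t) (F n)) \<longlonglongrightarrow> signed_integral ?M (\<mu> t) f"
    if "t \<in> space (restrict_space borel I')" for t
    by (rule sigma_linear_lim[OF sl[OF that] *(1) f, where K = K])
       (auto simp: space_restrict_space intro: *(3,4))
  then show "(\<lambda>t. signed_integral ?M (\<mu> t) f) \<in> borel_measurable (restrict_space borel I')"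
    by (rule borel_measurable_LIMSEQ_real[OF _ *(2)])
qed

section \<open>Space-time measures\<close>

abbreviation Leb :: "real \<Rightarrow> real measure"
  where "Leb T \<equiv> restrict_space lborel {0<..<T}"

lemma finite_measure_Leb: "finite_measure (Leb T)"
  by (rule finite_measureI, cases "T \<ge> 0") (simp_all add: emeasure_restrict_space space_restrict_space)

lemma space_Leb [simp]: "space (Leb T) = {0<..<T}"
  by (simp add: space_restrict_space)

lemma sets_Leb: "sets (Leb T) = sets (restrict_space borel {0<..<T})"
  by (simp add: sets_restrict_space)

lemma measurable_Leb: "f \<in> borel_measurable (restrict_space borel {0<..<T}) \<longleftrightarrow> f \<in> borel_measurable (Leb T)"
  by (simp add: measurable_cong_sets[OF sets_Leb refl])

lemma set_LINT_Leb: "A \<subseteq> {0<..<T} \<Longrightarrow> A \<in> sets borel \<Longrightarrow>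
    (LINT t:A|lborel. f t) = (LINT t|Leb T. indicator A t * (f t :: real))"
  unfolding set_lebesgue_integral_def
  by (subst integral_restrict_space) (auto intro!: Bochner_Integration.integral_cong split: split_indicator)

lemma set_LINT_Leb_full: "(LINT t:{0<..<T}|lborel. f t) = (LINT t|Leb T. (f t :: real))"
  unfolding set_lebesgue_integral_def by (subst integral_restrict_space) auto

lemma space_ST: "space (ST T) = {0<..<T} \<times> UNIV"
  by (simp add: ST_def space_restrict_space)

lemma bmeas_ST_section:
  assumes "f \<in> bmeas (ST T)" "t \<in> {0<..<T}"
  shows "(\<lambda>x. f (t, x)) \<in> bmeas borel"
proof (rule bmeas_compose[OF assms(1)])
  show "(\<lambda>x. (t, x)) \<in> borel \<rightarrow>\<^sub>M ST T"
    unfolding ST_def using assms(2) by (intro measurable_restrict_space2) auto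
qed

locale bounded_family =
  fixes T :: real and \<mu> :: "real \<Rightarrow> torus set \<Rightarrow> real" and c :: real
  assumes vm: "\<And>t. t \<in> {0<..<T} \<Longrightarrow> vector_measure borel (\<mu> t)"
    and bound: "\<And>t A. t \<in> {0<..<T} \<Longrightarrow> A \<in> sets borel \<Longrightarrow> \<bar>\<mu> t A\<bar> \<le> c"
    and meas: "\<And>A. A \<in> sets borel \<Longrightarrow> (\<lambda>t. \<mu> t A) \<in> borel_measurable (Leb T)"
begin

lemma sl: "t \<in> {0<..<T} \<Longrightarrow> sigma_linear borel (signed_integral borel (\<mu> t))"
  by (intro sigma_linear_signed_integral vm)

lemma section_measurable:
  assumes "f \<in> bmeas (ST T)"
  shows "(\<lambda>t. signed_integral borel (\<mu> t) (\<lambda>x. f (t, x))) \<in> borel_measurable (Leb T)"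
  using assms
proof (rule bmeas_induct)
  let ?B = "{A \<times> B | A B. A \<in> sets borel \<and> B \<in> sets borel} :: (real \<times> torus) set set"
  let ?S = "{0<..<T} \<times> (UNIV :: torus set)"
  let ?G = "(\<inter>) ?S ` ?B"
  show "Int_stable ?G"
    unfolding Int_stable_def
  proof safe
    fix A A' :: "real set" and B B' :: "torus set"
    assume "A \<in> sets borel" "B \<in> sets borel" "A' \<in> sets borel" "B' \<in> sets borel"
    then show "?S \<inter> A \<times> B \<inter> (?S \<inter> A' \<times> B') \<in> ?G"
      by (intro image_eqI[where x = "(A \<inter> A') \<times> (B \<inter> B')"]) auto
  qed
  show "?G \<subseteq> Pow (space (ST T))"
    by (auto simp: space_ST)
  have gen: "sets (borel :: (real \<times> torus) measure) = sigma_sets UNIV ?B"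
    by (simp add: borel_prod[symmetric] sets_pair_measure)
  have "open ?S" by (intro open_Times) auto
  then have "?S \<in> sets borel" by (rule borel_open)
  then show "sets (ST T) = sigma_sets (space (ST T)) ?G"
    using sigma_sets_Int[of ?S UNIV ?B] by (simp add: space_ST sets_restrict_space ST_def gen)
  have *: "(\<lambda>t. signed_integral borel (\<mu> t) (indicator B)) \<in> borel_measurable (Leb T)" if "B \<in> sets borel" for B
    using meas[OF that]
    by (subst measurable_cong[OF signed_integral_indicator[OF vm that]]) auto
  show "(\<lambda>t. signed_integral borel (\<mu> t) (\<lambda>x. indicator A (t, x))) \<in> borel_measurable (Leb T)"
    if A: "A \<in> ?G" for A
  proof -
    obtain A' B' where AB: "A = ?S \<inter> A' \<times> B'" "A' \<in> sets borel" "B' \<in> sets borel"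
      using A by auto
    have [measurable]: "indicator A' \<in> borel_measurable (Leb T)"
      using AB(2) by (intro measurable_restrict_space1) auto
    have "signed_integral borel (\<mu> t) (\<lambda>x. indicator A (t, x)) = indicator A' t * signed_integral borel (\<mu> t) (indicator B')"
      if t: "t \<in> space (Leb T)" for t
    proof -
      have "(\<lambda>x. indicator A (t, x) :: real) = (\<lambda>x. indicator A' t * indicator B' x)"
        using t AB(1) by (auto simp: fun_eq_iff split: split_indicator)
      then show ?thesis
        using t sigma_linear_scale[OF sl bmeas_indicator[OF AB(3)]] by simp
    qed
    moreover have "(\<lambda>t. indicator A' t * signed_integral borel (\<mu> t) (indicator B')) \<in> borel_measurable (Leb T)"
      using *[OF AB(3)] by measurable
    ultimately show ?thesis
      by (rule measurable_cong[THEN iffD2])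
  qed
  have "(\<lambda>_. 1 :: real) = indicator (UNIV :: torus set)" by auto
  then show "(\<lambda>t. signed_integral borel (\<mu> t) (\<lambda>x. 1)) \<in> borel_measurable (Leb T)"
    using *[of UNIV] by simp
next
  fix f assume f: "f \<in> bmeas (ST T)"
    "(\<lambda>t. signed_integral borel (\<mu> t) (\<lambda>x. f (t, x))) \<in> borel_measurable (Leb T)"
  show "(\<lambda>t. signed_integral borel (\<mu> t) (\<lambda>x. c * f (t, x))) \<in> borel_measurable (Leb T)" for c
    using f(2) by (subst measurable_cong[OF sigma_linear_scale[OF sl bmeas_ST_section[OF f(1)]]]) auto
  show "(\<lambda>t. signed_integral borel (\<mu> t) (\<lambda>x. f (t, x) + g (t, x))) \<in> borel_measurable (Leb T)"
    if g: "g \<in> bmeas (ST T)" "(\<lambda>t. signed_integral borel (\<mu> t) (\<lambda>x. g (t, x))) \<in> borel_measurable (Leb T)" for g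
    using f(2) g(2)
    by (subst measurable_cong[OF sigma_linear_add[OF sl bmeas_ST_section[OF f(1)] bmeas_ST_section[OF g(1)]]]) auto
next
  fix F :: "nat \<Rightarrow> _" and f K
  assume *: "f \<in> bmeas (ST T)" "\<And>n. F n \<in> bmeas (ST T)"
    "\<And>n. (\<lambda>t. signed_integral borel (\<mu> t) (\<lambda>x. F n (t, x))) \<in> borel_measurable (Leb T)"
    "\<And>n x. x \<in> space (ST T) \<Longrightarrow> \<bar>F n x\<bar> \<le> K" "\<And>x. x \<in> space (ST T) \<Longrightarrow> (\<lambda>n. F n x) \<longlonglongrightarrow> f x"
  have "(\<lambda>n. signed_integral borel (\<mu> t) (\<lambda>x. F n (t, x))) \<longlonglongrightarrow> signed_integral borel (\<mu> t) (\<lambda>x. f (t, x))"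
    if "t \<in> space (Leb T)" for t
    using that by (intro sigma_linear_lim[OF sl, where K = K] bmeas_ST_section[where T = T] * ) (auto simp: space_ST)
  then show "(\<lambda>t. signed_integral borel (\<mu> t) (\<lambda>x. f (t, x))) \<in> borel_measurable (Leb T)"
    by (rule borel_measurable_LIMSEQ_real[OF _ *(3)])
qed

lemma section_bound:
  assumes "\<And>z. z \<in> space (ST T) \<Longrightarrow> \<bar>f z\<bar> \<le> K" "K \<ge> 0" "t \<in> {0<..<T}"
  shows "\<bar>signed_integral borel (\<mu> t) (\<lambda>x. f (t, x))\<bar> \<le> 2 * c * K"
  using assms by (intro signed_integral_bound bound) (auto simp: space_ST)

lemma section_integrable:
  assumes "f \<in> bmeas (ST T)"
  shows "integrable (Leb T) (\<lambda>t. signed_integral borel (\<mu> t) (\<lambda>x. f (t, x)))"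
proof -
  obtain K where "K > 0" "\<And>z. z \<in> space (ST T) \<Longrightarrow> \<bar>f z\<bar> \<le> K"
    using assms by (metis bmeasE)
  then show ?thesis
    using section_measurable[OF assms] section_bound[of f K]
    by (intro finite_measure.integrable_const_bound[OF finite_measure_Leb, of _ "2 * c * K"]) (auto intro!: AE_I2)
qed

lemma sigma_linear_sections:
  "sigma_linear (ST T) (\<lambda>f. LINT t|Leb T. signed_integral borel (\<mu> t) (\<lambda>x. f (t, x)))"
  unfolding sigma_linear_def
proof (intro conjI ballI allI impI)
  fix f assume f: "f \<in> bmeas (ST T)"
  show "(LINT t|Leb T. signed_integral borel (\<mu> t) (\<lambda>x. c * f (t, x))) =
      c * (LINT t|Leb T. signed_integral borel (\<mu> t) (\<lambda>x. f (t, x)))" for c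
    by (subst Bochner_Integration.integral_cong[OF refl sigma_linear_scale[OF sl bmeas_ST_section[OF f]]]) auto
  show "(LINT t|Leb T. signed_integral borel (\<mu> t) (\<lambda>x. f (t, x) + g (t, x))) =
      (LINT t|Leb T. signed_integral borel (\<mu> t) (\<lambda>x. f (t, x))) +
      (LINT t|Leb T. signed_integral borel (\<mu> t) (\<lambda>x. g (t, x)))" if g: "g \<in> bmeas (ST T)" for g
    using section_integrable[OF f] section_integrable[OF g]
    by (subst Bochner_Integration.integral_cong[OF refl sigma_linear_add[OF sl bmeas_ST_section[OF f] bmeas_ST_section[OF g]]]) auto
next
  fix F :: "nat \<Rightarrow> _" and f K
  assume *: "\<forall>n. F n \<in> bmeas (ST T)" "f \<in> bmeas (ST T)" "\<forall>n. \<forall>x\<in>space (ST T). \<bar>F n x\<bar> \<le> K"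
    "\<forall>x\<in>space (ST T). (\<lambda>n. F n x) \<longlonglongrightarrow> f x"
  show "(\<lambda>n. LINT t|Leb T. signed_integral borel (\<mu> t) (\<lambda>x. F n (t, x)))
    \<longlonglongrightarrow> (LINT t|Leb T. signed_integral borel (\<mu> t) (\<lambda>x. f (t, x)))"
  proof (rule integral_dominated_convergence[where w = "\<lambda>_. 2 * c * \<bar>K\<bar>"])
    show "(\<lambda>t. signed_integral borel (\<mu> t) (\<lambda>x. f (t, x))) \<in> borel_measurable (Leb T)"
      using * by (intro section_measurable) auto
    show "(\<lambda>t. signed_integral borel (\<mu> t) (\<lambda>x. F n (t, x))) \<in> borel_measurable (Leb T)" for n
      using * by (intro section_measurable) auto
    show "integrable (Leb T) (\<lambda>_. 2 * c * \<bar>K\<bar>)"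
      using finite_measure.integrable_const[OF finite_measure_Leb] .
    show "AE t in Leb T. norm (signed_integral borel (\<mu> t) (\<lambda>x. F n (t, x))) \<le> 2 * c * \<bar>K\<bar>" for n
    proof (rule AE_I2)
      fix t assume "t \<in> space (Leb T)"
      moreover have "\<bar>F n z\<bar> \<le> \<bar>K\<bar>" if "z \<in> space (ST T)" for z
        using * that by (meson abs_ge_self order_trans)
      ultimately show "norm (signed_integral borel (\<mu> t) (\<lambda>x. F n (t, x))) \<le> 2 * c * \<bar>K\<bar>"
        using section_bound[of "F n" "\<bar>K\<bar>" t] by simp
    qed
    show "AE t in Leb T. (\<lambda>n. signed_integral borel (\<mu> t) (\<lambda>x. F n (t, x)))
        \<longlonglongrightarrow> signed_integral borel (\<mu> t) (\<lambda>x. f (t, x))"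
      using * by (intro AE_I2 sigma_linear_lim[OF sl, where K = K] bmeas_ST_section[where T = T]) (auto simp: space_ST)
  qed
qed

lemma spacetime_eq:
  assumes B: "B \<in> sets (ST T)"
  shows "spacetime T \<mu> B = (LINT t|Leb T. signed_integral borel (\<mu> t) (\<lambda>x. indicator B (t, x)))"
  unfolding spacetime_def set_LINT_Leb_full
proof (rule Bochner_Integration.integral_cong[OF refl])
  fix t assume "t \<in> space (Leb T)"
  then have t: "t \<in> {0<..<T}" by simp
  have ind: "(\<lambda>x. indicator B (t, x)) = (indicator {x. (t, x) \<in> B} :: torus \<Rightarrow> real)"
    by (auto simp: indicator_def)
  have "(\<lambda>x. (t, x)) \<in> borel \<rightarrow>\<^sub>M ST T"
    unfolding ST_def using t by (intro measurable_restrict_space2) auto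
  from measurable_sets[OF this B] have "{x. (t, x) \<in> B} \<in> sets borel"
    by (simp add: vimage_def)
  then show "\<mu> t {x. (t, x) \<in> B} = signed_integral borel (\<mu> t) (\<lambda>x. indicator B (t, x))"
    by (simp add: ind signed_integral_indicator[OF vm[OF t]])
qed

lemma vector_measure_spacetime: "vector_measure (ST T) (spacetime T \<mu>)"
  using sigma_linear_vector_measure[OF sigma_linear_sections]
  by (rule vector_measure_cong) (simp add: spacetime_eq)

lemma signed_integral_spacetime:
  "f \<in> bmeas (ST T) \<Longrightarrow>
    signed_integral (ST T) (spacetime T \<mu>) f = (LINT t|Leb T. signed_integral borel (\<mu> t) (\<lambda>x. f (t, x)))"
  by (rule signed_integral_eqI[OF sigma_linear_sections spacetime_eq])

end

text \<open>No measurability of the Lagrangian \<open>L\<close> in time is available, so its integral is only monotone: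
  it is neither additive, nor does its finiteness give \<open>L t < \<infinity>\<close> almost everywhere. Hence only
  measurable lower bounds of \<open>L\<close> are integrated.\<close>

lemma remainder_bound:
  fixes h :: "real \<Rightarrow> real" and L :: "real \<Rightarrow> ennreal"
  assumes L: "(\<integral>\<^sup>+t\<in>{0<..<T}. L t \<partial>lborel) \<le> ennreal C" and "C \<ge> 0" "T > 0" "a > 0" "b \<ge> 0"
    and h: "h \<in> borel_measurable (Leb T)"
    and le: "\<And>t. t \<in> {0<..<T} \<Longrightarrow> ennreal (a * \<bar>h t\<bar> - b) \<le> L t"
  shows "integrable (Leb T) h" "(LINT t|Leb T. \<bar>h t\<bar>) \<le> (C + b * T) / a"
proof -
  have "(\<integral>\<^sup>+t. ennreal (a * \<bar>h t\<bar>) \<partial>Leb T) \<le> (\<integral>\<^sup>+t. ennreal (a * \<bar>h t\<bar> - b) + ennreal b \<partial>Leb T)"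
  proof (rule nn_integral_mono)
    fix t show "ennreal (a * \<bar>h t\<bar>) \<le> ennreal (a * \<bar>h t\<bar> - b) + ennreal b"
      using \<open>b \<ge> 0\<close> by (cases "a * \<bar>h t\<bar> \<ge> b") (auto simp: ennreal_plus[symmetric] ennreal_neg intro: ennreal_leI simp del: ennreal_plus)
  qed
  also have "\<dots> = (\<integral>\<^sup>+t. ennreal (a * \<bar>h t\<bar> - b) \<partial>Leb T) + (\<integral>\<^sup>+t. ennreal b \<partial>Leb T)"
    using h by (intro nn_integral_add) auto
  also have "(\<integral>\<^sup>+t. ennreal (a * \<bar>h t\<bar> - b) \<partial>Leb T) \<le> (\<integral>\<^sup>+t\<in>{0<..<T}. L t \<partial>lborel)"
    by (subst nn_integral_restrict_space) (auto intro!: nn_integral_mono le split: split_indicator)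
  also have "(\<integral>\<^sup>+t. ennreal b \<partial>Leb T) = ennreal (b * T)"
    using \<open>b \<ge> 0\<close> \<open>T > 0\<close> by (simp add: emeasure_restrict_space ennreal_mult)
  finally have "(\<integral>\<^sup>+t. ennreal (a * \<bar>h t\<bar>) \<partial>Leb T) \<le> (\<integral>\<^sup>+t\<in>{0<..<T}. L t \<partial>lborel) + ennreal (b * T)"
    by (simp add: add_right_mono)
  also have "\<dots> \<le> ennreal C + ennreal (b * T)"
    by (intro add_right_mono L)
  also have "\<dots> = ennreal (C + b * T)"
    using assms by simp
  finally have fin: "(\<integral>\<^sup>+t. ennreal (a * \<bar>h t\<bar>) \<partial>Leb T) \<le> ennreal (C + b * T)" .
  have "integrable (Leb T) (\<lambda>t. a * \<bar>h t\<bar>)"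
    using fin h \<open>a > 0\<close> by (intro integrableI_nonneg) (auto simp: order_le_less_trans top_unique less_top[symmetric])
  then have i: "integrable (Leb T) (\<lambda>t. \<bar>h t\<bar>)"
    using \<open>a > 0\<close> by simp
  then show "integrable (Leb T) h"
    using h by (simp add: integrable_abs_iff)
  have "ennreal (a * (LINT t|Leb T. \<bar>h t\<bar>)) = (\<integral>\<^sup>+t. ennreal (a * \<bar>h t\<bar>) \<partial>Leb T)"
    using i \<open>a > 0\<close> by (subst nn_integral_eq_integral) auto
  with fin have "ennreal (a * (LINT t|Leb T. \<bar>h t\<bar>)) \<le> ennreal (C + b * T)"
    by simp
  then have "a * (LINT t|Leb T. \<bar>h t\<bar>) \<le> C + b * T"
    using assms by (subst (asm) ennreal_le_iff) auto
  then show "(LINT t|Leb T. \<bar>h t\<bar>) \<le> (C + b * T) / a"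
    using \<open>a > 0\<close> by (simp add: field_simps)
qed

section \<open>The kinetic model at a fixed rate\<close>

lemma Omega_Sigma_borel: "UNIV \<times> {-V, V} \<in> sets (borel :: (torus \<times> real) measure)"
  by (intro borel_closed closed_Times) (auto intro: finite_imp_closed)

lemma space_Omega: "space (Omega V) = UNIV \<times> {-V, V}"
  by (simp add: Omega_def space_restrict_space)

lemma continuous_bcont_Omega:
  fixes f :: "torus \<times> real \<Rightarrow> real"
  assumes "continuous_on UNIV f"
  shows "f \<in> bcont (UNIV \<times> {-V, V})"
proof -
  have "compact (UNIV \<times> {-V, V} :: (torus \<times> real) set)"
    by (intro compact_Times compact_UNIV_torus finite_imp_compact) simp
  then have "compact (f ` (UNIV \<times> {-V, V}))"
    using assms by (intro compact_continuous_image) (auto intro: continuous_on_subset)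
  then show ?thesis
    using assms by (auto simp: bcont_def intro: compact_imp_bounded continuous_on_subset)
qed

lemma continuous_bmeas_Omega:
  fixes f :: "torus \<times> real \<Rightarrow> real"
  shows "continuous_on UNIV f \<Longrightarrow> f \<in> bmeas (Omega V)"
  unfolding Omega_def by (rule bcont_bmeas[OF continuous_bcont_Omega Omega_Sigma_borel])

lemma continuous_bmeas_torus:
  fixes f :: "torus \<Rightarrow> real"
  assumes "continuous_on UNIV f"
  shows "f \<in> bcont UNIV" "f \<in> bmeas borel"
proof -
  obtain K where "\<And>p. \<bar>f p\<bar> \<le> K" using bounded_torus[OF assms] by blast
  then show "f \<in> bcont UNIV"
    using assms by (auto simp: bcont_def bounded_iff)
  then show "f \<in> bmeas borel"
    using assms by (auto simp: bcont_def bmeas_def intro: borel_measurable_continuous_onI)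
qed

lemma deriv_torus_cmult:
  assumes "C1_torus f"
  shows "C1_torus (\<lambda>x. c * f x)" "deriv_torus (\<lambda>x. c * f x) p = c * deriv_torus f p"
proof -
  show "C1_torus (\<lambda>x. c * f x)"
    using assms unfolding C1_torus_def by (intro C1_differentiable_on_mult) auto
  have "(\<lambda>x. f (torus_of x)) field_differentiable (at x)" for x
    using assms unfolding C1_torus_def C1_differentiable_on_def
    by (auto simp: field_differentiable_def has_real_derivative_iff_has_vector_derivative)
  then show "deriv_torus (\<lambda>x. c * f x) p = c * deriv_torus f p"
    by (simp add: deriv_torus_def deriv_cmult)
qed

lemma fst_Omega_measurable: "fst \<in> Omega V \<rightarrow>\<^sub>M borel"
  unfolding Omega_def borel_prod[symmetric] by (intro measurable_restrict_space1) simp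

lemma slice_sets: "A \<in> sets borel \<Longrightarrow> v \<in> {-V, V} \<Longrightarrow> A \<times> {v} \<in> sets (Omega V)"
proof -
  assume A: "A \<in> sets borel" "v \<in> {-V, V}"
  then have "A \<times> {v} \<in> sets (borel \<Otimes>\<^sub>M borel)" by auto
  then have "A \<times> {v} \<in> sets borel" by (simp only: borel_prod)
  moreover have "A \<times> {v} = (UNIV \<times> {-V, V}) \<inter> (A \<times> {v})" using A by auto
  ultimately show ?thesis
    unfolding Omega_def sets_restrict_space by (rule image_eqI[rotated])
qed

lemma slice_decomposition:
  assumes "V > 0" "z \<in> space (Omega V)"
  shows "q (snd z) * indicator A (fst z) =
    (q V * indicator (A \<times> {V}) z + q (-V) * indicator (A \<times> {-V}) z :: real)"
  using assms by (auto simp: space_Omega split: split_indicator)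

locale velocity_measure = prob_space \<sigma> for \<sigma> :: "(torus \<times> real) measure" +
  fixes V :: real
  assumes V: "V > 0" and sets_eq: "sets \<sigma> = sets (Omega V)"
begin

lemma space_eq: "space \<sigma> = UNIV \<times> {-V, V}"
  using sets_eq_imp_space_eq[OF sets_eq] by (simp add: space_Omega)

lemma integrable_continuous:
  fixes f :: "torus \<times> real \<Rightarrow> real"
  shows "continuous_on UNIV f \<Longrightarrow> integrable \<sigma> f"
  using continuous_bmeas_Omega[of f V] bmeas_cong_sets[OF sets_eq]
  by (intro integrable_bmeas finite_measure_axioms) auto

lemma fst_measurable: "fst \<in> \<sigma> \<rightarrow>\<^sub>M borel"
  using fst_Omega_measurable measurable_cong_sets[OF sets_eq refl] by blast

lemma moment_sigma_linear:
  assumes "continuous_on UNIV q"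
  shows "sigma_linear borel (\<lambda>f. LINT z|\<sigma>. q (snd z) * f (fst z))"
  using assms by (intro sigma_linear_LINT integrable_continuous fst_measurable)
    (auto intro!: continuous_intros continuous_on_compose2[OF assms])

lemma moment_eq:
  assumes A: "A \<in> sets borel"
  shows "(\<Sum>v\<in>{-V, V}. q v * measure \<sigma> (A \<times> {v})) = (LINT z|\<sigma>. q (snd z) * indicator A (fst z))"
proof -
  have s: "A \<times> {v} \<in> sets \<sigma>" if "v \<in> {-V, V}" for v
    using slice_sets[OF A that] sets_eq by simp
  have "(LINT z|\<sigma>. q (snd z) * indicator A (fst z)) =
    (LINT z|\<sigma>. q V * indicator (A \<times> {V}) z + q (-V) * indicator (A \<times> {-V}) z)"
    using V by (intro Bochner_Integration.integral_cong refl slice_decomposition)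
      (auto simp: space_eq space_Omega)
  also have "\<dots> = q V * measure \<sigma> (A \<times> {V}) + q (-V) * measure \<sigma> (A \<times> {-V})"
    using s by (subst Bochner_Integration.integral_add) (auto simp: emeasure_eq_measure Int_absorb2 sets.sets_into_space)
  also have "\<dots> = (\<Sum>v\<in>{-V, V}. q v * measure \<sigma> (A \<times> {v}))"
    using V by (subst sum.insert) auto
  finally show ?thesis ..
qed

lemma rho_of_eq: "A \<in> sets borel \<Longrightarrow> rho_of V \<sigma> A = (LINT z|\<sigma>. 1 * indicator A (fst z))"
  using moment_eq[of A "\<lambda>_. 1"] by (simp add: rho_of_def)

lemma omega_of_eq: "A \<in> sets borel \<Longrightarrow> omega_of V \<sigma> A = (LINT z|\<sigma>. snd z * indicator A (fst z))"
  using moment_eq[of A "\<lambda>v. v"] by (simp add: omega_of_def)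

lemma vector_measure_moments: "vector_measure borel (rho_of V \<sigma>)" "vector_measure borel (omega_of V \<sigma>)"
  using vector_measure_cong[OF sigma_linear_vector_measure[OF moment_sigma_linear[of "\<lambda>_. 1"]]]
    vector_measure_cong[OF sigma_linear_vector_measure[OF moment_sigma_linear[of "\<lambda>v. v"]]]
  by (auto simp: rho_of_eq omega_of_eq)

lemma signed_integral_rho: "f \<in> bmeas borel \<Longrightarrow> signed_integral borel (rho_of V \<sigma>) f = (LINT z|\<sigma>. f (fst z))"
  using signed_integral_eqI[OF moment_sigma_linear[of "\<lambda>_. 1"] rho_of_eq] by simp

lemma signed_integral_omega:
  "f \<in> bmeas borel \<Longrightarrow> signed_integral borel (omega_of V \<sigma>) f = (LINT z|\<sigma>. snd z * f (fst z))"
  using signed_integral_eqI[OF moment_sigma_linear[of "\<lambda>v. v"] omega_of_eq] by simp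

lemma abs_LINT_le:
  fixes f :: "torus \<times> real \<Rightarrow> real"
  assumes "\<And>z. z \<in> space \<sigma> \<Longrightarrow> \<bar>f z\<bar> \<le> K" "K \<ge> 0"
  shows "\<bar>LINT z|\<sigma>. f z\<bar> \<le> K"
proof (cases "integrable \<sigma> f")
  case True
  have "\<bar>LINT z|\<sigma>. f z\<bar> \<le> (LINT z|\<sigma>. \<bar>f z\<bar>)"
    by (rule integral_abs_bound)
  also have "\<dots> \<le> (LINT z|\<sigma>. K)"
    using True assms by (intro integral_mono) auto
  finally show ?thesis by (simp add: prob_space)
qed (use assms in \<open>simp add: not_integrable_integral_eq\<close>)

lemma moments_bound: "A \<in> sets borel \<Longrightarrow> \<bar>rho_of V \<sigma> A\<bar> \<le> 1" "A \<in> sets borel \<Longrightarrow> \<bar>omega_of V \<sigma> A\<bar> \<le> V"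
  unfolding rho_of_eq omega_of_eq
  by (rule abs_LINT_le, use V in \<open>auto simp: space_eq split: split_indicator\<close>)+

end

locale kinetic =
  fixes V T C l :: real and \<sigma> :: "real \<Rightarrow> (torus \<times> real) measure"
    and j :: "real \<Rightarrow> (torus \<times> real) set \<Rightarrow> real \<times> real"
  assumes V: "V > 0" and T: "T > 0" and C: "C > 0" and l: "l > 0"
    and CE: "CE V T \<sigma> j" and act: "action V T l \<sigma> j \<le> ennreal C"
begin

lemma velocity_measure: "t \<in> {0..T} \<Longrightarrow> velocity_measure (\<sigma> t) V"
  using CE V by (simp add: CE_def prob_measure_on_def velocity_measure_def velocity_measure_axioms_def)

lemma vector_measure_flux:
  assumes "t \<in> {0<..<T}"
  shows "vector_measure (Omega V) (\<lambda>A. fst (j t A))" "vector_measure (Omega V) (\<lambda>A. snd (j t A))"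
proof -
  have "vector_measure (Omega V) (j t)"
    using CE assms by (simp add: CE_def integrable_family_def)
  then show "vector_measure (Omega V) (\<lambda>A. fst (j t A))" "vector_measure (Omega V) (\<lambda>A. snd (j t A))"
    by (auto intro: vector_measure_bounded_linear bounded_linear_fst bounded_linear_snd)
qed

lemma LINT_measurable:
  assumes f: "f \<in> bmeas (Omega V)"
  shows "(\<lambda>t. LINT z|\<sigma> t. f z) \<in> borel_measurable (Leb T)"
proof -
  have vm: "t \<in> {0..T} \<Longrightarrow> finite_measure (\<sigma> t) \<and> sets (\<sigma> t) = sets (Omega V)" for t
    using velocity_measure[of t]
    by (simp add: velocity_measure_def velocity_measure_axioms_def prob_space_def)
  have "(\<lambda>t. signed_integral (Omega V) (measure (\<sigma> t)) f) \<in> borel_measurable (restrict_space borel {0<..<T})"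
    unfolding Omega_def
  proof (rule narrow_continuous_measurable[OF Omega_Sigma_borel])
    show "narrow_continuous_on (restrict_space borel (UNIV \<times> {-V, V})) {0..T} (\<lambda>t. measure (\<sigma> t))"
      using CE by (simp add: CE_def Omega_def)
    show "vector_measure (restrict_space borel (UNIV \<times> {-V, V})) (measure (\<sigma> t))" if "t \<in> {0..T}" for t
      using vm[OF that] unfolding Omega_def by (intro vector_measure_measure) auto
  qed (use f in \<open>auto simp: Omega_def\<close>)
  then show ?thesis
    unfolding measurable_Leb
    by (rule measurable_cong[THEN iffD1, rotated]) (use vm f in \<open>auto simp: signed_integral_measure\<close>)
qed

lemma flux_measurable:
  assumes f: "f \<in> bmeas (Omega V)"
  shows "(\<lambda>t. signed_integral (Omega V) (\<lambda>A. fst (j t A)) f) \<in> borel_measurable (Leb T)"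
    "(\<lambda>t. signed_integral (Omega V) (\<lambda>A. snd (j t A)) f) \<in> borel_measurable (Leb T)"
proof -
  have "(\<lambda>t. j t A) \<in> borel_measurable (Leb T)" if "A \<in> sets (Omega V)" for A
    using CE that unfolding CE_def integrable_family_def measurable_Leb by blast
  then have "(\<lambda>t. fst (j t A)) \<in> borel_measurable (Leb T)" "(\<lambda>t. snd (j t A)) \<in> borel_measurable (Leb T)"
    if "A \<in> sets (Omega V)" for A
    using that by (auto intro!: measurable_compose[of "\<lambda>t. j t A" _ _ fst] measurable_compose[of "\<lambda>t. j t A" _ _ snd]
        borel_measurable_continuous_onI continuous_on_fst continuous_on_snd continuous_on_id)
  then show "(\<lambda>t. signed_integral (Omega V) (\<lambda>A. fst (j t A)) f) \<in> borel_measurable (Leb T)"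
    "(\<lambda>t. signed_integral (Omega V) (\<lambda>A. snd (j t A)) f) \<in> borel_measurable (Leb T)"
    using f vector_measure_flux by (auto intro!: signed_integral_measurable)
qed

lemma action_integral: "(\<integral>\<^sup>+t\<in>{0<..<T}. lagrangian V l (\<sigma> t) (j t) \<partial>lborel) \<le> ennreal C"
  using act CE by (simp add: action_def)

lemma lagrangian_ge:
  assumes t: "t \<in> {0<..<T}" and f: "f \<in> bmeas (Omega V)" and g: "g \<in> bmeas (Omega V)"
    "\<And>z. z \<in> space (Omega V) \<Longrightarrow> \<bar>g z\<bar> \<le> c" and a: "a > 0"
  shows "ennreal (a * \<bar>signed_integral (Omega V) (\<lambda>A. fst (j t A)) f - (LINT z|\<sigma> t. snd z * f z) +
      signed_integral (Omega V) (\<lambda>A. snd (j t A)) g\<bar> - l * exp (a * c)) \<le> lagrangian V l (\<sigma> t) (j t)"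
proof (cases "\<forall>A\<in>sets (Omega V). fst (j t A) = (LINT z:A|\<sigma> t. snd z)")
  case True
  interpret velocity_measure "\<sigma> t" V using t by (intro velocity_measure) auto
  have "sigma_linear (Omega V) (\<lambda>f. LINT z|\<sigma> t. snd z * f z)"
    using sigma_linear_LINT[OF integrable_continuous[OF continuous_on_snd[OF continuous_on_id]]
        measurable_ident_sets[OF sets_eq]] by simp
  then have "signed_integral (Omega V) (\<lambda>A. fst (j t A)) f = (LINT z|\<sigma> t. snd z * f z)"
    using True by (intro signed_integral_eqI f) (auto simp: set_lebesgue_integral_def mult.commute)
  moreover have "lagrangian V l (\<sigma> t) (j t) = Ent (\<lambda>A. snd (j t A)) (scale_measure (ennreal l) (\<sigma> t))"
    unfolding lagrangian_def using True by (rule if_P)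
  ultimately show ?thesis
    using Ent_scale_ge[OF prob_space_axioms sets_eq vector_measure_flux(2)[OF t] g a l] by simp
next
  case False
  then have "lagrangian V l (\<sigma> t) (j t) = \<infinity>"
    unfolding lagrangian_def by (rule if_not_P)
  then show ?thesis by simp
qed

lemma J_bound:
  assumes B: "B \<in> sets (ST T)" and a: "a > 0"
  shows "\<bar>spacetime T (\<lambda>t. J_of V (j t)) B\<bar> \<le> (C + l * exp (a * V) * T) / a"
proof -
  define h where "h t = J_of V (j t) {x. (t, x) \<in> B}" for t
  have le: "ennreal (a * \<bar>h t\<bar> - l * exp (a * V)) \<le> lagrangian V l (\<sigma> t) (j t)" if t: "t \<in> {0<..<T}" for t
  proof -
    interpret velocity_measure "\<sigma> t" V using t by (intro velocity_measure) auto
    let ?A = "{x. (t, x) \<in> B}" and ?S = "signed_integral (Omega V) (\<lambda>A. snd (j t A))"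
    have "(\<lambda>x. (t, x)) \<in> borel \<rightarrow>\<^sub>M ST T"
      unfolding ST_def using t by (intro measurable_restrict_space2) auto
    from measurable_sets[OF this B] have A: "?A \<in> sets borel"
      by (simp add: vimage_def)
    let ?g = "\<lambda>z. V * indicator (?A \<times> {V}) z + (-V) * indicator (?A \<times> {-V}) z :: real"
    have m: "indicator (?A \<times> {V}) \<in> bmeas (Omega V)" "indicator (?A \<times> {-V}) \<in> bmeas (Omega V)"
      using slice_sets[OF A] by (auto intro!: bmeas_indicator)
    have m': "(\<lambda>z. V * indicator (?A \<times> {V}) z :: real) \<in> bmeas (Omega V)"
        "(\<lambda>z. (-V) * indicator (?A \<times> {-V}) z :: real) \<in> bmeas (Omega V)"
      by (rule bmeas_mult[OF bmeas_const m(1)] bmeas_mult[OF bmeas_const m(2)])+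
    note sl = sigma_linear_signed_integral[OF vector_measure_flux(2)[OF t]]
    have "?S ?g = V * snd (j t (?A \<times> {V})) + (-V) * snd (j t (?A \<times> {-V}))"
      unfolding sigma_linear_add[OF sl m'] sigma_linear_scale[OF sl m(1)] sigma_linear_scale[OF sl m(2)]
      by (simp add: signed_integral_indicator[OF vector_measure_flux(2)[OF t]] slice_sets[OF A])
    also have "\<dots> = h t"
      unfolding h_def J_of_def using V by (subst sum.insert) auto
    finally have "h t = ?S ?g" ..
    moreover have "\<bar>?g z\<bar> \<le> V" for z
      using V by (auto split: split_indicator)
    ultimately show ?thesis
      using lagrangian_ge[OF t bmeas_const[of 0] bmeas_add[OF m'] _ a, of V]
        sigma_linear_zero[OF sigma_linear_signed_integral[OF vector_measure_flux(1)[OF t]]] by simp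
  qed
  have "\<bar>LINT t|Leb T. h t\<bar> \<le> (C + l * exp (a * V) * T) / a"
  proof (cases "integrable (Leb T) h")
    case True
    have "\<bar>LINT t|Leb T. h t\<bar> \<le> (LINT t|Leb T. \<bar>h t\<bar>)"
      by (rule integral_abs_bound)
    also have "\<dots> \<le> (C + l * exp (a * V) * T) / a"
      by (rule remainder_bound(2)[OF action_integral _ T a _ _ le]) (use True C l in auto)
    finally show ?thesis .
  qed (use C l T a in \<open>simp add: not_integrable_integral_eq\<close>)
  then show ?thesis
    by (simp add: spacetime_def set_LINT_Leb_full h_def)
qed

lemma balance:
  assumes \<psi>: "C1_torus \<psi>" and q: "continuous_on UNIV q" and st: "0 \<le> s" "s \<le> t" "t \<le> T" and a: "a > 0"
    and c: "\<And>x. \<bar>(q (-V) - q V) * \<psi> x\<bar> \<le> c"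
  shows "\<bar>(LINT z|\<sigma> t. q (snd z) * \<psi> (fst z)) - (LINT z|\<sigma> s. q (snd z) * \<psi> (fst z)) -
      (LINT r|Leb T. indicator {s<..<t} r * (LINT z|\<sigma> r. snd z * (q (snd z) * deriv_torus \<psi> (fst z))))\<bar>
    \<le> (C + l * exp (a * c) * T) / a"
proof -
  define \<phi> where "\<phi> z = q (snd z) * \<psi> (fst z)" for z
  define f where "f z = q (snd z) * deriv_torus \<psi> (fst z)" for z :: "torus \<times> real"
  define g where "g z = \<phi> (flip z) - \<phi> z" for z
  have cont: "continuous_on UNIV \<phi>" "continuous_on UNIV f" "continuous_on UNIV g"
    "continuous_on UNIV (\<lambda>z. snd z * f z)"
    unfolding g_def \<phi>_def f_def flip_def
    by (auto intro!: continuous_intros continuous_on_compose2[OF q] 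
        continuous_on_compose2[OF C1_torus_continuous[OF \<psi>]] continuous_on_compose2[OF C1_torus_continuous_deriv[OF \<psi>]])
  have dx: "dx \<phi> = f"
    by (auto simp: dx_def \<phi>_def f_def deriv_torus_cmult(2)[OF \<psi>])
  have C10: "C10 V \<phi>"
    by (auto simp: C10_def \<phi>_def deriv_torus_cmult(1)[OF \<psi>])
  have gc: "\<bar>g z\<bar> \<le> c" if "z \<in> space (Omega V)" for z
  proof -
    have "g z = (q (-V) - q V) * \<psi> (fst z) \<or> g z = - ((q (-V) - q V) * \<psi> (fst z))"
      using that by (auto simp: g_def \<phi>_def flip_def space_Omega algebra_simps)
    then show ?thesis using c[of "fst z"] by auto
  qed
  define w where "w r = (LINT z|\<sigma> r. snd z * f z)" for r
  define i where "i r = signed_integral (Omega V) (\<lambda>A. fst (j r A)) f + signed_integral (Omega V) (\<lambda>A. snd (j r A)) g" for r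
  define h where "h r = signed_integral (Omega V) (\<lambda>A. fst (j r A)) f - w r + signed_integral (Omega V) (\<lambda>A. snd (j r A)) g" for r
  have wm: "w \<in> borel_measurable (Leb T)"
    unfolding w_def by (intro LINT_measurable continuous_bmeas_Omega cont)
  have hm: "h \<in> borel_measurable (Leb T)"
    unfolding h_def by (intro borel_measurable_add borel_measurable_diff wm flux_measurable continuous_bmeas_Omega cont)
  have le: "ennreal (a * \<bar>h r\<bar> - l * exp (a * c)) \<le> lagrangian V l (\<sigma> r) (j r)" if "r \<in> {0<..<T}" for r
    unfolding h_def w_def using that gc a by (intro lagrangian_ge continuous_bmeas_Omega cont) auto
  note rem = remainder_bound[OF action_integral less_imp_le[OF C] T a _ hm le]
  have b: "l * exp (a * c) \<ge> 0" using l by simp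
  obtain K where K: "\<And>z. z \<in> space (Omega V) \<Longrightarrow> \<bar>snd z * f z\<bar> \<le> K" "K > 0"
    using bmeasE[OF continuous_bmeas_Omega[OF cont(4), of V]] by metis
  have iw: "integrable (Leb T) w"
  proof (rule finite_measure.integrable_const_bound[OF finite_measure_Leb _ wm, of K], rule AE_I2)
    fix r assume "r \<in> space (Leb T)"
    then interpret velocity_measure "\<sigma> r" V by (intro velocity_measure) auto
    show "norm (w r) \<le> K"
      unfolding w_def using K by (auto intro!: abs_LINT_le simp: space_Omega space_eq)
  qed
  have ind: "integrable (Leb T) (\<lambda>r. indicator {s<..<t} r * k r)" if "integrable (Leb T) k" for k :: "real \<Rightarrow> real"
  proof -
    have "{s<..<t} \<in> sets (Leb T)"
      using st by (auto simp: sets_restrict_space intro!: image_eqI[where x = "{s<..<t}"])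
    from integrable_mult_indicator[OF this that] show ?thesis by simp
  qed
  have "(LINT z|\<sigma> t. \<phi> z) - (LINT z|\<sigma> s. \<phi> z) = (LINT r:{s<..<t}|lborel. i r)"
    using CE C10 st unfolding CE_def i_def dx[symmetric] g_def by blast
  also have "\<dots> = (LINT r|Leb T. indicator {s<..<t} r * i r)"
    using st by (intro set_LINT_Leb) auto
  also have "\<dots> = (LINT r|Leb T. indicator {s<..<t} r * w r + indicator {s<..<t} r * h r)"
    by (intro Bochner_Integration.integral_cong) (auto simp: i_def h_def algebra_simps)
  also have "\<dots> = (LINT r|Leb T. indicator {s<..<t} r * w r) + (LINT r|Leb T. indicator {s<..<t} r * h r)"
    by (intro Bochner_Integration.integral_add ind iw rem(1)[OF b])
  finally have "\<bar>(LINT z|\<sigma> t. \<phi> z) - (LINT z|\<sigma> s. \<phi> z) - (LINT r|Leb T. indicator {s<..<t} r * w r)\<bar>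
    = \<bar>LINT r|Leb T. indicator {s<..<t} r * h r\<bar>"
    by simp
  also have "\<dots> \<le> (LINT r|Leb T. \<bar>indicator {s<..<t} r * h r\<bar>)"
    by (rule integral_abs_bound)
  also have "\<dots> \<le> (LINT r|Leb T. \<bar>h r\<bar>)"
    using ind[OF rem(1)[OF b]] rem(1)[OF b] by (intro integral_mono) (auto split: split_indicator)
  also have "\<dots> \<le> (C + l * exp (a * c) * T) / a"
    by (rule rem(2)[OF b])
  finally show ?thesis
    unfolding \<phi>_def w_def f_def .
qed

end

section \<open>Compactness\<close>

lemma C1_dense_convergence:
  fixes \<Phi> :: "'i \<Rightarrow> (torus \<Rightarrow> real) \<Rightarrow> real"
  assumes sl: "\<forall>\<^sub>F i in F. sigma_linear borel (\<Phi> i)" "sigma_linear borel \<Psi>"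
    and bd: "\<forall>\<^sub>F i in F. \<forall>f K. (\<forall>x. \<bar>f x\<bar> \<le> K) \<longrightarrow> \<bar>\<Phi> i f\<bar> \<le> B * K" "\<And>f K. (\<And>x. \<bar>f x\<bar> \<le> K) \<Longrightarrow> \<bar>\<Psi> f\<bar> \<le> B * K"
    and lim: "\<And>f. C1_torus f \<Longrightarrow> ((\<lambda>i. \<Phi> i f) \<longlongrightarrow> \<Psi> f) F"
    and "B > 0" and f: "continuous_on UNIV f"
  shows "((\<lambda>i. \<Phi> i f) \<longlongrightarrow> \<Psi> f) F"
  unfolding tendsto_iff
proof (intro allI impI)
  fix e :: real assume "e > 0"
  define d where "d = e / (3 * B)"
  have "d > 0" using \<open>e > 0\<close> \<open>B > 0\<close> by (simp add: d_def)
  then obtain g where g: "C1_torus g" "\<And>p. \<bar>f p - g p\<bar> < d"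
    using C1_torus_dense[OF f] by blast
  have m: "f \<in> bmeas borel" "g \<in> bmeas borel"
    using f C1_torus_continuous[OF g(1)] by (auto intro: continuous_bmeas_torus)
  have fg: "\<bar>f p - g p\<bar> \<le> d" for p using g(2)[of p] by simp
  have Bd: "B * d = e / 3" using \<open>B > 0\<close> by (simp add: d_def)
  have 2: "\<bar>\<Psi> f - \<Psi> g\<bar> \<le> e / 3"
    using bd(2)[of "\<lambda>p. f p - g p" d] fg sigma_linear_diff[OF sl(2) m] Bd by simp
  have "\<forall>\<^sub>F i in F. dist (\<Phi> i g) (\<Psi> g) < e / 3"
    using tendstoD[OF lim[OF g(1)], of "e / 3"] \<open>e > 0\<close> by simp
  with sl(1) bd(1) show "\<forall>\<^sub>F i in F. dist (\<Phi> i f) (\<Psi> f) < e"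
  proof eventually_elim
    case (elim i)
    have "\<bar>\<Phi> i f - \<Phi> i g\<bar> \<le> e / 3"
      using elim(2)[rule_format, of "\<lambda>p. f p - g p" d] fg sigma_linear_diff[OF elim(1) m] Bd by simp
    with 2 elim(3) show ?case
      unfolding dist_real_def by linarith
  qed
qed

lemma lipschitz_dense_continuous:
  fixes \<Phi> :: "real \<Rightarrow> (torus \<Rightarrow> real) \<Rightarrow> real"
  assumes sl: "\<And>t. t \<in> S \<Longrightarrow> sigma_linear borel (\<Phi> t)"
    and bd: "\<And>t f K. t \<in> S \<Longrightarrow> (\<And>x. \<bar>f x\<bar> \<le> K) \<Longrightarrow> \<bar>\<Phi> t f\<bar> \<le> B * K" and "B > 0"
    and lip: "\<And>f. C1_torus f \<Longrightarrow> \<exists>K. \<forall>s\<in>S. \<forall>t\<in>S. s \<le> t \<longrightarrow> \<bar>\<Phi> t f - \<Phi> s f\<bar> \<le> K * (t - s)"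
    and f: "continuous_on UNIV f"
  shows "continuous_on S (\<lambda>t. \<Phi> t f)"
  unfolding continuous_on_def
proof
  fix t assume t: "t \<in> S"
  have ev: "\<forall>\<^sub>F s in at t within S. s \<in> S" by (simp add: eventually_at_topological) blast
  show "((\<lambda>s. \<Phi> s f) \<longlongrightarrow> \<Phi> t f) (at t within S)"
  proof (rule C1_dense_convergence[where B = B and \<Phi> = \<Phi> and \<Psi> = "\<Phi> t"])
    fix g assume "C1_torus g"
    then obtain K where K: "\<And>s t. s \<in> S \<Longrightarrow> t \<in> S \<Longrightarrow> s \<le> t \<Longrightarrow> \<bar>\<Phi> t g - \<Phi> s g\<bar> \<le> K * (t - s)"
      using lip by blast
    have "((\<lambda>s. K * \<bar>s - t\<bar>) \<longlongrightarrow> K * \<bar>t - t\<bar>) (at t within S)"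
      by (intro tendsto_intros)
    then have "((\<lambda>s. K * \<bar>s - t\<bar>) \<longlongrightarrow> 0) (at t within S)"
      by simp
    then have "((\<lambda>s. \<Phi> s g - \<Phi> t g) \<longlongrightarrow> 0) (at t within S)"
    proof (rule Lim_null_comparison[rotated])
      show "\<forall>\<^sub>F s in at t within S. norm (\<Phi> s g - \<Phi> t g) \<le> K * \<bar>s - t\<bar>"
        using ev
      proof eventually_elim
        case (elim s)
        then show ?case
          using K[of s t] K[of t s] t by (cases "s \<le> t") (auto simp: abs_minus_commute)
      qed
    qed
    then show "((\<lambda>s. \<Phi> s g) \<longlongrightarrow> \<Phi> t g) (at t within S)"
      by (simp add: LIM_zero_iff)
  qed (use t sl bd \<open>B > 0\<close> f ev in \<open>auto elim!: eventually_mono\<close>)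
qed

lemma tent_integral_pos:
  assumes "t \<in> {0..T}" "T > 0" "h > 0"
  shows "(LINT s|Leb T. max 0 (h - \<bar>s - t\<bar>)) > 0" "integrable (Leb T) (\<lambda>s. max 0 (h - \<bar>s - t\<bar>))"
proof -
  interpret finite_measure "Leb T" by (rule finite_measure_Leb)
  show int: "integrable (Leb T) (\<lambda>s. max 0 (h - \<bar>s - t\<bar>))"
  proof (rule integrable_const_bound[of _ h])
    show "(\<lambda>s. max 0 (h - \<bar>s - t\<bar>)) \<in> borel_measurable (Leb T)"
      by (intro measurable_restrict_space1) simp
  qed (use assms in auto)
  define d where "d = min (h / 2) (T / 2)"
  have d: "d > 0" "d \<le> h / 2" "d \<le> T / 2" using assms by (auto simp: d_def)
  obtain u where u: "0 \<le> u" "u + d \<le> T" "\<And>s. u < s \<Longrightarrow> s < u + d \<Longrightarrow> \<bar>s - t\<bar> \<le> h / 2"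
  proof (cases "t \<le> T / 2")
    case True
    then show ?thesis using assms d by (intro that[of t]) auto
  next
    case False
    then show ?thesis using assms d by (intro that[of "t - d"]) auto
  qed
  have sub: "{u<..<u+d} \<subseteq> {0<..<T}" using u by auto
  then have s: "{u<..<u+d} \<in> sets (Leb T)"
    by (auto simp: sets_restrict_space intro!: image_eqI[where x = "{u<..<u+d}"])
  have "0 < h / 2 * d" using assms d by simp
  also have "\<dots> = (LINT s|Leb T. h / 2 * indicator {u<..<u+d} s)"
  proof -
    have "measure (Leb T) {u<..<u+d} = d"
      using sub d by (subst measure_restrict_space) auto
    then show ?thesis
      unfolding integral_mult_right_zero Bochner_Integration.integral_indicator sets.Int_space_eq2[OF s] by simp
  qed
  also have "\<dots> \<le> (LINT s|Leb T. max 0 (h - \<bar>s - t\<bar>))"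
  proof (rule integral_mono[OF _ int])
    show "integrable (Leb T) (\<lambda>s. h / 2 * indicator {u<..<u+d} s)"
      using s by (simp add: emeasure_eq_measure)
    show "h / 2 * indicator {u<..<u+d} s \<le> max 0 (h - \<bar>s - t\<bar>)" for s
      using u(3)[of s] by (auto simp: max_def split: split_indicator)
  qed
  finally show "(LINT s|Leb T. max 0 (h - \<bar>s - t\<bar>)) > 0" .
qed

lemma filterlim_inverse_Suc_at_right: "filterlim (\<lambda>n. inverse (real (Suc n))) (at_right 0) sequentially"
  using LIMSEQ_inverse_real_of_nat by (auto simp: filterlim_at)

text \<open>The state space is encoded in the real line by \<open>(x, -V) \<mapsto> x\<close> and \<open>(x, V) \<mapsto> x + 2\<close> with
  \<open>x \<in> [0,1)\<close>, so that Helly's selection theorem applies; both the position and the velocity are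
  continuous functions of the code.\<close>

definition encode :: "torus \<times> real \<Rightarrow> real"
  where "encode z = unit_rep (fst z) + (if snd z > 0 then 2 else 0)"

definition velocity :: "real \<Rightarrow> real \<Rightarrow> real"
  where "velocity V x = V * max (-1) (min 1 (2 * x - 3))"

lemma encode:
  assumes "V > 0" "z \<in> UNIV \<times> {-V, V}"
  shows "torus_of (encode z) = fst z" "velocity V (encode z) = snd z" "encode z \<in> {-1<..4}"
proof -
  have "torus_of (unit_rep (fst z) + of_int 2) = fst z"
    by (simp only: torus_of_add_int unit_rep)
  then show "torus_of (encode z) = fst z"
    using assms by (auto simp: encode_def unit_rep)
  show "velocity V (encode z) = snd z" "encode z \<in> {-1<..4}"
    using assms unit_rep(2,3)[of "fst z"] by (auto simp: encode_def velocity_def max_def min_def)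
qed

lemma encode_measurable: "encode \<in> borel_measurable borel"
  unfolding borel_prod[symmetric] encode_def by measurable

lemma velocity_bound: "V > 0 \<Longrightarrow> \<bar>velocity V x\<bar> \<le> V"
  by (simp add: velocity_def abs_mult)

lemma (in velocity_measure) distr_encode:
  "real_distribution (distr \<sigma> borel encode)"
  "measure (distr \<sigma> borel encode) {-1<..4} = 1"
  "continuous_on UNIV f \<Longrightarrow>
    (LINT x|distr \<sigma> borel encode. velocity V x * f (torus_of x)) = (LINT z|\<sigma>. snd z * f (fst z))"
proof -
  have e: "encode \<in> \<sigma> \<rightarrow>\<^sub>M borel"
    using measurable_restrict_space1[OF encode_measurable] measurable_cong_sets[OF sets_eq refl]
    unfolding Omega_def by blast
  show "real_distribution (distr \<sigma> borel encode)"
    using e by (simp add: real_distribution_def real_distribution_axioms_def prob_space_distr)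
  have "encode -` {-1<..4} \<inter> space \<sigma> = space \<sigma>"
    using encode(3)[OF V] by (auto simp: space_eq)
  then show "measure (distr \<sigma> borel encode) {-1<..4} = 1"
    using e by (simp add: measure_distr prob_space)
  assume f: "continuous_on UNIV f"
  have "continuous_on UNIV (\<lambda>x. velocity V x * f (torus_of x))"
    unfolding velocity_def
    by (intro continuous_intros continuous_on_compose2[OF f] continuous_on_torus_of) auto
  then have "(LINT x|distr \<sigma> borel encode. velocity V x * f (torus_of x)) =
    (LINT z|\<sigma>. velocity V (encode z) * f (torus_of (encode z)))"
    using e by (intro integral_distr) (auto intro: borel_measurable_continuous_onI)
  also have "\<dots> = (LINT z|\<sigma>. snd z * f (fst z))"
    using encode[OF V] by (intro Bochner_Integration.integral_cong) (auto simp: space_eq)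
  finally show "(LINT x|distr \<sigma> borel encode. velocity V x * f (torus_of x)) = (LINT z|\<sigma>. snd z * f (fst z))" .
qed

lemma flux_limit_exists:
  assumes vm: "\<And>n. velocity_measure (\<tau> n) V"
  shows "\<exists>r \<mu>. strict_mono (r :: nat \<Rightarrow> nat) \<and> prob_space \<mu> \<and> sets \<mu> = sets borel \<and>
    (\<forall>f. continuous_on UNIV f \<longrightarrow>
      (\<lambda>n. LINT z|\<tau> (r n). snd z * f (fst z)) \<longlonglongrightarrow> (LINT x|\<mu>. velocity V x * f (torus_of x)))"
proof -
  interpret velocity_measure "\<tau> n" V for n by (rule vm)
  let ?M = "\<lambda>n. distr (\<tau> n) borel encode"
  have "tight ?M"
    unfolding tight_def
  proof (intro conjI allI impI)
    show "real_distribution (?M n)" for n by (rule distr_encode)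
    show "\<exists>a b. a < b \<and> (\<forall>n. measure (?M n) {a<..b} > 1 - e)" if "e > 0" for e :: real
      using that by (intro exI[of _ "-1"] exI[of _ 4]) (simp add: distr_encode(2))
  qed
  then obtain r \<mu> where r: "strict_mono (r :: nat \<Rightarrow> nat)" "real_distribution \<mu>" "weak_conv_m (?M \<circ> id \<circ> r) \<mu>"
    using tight_imp_convergent_subsubsequence[of ?M id] by (auto simp: strict_mono_def)
  interpret \<mu>: real_distribution \<mu> by fact
  have "(\<lambda>n. LINT z|\<tau> (r n). snd z * f (fst z)) \<longlonglongrightarrow> (LINT x|\<mu>. velocity V x * f (torus_of x))"
    if f: "continuous_on UNIV f" for f
  proof -
    obtain K where K: "\<And>p. \<bar>f p\<bar> \<le> K" using bounded_torus[OF f] by blast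
    have c: "continuous_on UNIV (\<lambda>x. velocity V x * f (torus_of x))"
      unfolding velocity_def
      by (intro continuous_intros continuous_on_compose2[OF f] continuous_on_torus_of) auto
    have "(\<lambda>n. LINT x|(?M \<circ> id \<circ> r) n. velocity V x * f (torus_of x)) \<longlonglongrightarrow> (LINT x|\<mu>. velocity V x * f (torus_of x))"
    proof (rule weak_conv_imp_integral_bdd_continuous_conv[OF _ r(2,3)])
      show "real_distribution ((?M \<circ> id \<circ> r) n)" for n by (simp add: distr_encode)
      show "isCont (\<lambda>x. velocity V x * f (torus_of x)) x" for x
        using c by (simp add: continuous_on_eq_continuous_at)
      show "norm (velocity V x * f (torus_of x)) \<le> V * K" for x
        using K[of "torus_of x"] velocity_bound[OF V, of x] V by (auto simp: abs_mult intro!: mult_mono)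
    qed
    then show ?thesis using f by (simp add: distr_encode(3))
  qed
  then show ?thesis
    using r(1) \<mu>.prob_space_axioms \<mu>.events_eq_borel by blast
qed

section \<open>The limit of vanishing rate\<close>

locale vanishing_rate =
  fixes V T C :: real
    and \<sigma> :: "real \<Rightarrow> real \<Rightarrow> (torus \<times> real) measure"
    and j :: "real \<Rightarrow> real \<Rightarrow> (torus \<times> real) set \<Rightarrow> real \<times> real"
    and \<rho> :: "real \<Rightarrow> torus measure"
    and \<omega> J :: "(real \<times> torus) set \<Rightarrow> real"
  assumes V: "V > 0" and T: "T > 0" and C: "C > 0"
    and CE: "\<And>l. l > 0 \<Longrightarrow> CE V T (\<sigma> l) (j l)"
    and act: "\<And>l. l > 0 \<Longrightarrow> action V T l (\<sigma> l) (j l) \<le> ennreal C"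
    and \<rho>: "\<And>t. t \<in> {0..T} \<Longrightarrow> prob_measure_on borel (\<rho> t)"
    and \<omega>: "vector_measure (ST T) \<omega>" and J: "vector_measure (ST T) J"
    and \<omega>_lim: "narrow_tendsto (ST T) (\<lambda>l. spacetime T (\<lambda>t. omega_of V (\<sigma> l t))) \<omega> (at_right 0)"
    and J_lim: "narrow_tendsto (ST T) (\<lambda>l. spacetime T (\<lambda>t. J_of V (j l t))) J (at_right 0)"
    and \<rho>_lim: "\<And>t. t \<in> {0..T} \<Longrightarrow> narrow_tendsto borel (\<lambda>l. rho_of V (\<sigma> l t)) (measure (\<rho> t)) (at_right 0)"
begin

abbreviation R :: "real \<Rightarrow> real \<Rightarrow> (torus \<Rightarrow> real) \<Rightarrow> real"
  where "R l t f \<equiv> LINT z|\<sigma> l t. f (fst z)"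

abbreviation W :: "real \<Rightarrow> real \<Rightarrow> (torus \<Rightarrow> real) \<Rightarrow> real"
  where "W l t f \<equiv> LINT z|\<sigma> l t. snd z * f (fst z)"

lemma kinetic: "l > 0 \<Longrightarrow> kinetic V T C l (\<sigma> l) (j l)"
  using V T C CE act by (simp add: kinetic_def)

lemma velocity_measure: "l > 0 \<Longrightarrow> t \<in> {0..T} \<Longrightarrow> velocity_measure (\<sigma> l t) V"
  using kinetic.velocity_measure[OF kinetic] .

lemma eventually_small_remainder:
  assumes "e > 0"
  shows "\<forall>\<^sub>F l in at_right 0. l > 0 \<and> (\<exists>a>0. (C + l * exp (a * c) * T) / a \<le> e)"
proof -
  define a where "a = (C + T) / e"
  have a: "a > 0" using C T assms by (simp add: a_def)
  have "\<forall>\<^sub>F l in at_right 0. l \<in> {0<..<exp (- (a * c))}"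
    by (rule eventually_at_right_real) simp
  then show ?thesis
  proof eventually_elim
    case (elim l)
    then have "l * exp (a * c) \<le> exp (- (a * c)) * exp (a * c)"
      by (intro mult_right_mono) auto
    also have "\<dots> = 1" by (simp flip: exp_add)
    finally have "C + l * exp (a * c) * T \<le> C + T"
      using T mult_right_mono[of "l * exp (a * c)" 1 T] by simp
    then have "(C + l * exp (a * c) * T) / a \<le> (C + T) / a"
      using a by (intro divide_right_mono) auto
    also have "\<dots> = e" using assms C T by (simp add: a_def)
    finally show ?case using a elim by auto
  qed
qed

lemma bcont_bmeas_ST:
  assumes "f \<in> bcont (space (ST T))"
  shows "f \<in> bmeas (ST T)" "f \<in> bcont ({0<..<T} \<times> UNIV)"
    "t \<in> {0<..<T} \<Longrightarrow> continuous_on UNIV (\<lambda>x. f (t, x))"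
proof -
  have "open ({0<..<T} \<times> (UNIV :: torus set))" by (intro open_Times) auto
  then have S: "{0<..<T} \<times> (UNIV :: torus set) \<in> sets borel" by (rule borel_open)
  show f: "f \<in> bcont ({0<..<T} \<times> UNIV)" using assms by (simp add: space_ST)
  show "f \<in> bmeas (ST T)" unfolding ST_def by (rule bcont_bmeas[OF f S])
  show "t \<in> {0<..<T} \<Longrightarrow> continuous_on UNIV (\<lambda>x. f (t, x))"
    using f unfolding bcont_def
    by (auto intro!: continuous_on_compose2[of "{0<..<T} \<times> UNIV" f] continuous_intros)
qed

lemma ST_eqI:
  assumes "vector_measure (ST T) \<mu>" "vector_measure (ST T) \<nu>"
    and "\<And>f. f \<in> bcont (space (ST T)) \<Longrightarrow> signed_integral (ST T) \<mu> f = signed_integral (ST T) \<nu> f"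
    and "B \<in> sets (ST T)"
  shows "\<mu> B = (\<nu> B :: real)"
proof -
  have "open ({0<..<T} \<times> (UNIV :: torus set))" by (intro open_Times) auto
  then have S: "{0<..<T} \<times> (UNIV :: torus set) \<in> sets borel" by (rule borel_open)
  from assms(3) have "\<And>f. f \<in> bcont ({0<..<T} \<times> UNIV) \<Longrightarrow> signed_integral (ST T) \<mu> f = signed_integral (ST T) \<nu> f"
    by (simp add: space_ST)
  then show ?thesis
    using assms(1,2,4) unfolding ST_def by - (rule vector_measure_eqI[OF S])
qed

lemma J_zero:
  assumes "B \<in> sets (ST T)"
  shows "J B = 0"
proof (rule ST_eqI[OF J _ _ assms, where \<nu> = "\<lambda>_. 0"])
  show "vector_measure (ST T) (\<lambda>_. 0 :: real)"
    by (simp add: vector_measure_def)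
  fix f assume f: "f \<in> bcont (space (ST T))"
  then obtain K where K: "K > 0" "\<And>z. z \<in> space (ST T) \<Longrightarrow> \<bar>f z\<bar> \<le> K"
    using bmeasE[OF bcont_bmeas_ST(1)[OF f]] by metis
  have "((\<lambda>l. signed_integral (ST T) (spacetime T (\<lambda>t. J_of V (j l t))) f) \<longlongrightarrow> 0) (at_right 0)"
    unfolding tendsto_iff
  proof (intro allI impI)
    fix e :: real assume "e > 0"
    then have "e / (4 * K) > 0" using K by simp
    from eventually_small_remainder[OF this, of V]
    show "\<forall>\<^sub>F l in at_right 0. dist (signed_integral (ST T) (spacetime T (\<lambda>t. J_of V (j l t))) f) 0 < e"
    proof eventually_elim
      case (elim l)
      then obtain a where a: "a > 0" "(C + l * exp (a * V) * T) / a \<le> e / (4 * K)" and l: "l > 0" by auto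
      have Jb: "\<bar>spacetime T (\<lambda>t. J_of V (j l t)) A\<bar> \<le> e / (4 * K)" if "A \<in> sets (ST T)" for A
        using kinetic.J_bound[OF kinetic[OF l] that a(1)] a(2) by linarith
      have "\<bar>signed_integral (ST T) (spacetime T (\<lambda>t. J_of V (j l t))) f\<bar> \<le> 2 * (e / (4 * K)) * K"
        by (rule signed_integral_bound[OF Jb K(2)]) (use K(1) in simp_all)
      also have "\<dots> < e" using K \<open>e > 0\<close> by (simp add: field_simps)
      finally show ?case by simp
    qed
  qed
  moreover have "((\<lambda>l. signed_integral (ST T) (spacetime T (\<lambda>t. J_of V (j l t))) f) \<longlongrightarrow> signed_integral (ST T) J f) (at_right 0)"
    using J_lim f by (simp add: narrow_tendsto_def)
  ultimately have "signed_integral (ST T) J f = 0"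
    by (intro tendsto_unique[OF trivial_limit_at_right_real])
  moreover have "signed_integral (ST T) (\<lambda>_. 0) f = 0"
    using signed_integral_bound[of "ST T" "\<lambda>_. 0" 0 f K] K by simp
  ultimately show "signed_integral (ST T) J f = signed_integral (ST T) (\<lambda>_. 0) f" by simp
qed

lemma mass_balance:
  assumes \<phi>: "C1_torus \<phi>" and st: "0 \<le> s" "s \<le> t" "t \<le> T" and l: "l > 0"
  shows "R l t \<phi> - R l s \<phi> = (LINT r|Leb T. indicator {s<..<t} r * W l r (deriv_torus \<phi>))" (is "?L = ?R")
proof -
  have "\<bar>?L - ?R\<bar> \<le> (C + l * T) / a" if a: "a > 0" for a
    using kinetic.balance[OF kinetic[OF l] \<phi> continuous_on_const[of UNIV 1] st a, of 0] by simp
  note le = this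
  have "\<bar>?L - ?R\<bar> \<le> 0"
  proof (rule field_le_epsilon)
    fix e :: real assume "e > 0"
    moreover have "C + l * T > 0" using C l T by (simp add: add_pos_pos)
    ultimately show "\<bar>?L - ?R\<bar> \<le> 0 + e"
      using le[of "(C + l * T) / e"] by simp
  qed
  then show ?thesis by simp
qed

lemma flux_balance:
  assumes \<psi>: "C1_torus \<psi>" and e: "e > 0"
  shows "\<forall>\<^sub>F l in at_right 0. l > 0 \<and> (\<forall>s t. 0 \<le> s \<longrightarrow> s \<le> t \<longrightarrow> t \<le> T \<longrightarrow>
    \<bar>W l t \<psi> - W l s \<psi> - V\<^sup>2 * (LINT r|Leb T. indicator {s<..<t} r * R l r (deriv_torus \<psi>))\<bar> \<le> e)"
proof -
  obtain K where K: "\<And>p. \<bar>\<psi> p\<bar> \<le> K"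
    using bounded_torus[OF C1_torus_continuous[OF \<psi>]] by blast
  from eventually_small_remainder[OF e, of "2 * V * K"] show ?thesis
  proof eventually_elim
    case (elim l)
    then obtain a where a: "a > 0" "(C + l * exp (a * (2 * V * K)) * T) / a \<le> e" and l: "l > 0" by auto
    show ?case
    proof (intro conjI allI impI l)
      fix s t assume st: "0 \<le> s" "s \<le> t" "t \<le> T"
      have c: "\<bar>(- V - V) * \<psi> x\<bar> \<le> 2 * V * K" for x
        using K[of x] V by (simp add: abs_mult)
      have "(LINT r|Leb T. indicator {s<..<t} r * (LINT z|\<sigma> l r. snd z * (snd z * deriv_torus \<psi> (fst z)))) =
        (LINT r|Leb T. V\<^sup>2 * (indicator {s<..<t} r * R l r (deriv_torus \<psi>)))"
      proof (rule Bochner_Integration.integral_cong[OF refl])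
        fix r assume "r \<in> space (Leb T)"
        then interpret velocity_measure "\<sigma> l r" V using l by (intro velocity_measure) auto
        have "(LINT z|\<sigma> l r. snd z * (snd z * deriv_torus \<psi> (fst z))) = (LINT z|\<sigma> l r. V\<^sup>2 * deriv_torus \<psi> (fst z))"
          by (intro Bochner_Integration.integral_cong) (auto simp: space_eq power2_eq_square)
        then show "indicator {s<..<t} r * (LINT z|\<sigma> l r. snd z * (snd z * deriv_torus \<psi> (fst z))) =
          V\<^sup>2 * (indicator {s<..<t} r * R l r (deriv_torus \<psi>))" by simp
      qed
      then show "\<bar>W l t \<psi> - W l s \<psi> - V\<^sup>2 * (LINT r|Leb T. indicator {s<..<t} r * R l r (deriv_torus \<psi>))\<bar> \<le> e"
        using order_trans[OF kinetic.balance[OF kinetic[OF l] \<psi> continuous_on_id st a(1) c] a(2)] by simp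
    qed
  qed
qed

lemma bounded_family_omega: "l > 0 \<Longrightarrow> bounded_family T (\<lambda>t. omega_of V (\<sigma> l t)) V"
proof
  assume l: "l > 0"
  interpret kinetic V T C l "\<sigma> l" "j l" by (rule kinetic[OF l])
  fix t assume "t \<in> {0<..<T}"
  then interpret velocity_measure "\<sigma> l t" V by (intro velocity_measure) auto
  show "vector_measure borel (omega_of V (\<sigma> l t))" by (rule vector_measure_moments)
  show "\<bar>omega_of V (\<sigma> l t) A\<bar> \<le> V" if "A \<in> sets borel" for A by (rule moments_bound[OF that])
next
  assume l: "l > 0"
  interpret kinetic V T C l "\<sigma> l" "j l" by (rule kinetic[OF l])
  fix A :: "torus set" assume A: "A \<in> sets borel"
  have "(\<lambda>z. snd z * indicator A (fst z)) \<in> bmeas (Omega V)"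
    by (intro bmeas_mult continuous_bmeas_Omega bmeas_compose[OF bmeas_indicator[OF A] fst_Omega_measurable] continuous_on_snd continuous_on_id)
  from LINT_measurable[OF this] show "(\<lambda>t. omega_of V (\<sigma> l t) A) \<in> borel_measurable (Leb T)"
    by (rule measurable_cong[THEN iffD1, rotated])
       (use velocity_measure.omega_of_eq[OF velocity_measure _] A in \<open>auto\<close>)
qed

lemma R_le:
  assumes l: "l > 0" and t: "t \<in> {0..T}" and f: "\<And>x. \<bar>f x\<bar> \<le> K"
  shows "\<bar>R l t f\<bar> \<le> K"
proof -
  interpret velocity_measure "\<sigma> l t" V using l t by (rule velocity_measure)
  show ?thesis
    using f order_trans[OF abs_ge_zero f] by (intro abs_LINT_le) auto
qed

lemma W_le:
  assumes l: "l > 0" and t: "t \<in> {0..T}" and f: "\<And>x. \<bar>f x\<bar> \<le> K"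
  shows "\<bar>W l t f\<bar> \<le> V * K"
proof -
  interpret velocity_measure "\<sigma> l t" V using l t by (rule velocity_measure)
  have "K \<ge> 0" using order_trans[OF abs_ge_zero f] .
  then show ?thesis
    using f V by (intro abs_LINT_le) (auto simp: space_eq abs_mult mult_left_mono)
qed

lemma continuous_on_fst_torus:
  fixes f :: "torus \<Rightarrow> real"
  assumes "continuous_on UNIV f"
  shows "continuous_on UNIV (\<lambda>z :: torus \<times> real. f (fst z))"
  by (rule continuous_on_compose2[OF assms continuous_on_fst[OF continuous_on_id]]) simp

lemma R_measurable: "l > 0 \<Longrightarrow> continuous_on UNIV f \<Longrightarrow> (\<lambda>t. R l t f) \<in> borel_measurable (Leb T)"
  by (rule kinetic.LINT_measurable[OF kinetic continuous_bmeas_Omega[OF continuous_on_fst_torus]])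

lemma W_measurable: "l > 0 \<Longrightarrow> continuous_on UNIV f \<Longrightarrow> (\<lambda>t. W l t f) \<in> borel_measurable (Leb T)"
  by (rule kinetic.LINT_measurable[OF kinetic continuous_bmeas_Omega[OF
      continuous_on_mult[OF continuous_on_snd[OF continuous_on_id] continuous_on_fst_torus]]])

lemma indicator_LINT_le:
  assumes st: "0 \<le> s" "s \<le> t" "t \<le> T" and k: "\<And>r. r \<in> {0<..<T} \<Longrightarrow> \<bar>k r\<bar> \<le> K" "K \<ge> 0"
  shows "\<bar>LINT r|Leb T. indicator {s<..<t} r * k r\<bar> \<le> K * (t - s)"
proof (cases "integrable (Leb T) (\<lambda>r. indicator {s<..<t} r * k r)")
  case True
  interpret finite_measure "Leb T" by (rule finite_measure_Leb)
  have sub: "{s<..<t} \<subseteq> {0<..<T}" using st by auto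
  then have S: "{s<..<t} \<in> sets (Leb T)"
    by (auto simp: sets_restrict_space intro!: image_eqI[where x = "{s<..<t}"])
  have "\<bar>LINT r|Leb T. indicator {s<..<t} r * k r\<bar> \<le> (LINT r|Leb T. \<bar>indicator {s<..<t} r * k r\<bar>)"
    by (rule integral_abs_bound)
  also have "\<dots> \<le> (LINT r|Leb T. K * indicator {s<..<t} r)"
  proof (rule integral_mono)
    show "integrable (Leb T) (\<lambda>r. K * indicator {s<..<t} r)"
      using S by (simp add: emeasure_eq_measure)
  qed (use True k in \<open>auto split: split_indicator\<close>)
  also have "\<dots> = K * (t - s)"
  proof -
    have "measure (Leb T) {s<..<t} = t - s"
      using sub st by (subst measure_restrict_space) auto
    then show ?thesis
      unfolding integral_mult_right_zero Bochner_Integration.integral_indicator sets.Int_space_eq2[OF S] by simp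
  qed
  finally show ?thesis .
qed (use st k in \<open>simp add: not_integrable_integral_eq\<close>)

lemma W_almost_lipschitz:
  assumes \<psi>: "C1_torus \<psi>"
  obtains K where "K \<ge> 0" "\<And>e. e > 0 \<Longrightarrow> \<forall>\<^sub>F l in at_right 0. l > 0 \<and>
    (\<forall>s\<in>{0..T}. \<forall>t\<in>{0..T}. \<bar>W l t \<psi> - W l s \<psi>\<bar> \<le> K * \<bar>t - s\<bar> + e)"
proof -
  obtain L where L: "L > 0" "\<And>p. \<bar>deriv_torus \<psi> p\<bar> \<le> L"
    using bounded_torus[OF C1_torus_continuous_deriv[OF \<psi>]] by blast
  have "\<forall>\<^sub>F l in at_right 0. l > 0 \<and>
    (\<forall>s\<in>{0..T}. \<forall>t\<in>{0..T}. \<bar>W l t \<psi> - W l s \<psi>\<bar> \<le> V\<^sup>2 * L * \<bar>t - s\<bar> + e)" if e: "e > 0" for e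
    using flux_balance[OF \<psi> e]
  proof eventually_elim
    case (elim l)
    have le: "\<bar>W l t \<psi> - W l s \<psi>\<bar> \<le> V\<^sup>2 * L * (t - s) + e" if st: "0 \<le> s" "s \<le> t" "t \<le> T" for s t
    proof -
      have "\<bar>LINT r|Leb T. indicator {s<..<t} r * R l r (deriv_torus \<psi>)\<bar> \<le> L * (t - s)"
        using elim L by (intro indicator_LINT_le[OF st] R_le) auto
      then have "V\<^sup>2 * \<bar>LINT r|Leb T. indicator {s<..<t} r * R l r (deriv_torus \<psi>)\<bar> \<le> V\<^sup>2 * (L * (t - s))"
        by (intro mult_left_mono) auto
      moreover have "\<bar>V\<^sup>2 * (LINT r|Leb T. indicator {s<..<t} r * R l r (deriv_torus \<psi>))\<bar> =
          V\<^sup>2 * \<bar>LINT r|Leb T. indicator {s<..<t} r * R l r (deriv_torus \<psi>)\<bar>"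
        by (simp add: abs_mult)
      moreover have "\<bar>W l t \<psi> - W l s \<psi> - V\<^sup>2 * (LINT r|Leb T. indicator {s<..<t} r * R l r (deriv_torus \<psi>))\<bar> \<le> e"
        using elim st by blast
      ultimately show ?thesis by (simp only: mult.assoc)
    qed
    show ?case
    proof (intro conjI ballI)
      fix s t assume "s \<in> {0..T}" "t \<in> {0..T}"
      then show "\<bar>W l t \<psi> - W l s \<psi>\<bar> \<le> V\<^sup>2 * L * \<bar>t - s\<bar> + e"
        using le[of s t] le[of t s] by (cases "s \<le> t") (auto simp: abs_minus_commute)
    qed (use elim in auto)
  qed
  then show ?thesis
    using L by (intro that[of "V\<^sup>2 * L"]) auto
qed

lemma tendsto_at_right_seq: "(f \<longlongrightarrow> L) (at_right (0::real)) \<Longrightarrow> (\<lambda>n. f (inverse (real (Suc n)))) \<longlonglongrightarrow> L"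
  by (rule filterlim_compose[OF _ filterlim_inverse_Suc_at_right])

lemma eventually_positive: "\<forall>\<^sub>F l :: real in at_right 0. l > 0"
  by (simp add: eventually_at_right_less)

definition is_flux_code :: "real \<Rightarrow> real measure \<Rightarrow> bool"
  where "is_flux_code t \<mu> \<longleftrightarrow> prob_space \<mu> \<and> sets \<mu> = sets borel \<and>
    (\<exists>L. filterlim L (at_right 0) sequentially \<and>
      (\<forall>f. continuous_on UNIV f \<longrightarrow> (\<lambda>n::nat. W (L n) t f) \<longlonglongrightarrow> (LINT x|\<mu>. velocity V x * f (torus_of x))))"

definition flux_code :: "real \<Rightarrow> real measure"
  where "flux_code t = (SOME \<mu>. is_flux_code t \<mu>)"

abbreviation w_integral :: "real \<Rightarrow> (torus \<Rightarrow> real) \<Rightarrow> real"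
  where "w_integral t f \<equiv> LINT x|flux_code t. velocity V x * f (torus_of x)"

definition w :: "real \<Rightarrow> torus set \<Rightarrow> real"
  where "w t A = w_integral t (indicator A)"

lemma flux_code: "t \<in> {0..T} \<Longrightarrow> is_flux_code t (flux_code t)"
proof -
  assume t: "t \<in> {0..T}"
  have "velocity_measure (\<sigma> (inverse (real (Suc n))) t) V" for n
    using t by (intro velocity_measure) auto
  from flux_limit_exists[where \<tau> = "\<lambda>n. \<sigma> (inverse (real (Suc n))) t", OF this]
  obtain r \<mu> where r: "strict_mono (r :: nat \<Rightarrow> nat)" "prob_space \<mu>" "sets \<mu> = sets borel"
    "\<And>f. continuous_on UNIV f \<Longrightarrow>
      (\<lambda>n. W (inverse (real (Suc (r n)))) t f) \<longlonglongrightarrow> (LINT x|\<mu>. velocity V x * f (torus_of x))"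
    by blast
  have "filterlim (\<lambda>n. inverse (real (Suc (r n)))) (at_right 0) sequentially"
    by (rule filterlim_compose[OF filterlim_inverse_Suc_at_right filterlim_subseq[OF r(1)]])
  with r have "is_flux_code t \<mu>"
    unfolding is_flux_code_def by blast
  then show ?thesis
    unfolding flux_code_def by (rule someI)
qed

lemma
  assumes t: "t \<in> {0..T}"
  shows w_sigma_linear: "sigma_linear borel (w_integral t)"
    and w_integral_le: "(\<And>x. \<bar>f x\<bar> \<le> K) \<Longrightarrow> \<bar>w_integral t f\<bar> \<le> V * K"
    and w_subsequence: "\<exists>L. filterlim L (at_right 0) sequentially \<and>
      (\<forall>f. continuous_on UNIV f \<longrightarrow> (\<lambda>n::nat. W (L n) t f) \<longlonglongrightarrow> w_integral t f)"
proof -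
  have fc: "prob_space (flux_code t)" "sets (flux_code t) = sets borel"
    using flux_code[OF t] by (simp_all add: is_flux_code_def)
  interpret prob_space "flux_code t" by (rule fc)
  show "\<exists>L. filterlim L (at_right 0) sequentially \<and>
      (\<forall>f. continuous_on UNIV f \<longrightarrow> (\<lambda>n::nat. W (L n) t f) \<longlonglongrightarrow> w_integral t f)"
    using flux_code[OF t] by (simp add: is_flux_code_def)
  have "velocity V \<in> borel_measurable borel"
    by (intro borel_measurable_continuous_onI) (auto simp: velocity_def intro!: continuous_intros)
  then have "velocity V \<in> borel_measurable (flux_code t)"
    using measurable_cong_sets[OF fc(2) refl] by blast
  then have "integrable (flux_code t) (velocity V)"
    using velocity_bound[OF V] by (intro integrable_const_bound[of _ V]) auto
  moreover have "torus_of \<in> flux_code t \<rightarrow>\<^sub>M borel"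
    using borel_measurable_continuous_onI[OF continuous_on_torus_of] measurable_cong_sets[OF fc(2) refl] by blast
  ultimately show "sigma_linear borel (w_integral t)"
    by (rule sigma_linear_LINT)
  assume f: "\<And>x. \<bar>f x\<bar> \<le> K"
  then have "K \<ge> 0" using order_trans[OF abs_ge_zero f] by simp
  show "\<bar>w_integral t f\<bar> \<le> V * K"
  proof (cases "integrable (flux_code t) (\<lambda>x. velocity V x * f (torus_of x))")
    case True
    have "\<bar>w_integral t f\<bar> \<le> (LINT x|flux_code t. \<bar>velocity V x * f (torus_of x)\<bar>)"
      by (rule integral_abs_bound)
    also have "\<dots> \<le> (LINT x|flux_code t. V * K)"
      using f velocity_bound[OF V] V
      by (intro integral_mono[OF integrable_abs[OF True]]) (auto simp: abs_mult intro!: mult_mono)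
    finally show ?thesis by (simp add: prob_space)
  qed (use V \<open>K \<ge> 0\<close> in \<open>simp add: not_integrable_integral_eq\<close>)
qed

lemma vector_measure_w: "t \<in> {0..T} \<Longrightarrow> vector_measure borel (w t)"
  unfolding w_def by (rule sigma_linear_vector_measure[OF w_sigma_linear])

lemma signed_integral_w: "t \<in> {0..T} \<Longrightarrow> f \<in> bmeas borel \<Longrightarrow> signed_integral borel (w t) f = w_integral t f"
  by (rule signed_integral_eqI[OF w_sigma_linear]) (simp_all add: w_def)

lemma W_sigma_linear: "l > 0 \<Longrightarrow> t \<in> {0..T} \<Longrightarrow> sigma_linear borel (W l t)"
  using velocity_measure.moment_sigma_linear[OF velocity_measure, of l t "\<lambda>v. v"] by simp

lemma spacetime_omega_tendsto:
  assumes f: "f \<in> bcont (space (ST T))"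
  shows "((\<lambda>l. LINT t|Leb T. W l t (\<lambda>x. f (t, x))) \<longlongrightarrow> signed_integral (ST T) \<omega> f) (at_right 0)"
proof -
  have "((\<lambda>l. signed_integral (ST T) (spacetime T (\<lambda>t. omega_of V (\<sigma> l t))) f) \<longlongrightarrow> signed_integral (ST T) \<omega> f) (at_right 0)"
    using \<omega>_lim f by (simp add: narrow_tendsto_def)
  moreover have "\<forall>\<^sub>F l in at_right 0. signed_integral (ST T) (spacetime T (\<lambda>t. omega_of V (\<sigma> l t))) f =
      (LINT t|Leb T. W l t (\<lambda>x. f (t, x)))"
    using eventually_positive
  proof eventually_elim
    case (elim l)
    have "signed_integral (ST T) (spacetime T (\<lambda>t. omega_of V (\<sigma> l t))) f =
      (LINT t|Leb T. signed_integral borel (omega_of V (\<sigma> l t)) (\<lambda>x. f (t, x)))"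
      by (rule bounded_family.signed_integral_spacetime[OF bounded_family_omega[OF elim] bcont_bmeas_ST(1)[OF f]])
    also have "\<dots> = (LINT t|Leb T. W l t (\<lambda>x. f (t, x)))"
      using velocity_measure[OF elim] bmeas_ST_section[OF bcont_bmeas_ST(1)[OF f]]
      by (intro Bochner_Integration.integral_cong velocity_measure.signed_integral_omega) auto
    finally show ?case .
  qed
  ultimately show ?thesis
    by (rule Lim_transform_eventually)
qed

lemma W_tendsto_C1:
  assumes \<psi>: "C1_torus \<psi>" and t: "t \<in> {0..T}"
  shows "((\<lambda>l. W l t \<psi>) \<longlongrightarrow> w_integral t \<psi>) (at_right 0)"
  unfolding tendsto_iff
proof (intro allI impI)
  fix e :: real assume e: "e > 0"
  obtain K where K: "K \<ge> 0" "\<And>e. e > 0 \<Longrightarrow> \<forall>\<^sub>F l in at_right 0. l > 0 \<and>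
    (\<forall>s\<in>{0..T}. \<forall>t\<in>{0..T}. \<bar>W l t \<psi> - W l s \<psi>\<bar> \<le> K * \<bar>t - s\<bar> + e)"
    using W_almost_lipschitz[OF \<psi>] by blast
  define h where "h = e / (8 * (K + 1))"
  have h: "h > 0" "K * h \<le> e / 8" using e K(1) by (auto simp: h_def field_simps)
  define g where "g s = max 0 (h - \<bar>s - t\<bar>)" for s
  define G where "G = (LINT s|Leb T. g s)"
  have G: "G > 0" "integrable (Leb T) g"
    using tent_integral_pos[OF t T h(1)] by (simp_all add: G_def g_def[abs_def])
  obtain M where M: "M > 0" "\<And>p. \<bar>\<psi> p\<bar> \<le> M"
    using bounded_torus[OF C1_torus_continuous[OF \<psi>]] by blast
  define f where "f z = g (fst z) * \<psi> (snd z)" for z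
  have "continuous_on UNIV f"
    unfolding f_def g_def
    by (intro continuous_intros continuous_on_compose2[OF C1_torus_continuous[OF \<psi>]]) auto
  moreover have "\<bar>f z\<bar> \<le> h * M" for z
    using M(2)[of "snd z"] h by (auto simp: f_def g_def abs_mult intro!: mult_mono)
  ultimately have "f \<in> bcont (space (ST T))"
    unfolding bcont_def bounded_iff by (auto intro: continuous_on_subset intro!: exI[of _ "h * M"])
  moreover have "W l s (\<lambda>x. f (s, x)) = g s * W l s \<psi>" for l s
    by (simp add: f_def mult.left_commute[of _ "g s"])
  ultimately have lim: "((\<lambda>l. LINT s|Leb T. g s * W l s \<psi>) \<longlongrightarrow> signed_integral (ST T) \<omega> f) (at_right 0)"
    using spacetime_omega_tendsto[of f] by simp
  define A where "A = signed_integral (ST T) \<omega> f / G"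
  have close: "\<forall>\<^sub>F l in at_right 0. \<bar>W l t \<psi> - A\<bar> \<le> 3 * (e / 8)"
  proof -
    have "\<forall>\<^sub>F l in at_right 0. dist (LINT s|Leb T. g s * W l s \<psi>) (signed_integral (ST T) \<omega> f) < G * (e / 8)"
      by (rule tendstoD[OF lim]) (use G e in simp)
    moreover have "e / 8 > 0" using e by simp
    note K(2)[OF this]
    ultimately show ?thesis
    proof eventually_elim
      case (elim l)
      then have l: "l > 0" by simp
      have i: "integrable (Leb T) (\<lambda>s. g s * W l s \<psi>)"
      proof (rule Bochner_Integration.integrable_bound)
        show "integrable (Leb T) (\<lambda>s. g s * (V * M))" using G by simp
        show "(\<lambda>s. g s * W l s \<psi>) \<in> borel_measurable (Leb T)"
          using G(2) W_measurable[OF l C1_torus_continuous[OF \<psi>]] by auto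
        show "AE s in Leb T. norm (g s * W l s \<psi>) \<le> norm (g s * (V * M))"
          using W_le[OF l, of _ \<psi> M] V M by (intro AE_I2) (auto simp: abs_mult intro!: mult_left_mono)
      qed
      have "\<bar>G * W l t \<psi> - (LINT s|Leb T. g s * W l s \<psi>)\<bar> = \<bar>LINT s|Leb T. g s * (W l t \<psi> - W l s \<psi>)\<bar>"
        using i G(2) by (simp add: G_def right_diff_distrib)
      also have "\<dots> \<le> (LINT s|Leb T. \<bar>g s * (W l t \<psi> - W l s \<psi>)\<bar>)"
        by (rule integral_abs_bound)
      also have "\<dots> \<le> (LINT s|Leb T. g s * (2 * (e / 8)))"
      proof (rule integral_mono)
        show "integrable (Leb T) (\<lambda>s. \<bar>g s * (W l t \<psi> - W l s \<psi>)\<bar>)"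
          using i G(2) by (intro integrable_abs) (simp add: right_diff_distrib)
        show "integrable (Leb T) (\<lambda>s. g s * (2 * (e / 8)))" using G(2) by simp
        fix s assume "s \<in> space (Leb T)"
        then have s: "s \<in> {0..T}" by simp
        show "\<bar>g s * (W l t \<psi> - W l s \<psi>)\<bar> \<le> g s * (2 * (e / 8))"
        proof (cases "\<bar>s - t\<bar> < h")
          case True
          have "\<bar>W l t \<psi> - W l s \<psi>\<bar> \<le> K * \<bar>t - s\<bar> + e / 8"
            using elim s t by blast
          also have "K * \<bar>t - s\<bar> \<le> K * h"
            using True K(1) by (intro mult_left_mono) (auto simp: abs_minus_commute)
          finally have "\<bar>W l t \<psi> - W l s \<psi>\<bar> \<le> 2 * (e / 8)"
            using h(2) by linarith
          then show ?thesis
            by (simp only: abs_mult) (rule mult_mono, simp_all add: g_def)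
        next
          case False
          then show ?thesis by (simp add: g_def)
        qed
      qed
      also have "\<dots> = G * (2 * (e / 8))" by (simp add: G_def)
      finally have "\<bar>G * W l t \<psi> - (LINT s|Leb T. g s * W l s \<psi>)\<bar> \<le> G * (2 * (e / 8))" .
      moreover have "\<bar>(LINT s|Leb T. g s * W l s \<psi>) - signed_integral (ST T) \<omega> f\<bar> < G * (e / 8)"
        using elim unfolding dist_real_def by blast
      moreover have "G * (3 * (e / 8)) = G * (2 * (e / 8)) + G * (e / 8)"
        by (simp add: field_simps)
      ultimately have "\<bar>G * W l t \<psi> - signed_integral (ST T) \<omega> f\<bar> \<le> G * (3 * (e / 8))"
        by linarith
      moreover have "G * W l t \<psi> - signed_integral (ST T) \<omega> f = G * (W l t \<psi> - A)"
        using G(1) by (simp add: A_def field_simps)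
      ultimately have "G * \<bar>W l t \<psi> - A\<bar> \<le> G * (3 * (e / 8))"
        using G(1) by (simp add: abs_mult)
      then show ?case using G(1) by simp
    qed
  qed
  obtain L where L: "filterlim L (at_right 0) sequentially" "(\<lambda>n::nat. W (L n) t \<psi>) \<longlonglongrightarrow> w_integral t \<psi>"
    using w_subsequence[OF t] C1_torus_continuous[OF \<psi>] by blast
  have "(\<lambda>n. \<bar>W (L n) t \<psi> - A\<bar>) \<longlonglongrightarrow> \<bar>w_integral t \<psi> - A\<bar>"
    by (intro tendsto_intros L)
  then have wA: "\<bar>w_integral t \<psi> - A\<bar> \<le> 3 * (e / 8)"
    by (rule tendsto_upperbound) (use eventually_compose_filterlim[OF close L(1)] in auto)
  from close show "\<forall>\<^sub>F l in at_right 0. dist (W l t \<psi>) (w_integral t \<psi>) < e"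
  proof eventually_elim
    case (elim l)
    then show ?case using wA e unfolding dist_real_def by linarith
  qed
qed

lemma W_tendsto:
  assumes t: "t \<in> {0..T}" and f: "continuous_on UNIV f"
  shows "((\<lambda>l. W l t f) \<longlongrightarrow> w_integral t f) (at_right 0)"
proof (rule C1_dense_convergence[where B = V and \<Phi> = "\<lambda>l. W l t" and \<Psi> = "w_integral t"])
  show "\<forall>\<^sub>F l in at_right 0. sigma_linear borel (W l t)"
    using eventually_positive by eventually_elim (rule W_sigma_linear[OF _ t])
  show "\<forall>\<^sub>F l in at_right 0. \<forall>f K. (\<forall>x. \<bar>f x\<bar> \<le> K) \<longrightarrow> \<bar>W l t f\<bar> \<le> V * K"
    using eventually_positive by eventually_elim (use W_le[OF _ t] in blast)
qed (use w_sigma_linear[OF t] w_integral_le[OF t] W_tendsto_C1[OF _ t] V f in auto)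

lemma w_continuous: "continuous_on UNIV f \<Longrightarrow> continuous_on {0..T} (\<lambda>t. w_integral t f)"
proof (rule lipschitz_dense_continuous[where B = V and \<Phi> = w_integral])
  fix \<psi> assume \<psi>: "C1_torus \<psi>"
  obtain K where K: "K \<ge> 0" "\<And>e. e > 0 \<Longrightarrow> \<forall>\<^sub>F l in at_right 0. l > 0 \<and>
    (\<forall>s\<in>{0..T}. \<forall>t\<in>{0..T}. \<bar>W l t \<psi> - W l s \<psi>\<bar> \<le> K * \<bar>t - s\<bar> + e)"
    using W_almost_lipschitz[OF \<psi>] by blast
  have "\<bar>w_integral t \<psi> - w_integral s \<psi>\<bar> \<le> K * (t - s)" if "s \<in> {0..T}" "t \<in> {0..T}" "s \<le> t" for s t
  proof (rule field_le_epsilon)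
    fix e :: real assume "e > 0"
    have "((\<lambda>l. \<bar>W l t \<psi> - W l s \<psi>\<bar>) \<longlongrightarrow> \<bar>w_integral t \<psi> - w_integral s \<psi>\<bar>) (at_right 0)"
      using that \<psi> by (intro tendsto_intros W_tendsto_C1)
    moreover have "\<forall>\<^sub>F l in at_right 0. \<bar>W l t \<psi> - W l s \<psi>\<bar> \<le> K * (t - s) + e"
      using K(2)[OF \<open>e > 0\<close>]
    proof eventually_elim
      case (elim l)
      then have "\<bar>W l t \<psi> - W l s \<psi>\<bar> \<le> K * \<bar>t - s\<bar> + e" using that by blast
      then show ?case using that by simp
    qed
    ultimately show "\<bar>w_integral t \<psi> - w_integral s \<psi>\<bar> \<le> K * (t - s) + e"
      by (rule tendsto_upperbound) simp
  qed
  then show "\<exists>K. \<forall>s\<in>{0..T}. \<forall>t\<in>{0..T}. s \<le> t \<longrightarrow> \<bar>w_integral t \<psi> - w_integral s \<psi>\<bar> \<le> K * (t - s)"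
    by blast
qed (use w_sigma_linear w_integral_le V in auto)

lemma \<rho>_finite: "t \<in> {0..T} \<Longrightarrow> finite_measure (\<rho> t)" "t \<in> {0..T} \<Longrightarrow> sets (\<rho> t) = sets borel"
  using \<rho> by (auto simp: prob_measure_on_def prob_space_def)

lemma R_tendsto:
  assumes t: "t \<in> {0..T}" and f: "continuous_on UNIV f"
  shows "((\<lambda>l. R l t f) \<longlongrightarrow> (LINT x|\<rho> t. f x)) (at_right 0)"
proof -
  note f' = continuous_bmeas_torus[OF f]
  have "((\<lambda>l. signed_integral borel (rho_of V (\<sigma> l t)) f) \<longlongrightarrow> signed_integral borel (measure (\<rho> t)) f) (at_right 0)"
    using \<rho>_lim[OF t] f'(1) by (simp add: narrow_tendsto_def)
  moreover have "\<forall>\<^sub>F l in at_right 0. signed_integral borel (rho_of V (\<sigma> l t)) f = R l t f"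
    using eventually_positive
    by eventually_elim (rule velocity_measure.signed_integral_rho[OF velocity_measure[OF _ t] f'(2)])
  ultimately show ?thesis
    unfolding signed_integral_measure[OF \<rho>_finite[OF t] f'(2)] by (rule Lim_transform_eventually)
qed

lemma mass_balance_limit:
  assumes \<phi>: "C1_torus \<phi>" and st: "0 \<le> s" "s \<le> t" "t \<le> T"
  shows "(LINT x|\<rho> t. \<phi> x) - (LINT x|\<rho> s. \<phi> x) =
    (LINT r|Leb T. indicator {s<..<t} r * w_integral r (deriv_torus \<phi>))"
proof (rule LIMSEQ_unique)
  let ?l = "\<lambda>n. inverse (real (Suc n))"
  note c = C1_torus_continuous[OF \<phi>] C1_torus_continuous_deriv[OF \<phi>]
  show "(\<lambda>n. R (?l n) t \<phi> - R (?l n) s \<phi>) \<longlonglongrightarrow> (LINT x|\<rho> t. \<phi> x) - (LINT x|\<rho> s. \<phi> x)"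
    using st by (intro tendsto_diff tendsto_at_right_seq R_tendsto c) auto
  obtain K where K: "K > 0" "\<And>p. \<bar>deriv_torus \<phi> p\<bar> \<le> K" using bounded_torus[OF c(2)] by blast
  have S: "indicator {s<..<t} \<in> borel_measurable (Leb T)"
    by (intro measurable_restrict_space1) simp
  have lim: "(\<lambda>n. W (?l n) r (deriv_torus \<phi>)) \<longlonglongrightarrow> w_integral r (deriv_torus \<phi>)" if "r \<in> space (Leb T)" for r
    using that by (intro tendsto_at_right_seq W_tendsto c) auto
  have "(\<lambda>n. LINT r|Leb T. indicator {s<..<t} r * W (?l n) r (deriv_torus \<phi>))
      \<longlonglongrightarrow> (LINT r|Leb T. indicator {s<..<t} r * w_integral r (deriv_torus \<phi>))"
  proof (rule integral_dominated_convergence[where w = "\<lambda>_. V * K"])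
    show m: "(\<lambda>r. indicator {s<..<t} r * W (?l n) r (deriv_torus \<phi>)) \<in> borel_measurable (Leb T)" for n
      by (intro borel_measurable_times S W_measurable c) simp
    show "(\<lambda>r. indicator {s<..<t} r * w_integral r (deriv_torus \<phi>)) \<in> borel_measurable (Leb T)"
      using m by (rule borel_measurable_LIMSEQ_real[rotated]) (rule tendsto_mult[OF tendsto_const lim])
    show "integrable (Leb T) (\<lambda>_. V * K)"
      by (rule finite_measure.integrable_const[OF finite_measure_Leb])
    show "AE r in Leb T. (\<lambda>n. indicator {s<..<t} r * W (?l n) r (deriv_torus \<phi>)) \<longlonglongrightarrow> indicator {s<..<t} r * w_integral r (deriv_torus \<phi>)"
      by (intro AE_I2 tendsto_intros lim)
    show "AE r in Leb T. norm (indicator {s<..<t} r * W (?l n) r (deriv_torus \<phi>)) \<le> V * K" for n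
    proof (rule AE_I2)
      fix r assume "r \<in> space (Leb T)"
      then have "\<bar>W (?l n) r (deriv_torus \<phi>)\<bar> \<le> V * K"
        using K by (intro W_le) auto
      then show "norm (indicator {s<..<t} r * W (?l n) r (deriv_torus \<phi>)) \<le> V * K"
        using V K(1) by (auto split: split_indicator)
    qed
  qed
  moreover have "(LINT r|Leb T. indicator {s<..<t} r * W (?l n) r (deriv_torus \<phi>)) = R (?l n) t \<phi> - R (?l n) s \<phi>" for n
    by (rule mass_balance[OF \<phi> st, symmetric]) simp
  ultimately show "(\<lambda>n. R (?l n) t \<phi> - R (?l n) s \<phi>) \<longlonglongrightarrow> (LINT r|Leb T. indicator {s<..<t} r * w_integral r (deriv_torus \<phi>))"
    by (simp only:)
qed

lemma flux_balance_limit: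
  assumes \<psi>: "C1_torus \<psi>" and st: "0 \<le> s" "s \<le> t" "t \<le> T"
  shows "w_integral t \<psi> - w_integral s \<psi> =
    V\<^sup>2 * (LINT r|Leb T. indicator {s<..<t} r * (LINT x|\<rho> r. deriv_torus \<psi> x))"
proof -
  let ?l = "\<lambda>n. inverse (real (Suc n))"
  note c = C1_torus_continuous[OF \<psi>] C1_torus_continuous_deriv[OF \<psi>]
  obtain K where K: "K > 0" "\<And>p. \<bar>deriv_torus \<psi> p\<bar> \<le> K" using bounded_torus[OF c(2)] by blast
  have S: "indicator {s<..<t} \<in> borel_measurable (Leb T)"
    by (intro measurable_restrict_space1) simp
  have lim: "(\<lambda>n. R (?l n) r (deriv_torus \<psi>)) \<longlonglongrightarrow> (LINT x|\<rho> r. deriv_torus \<psi> x)" if "r \<in> space (Leb T)" for r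
    using that by (intro tendsto_at_right_seq R_tendsto c) auto
  have "(\<lambda>n. LINT r|Leb T. indicator {s<..<t} r * R (?l n) r (deriv_torus \<psi>))
      \<longlonglongrightarrow> (LINT r|Leb T. indicator {s<..<t} r * (LINT x|\<rho> r. deriv_torus \<psi> x))"
  proof (rule integral_dominated_convergence[where w = "\<lambda>_. K"])
    show m: "(\<lambda>r. indicator {s<..<t} r * R (?l n) r (deriv_torus \<psi>)) \<in> borel_measurable (Leb T)" for n
      by (intro borel_measurable_times S R_measurable c) simp
    show "(\<lambda>r. indicator {s<..<t} r * (LINT x|\<rho> r. deriv_torus \<psi> x)) \<in> borel_measurable (Leb T)"
      using m by (rule borel_measurable_LIMSEQ_real[rotated]) (rule tendsto_mult[OF tendsto_const lim])
    show "integrable (Leb T) (\<lambda>_. K)"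
      by (rule finite_measure.integrable_const[OF finite_measure_Leb])
    show "AE r in Leb T. (\<lambda>n. indicator {s<..<t} r * R (?l n) r (deriv_torus \<psi>)) \<longlonglongrightarrow> indicator {s<..<t} r * (LINT x|\<rho> r. deriv_torus \<psi> x)"
      by (intro AE_I2 tendsto_intros lim)
    show "AE r in Leb T. norm (indicator {s<..<t} r * R (?l n) r (deriv_torus \<psi>)) \<le> K" for n
    proof (rule AE_I2)
      fix r assume "r \<in> space (Leb T)"
      then have "\<bar>R (?l n) r (deriv_torus \<psi>)\<bar> \<le> K"
        using K by (intro R_le) auto
      then show "norm (indicator {s<..<t} r * R (?l n) r (deriv_torus \<psi>)) \<le> K"
        using K(1) by (auto split: split_indicator)
    qed
  qed
  note flux = this
  have "(\<lambda>n. W (?l n) t \<psi>) \<longlonglongrightarrow> w_integral t \<psi>" "(\<lambda>n. W (?l n) s \<psi>) \<longlonglongrightarrow> w_integral s \<psi>"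
    using st by (intro tendsto_at_right_seq W_tendsto c; simp)+
  then have "(\<lambda>n. \<bar>W (?l n) t \<psi> - W (?l n) s \<psi> - V\<^sup>2 * (LINT r|Leb T. indicator {s<..<t} r * R (?l n) r (deriv_torus \<psi>))\<bar>)
      \<longlonglongrightarrow> \<bar>w_integral t \<psi> - w_integral s \<psi> - V\<^sup>2 * (LINT r|Leb T. indicator {s<..<t} r * (LINT x|\<rho> r. deriv_torus \<psi> x))\<bar>"
    by (intro tendsto_rabs tendsto_diff tendsto_mult[OF tendsto_const flux])
  note lim = this
  have "\<bar>w_integral t \<psi> - w_integral s \<psi> - V\<^sup>2 * (LINT r|Leb T. indicator {s<..<t} r * (LINT x|\<rho> r. deriv_torus \<psi> x))\<bar> \<le> 0"
  proof (rule field_le_epsilon)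
    fix e :: real assume "e > 0"
    have "\<forall>\<^sub>F n in sequentially. ?l n > 0 \<and> (\<forall>s t. 0 \<le> s \<longrightarrow> s \<le> t \<longrightarrow> t \<le> T \<longrightarrow>
        \<bar>W (?l n) t \<psi> - W (?l n) s \<psi> - V\<^sup>2 * (LINT r|Leb T. indicator {s<..<t} r * R (?l n) r (deriv_torus \<psi>))\<bar> \<le> e)"
      by (rule eventually_compose_filterlim[OF flux_balance[OF \<psi> \<open>e > 0\<close>] filterlim_inverse_Suc_at_right])
    then have "\<forall>\<^sub>F n in sequentially. \<bar>W (?l n) t \<psi> - W (?l n) s \<psi> -
        V\<^sup>2 * (LINT r|Leb T. indicator {s<..<t} r * R (?l n) r (deriv_torus \<psi>))\<bar> \<le> 0 + e"
      by eventually_elim (use st in auto)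
    then show "\<bar>w_integral t \<psi> - w_integral s \<psi> - V\<^sup>2 * (LINT r|Leb T. indicator {s<..<t} r * (LINT x|\<rho> r. deriv_torus \<psi> x))\<bar> \<le> 0 + e"
      by (rule tendsto_upperbound[OF lim]) simp
  qed
  then show ?thesis by simp
qed

lemma \<rho>_continuous:
  fixes f :: "torus \<Rightarrow> real"
  shows "continuous_on UNIV f \<Longrightarrow> continuous_on {0..T} (\<lambda>t. LINT x|\<rho> t. f x)"
proof (rule lipschitz_dense_continuous[where B = 1 and \<Phi> = "\<lambda>t f. LINT x|\<rho> t. f x"])
  fix \<phi> assume \<phi>: "C1_torus \<phi>"
  obtain K where K: "K > 0" "\<And>p. \<bar>deriv_torus \<phi> p\<bar> \<le> K"
    using bounded_torus[OF C1_torus_continuous_deriv[OF \<phi>]] by blast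
  have "\<bar>(LINT x|\<rho> t. \<phi> x) - (LINT x|\<rho> s. \<phi> x)\<bar> \<le> V * K * (t - s)" if "s \<in> {0..T}" "t \<in> {0..T}" "s \<le> t" for s t
    using mass_balance_limit[OF \<phi>, of s t] that V K
    by (auto intro!: indicator_LINT_le w_integral_le)
  then show "\<exists>K. \<forall>s\<in>{0..T}. \<forall>t\<in>{0..T}. s \<le> t \<longrightarrow> \<bar>(LINT x|\<rho> t. \<phi> x) - (LINT x|\<rho> s. \<phi> x)\<bar> \<le> K * (t - s)"
    by blast
next
  fix t assume t: "t \<in> {0..T}"
  interpret finite_measure "\<rho> t" by (rule \<rho>_finite(1)[OF t])
  show "sigma_linear borel (\<lambda>f. LINT x|\<rho> t. f x)"
    using sigma_linear_LINT[OF integrable_bmeas[OF \<rho>_finite(1)[OF t] bmeas_const[of 1]]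
        measurable_ident_sets[OF \<rho>_finite(2)[OF t]]] by simp
  interpret prob_space "\<rho> t" using \<rho>[OF t] by (simp add: prob_measure_on_def)
  fix f :: "torus \<Rightarrow> real" and K assume f: "\<And>x. \<bar>f x\<bar> \<le> K"
  then have "K \<ge> 0" using order_trans[OF abs_ge_zero f] by simp
  show "\<bar>LINT x|\<rho> t. f x\<bar> \<le> 1 * K"
  proof (cases "integrable (\<rho> t) f")
    case True
    have "\<bar>LINT x|\<rho> t. f x\<bar> \<le> (LINT x|\<rho> t. \<bar>f x\<bar>)" by (rule integral_abs_bound)
    also have "\<dots> \<le> (LINT x|\<rho> t. K)" using True f by (intro integral_mono) auto
    finally show ?thesis by (simp add: prob_space)
  qed (use \<open>K \<ge> 0\<close> in \<open>simp add: not_integrable_integral_eq\<close>)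
qed simp_all

lemma narrow_continuous_w: "narrow_continuous_on borel {0..T} w"
  unfolding narrow_continuous_on_def
proof
  fix f :: "torus \<Rightarrow> real" assume "f \<in> bcont (space borel)"
  then have f: "continuous_on UNIV f" by (simp add: bcont_def)
  show "continuous_on {0..T} (\<lambda>t. signed_integral borel (w t) f)"
    using w_continuous[OF f]
    by (rule continuous_on_eq) (simp add: signed_integral_w continuous_bmeas_torus(2)[OF f])
qed

lemma narrow_continuous_\<rho>: "narrow_continuous_on borel {0..T} (\<lambda>t. measure (\<rho> t))"
  unfolding narrow_continuous_on_def
proof
  fix f :: "torus \<Rightarrow> real" assume "f \<in> bcont (space borel)"
  then have f: "continuous_on UNIV f" by (simp add: bcont_def)
  show "continuous_on {0..T} (\<lambda>t. signed_integral borel (measure (\<rho> t)) f)"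
    using \<rho>_continuous[OF f]
    by (rule continuous_on_eq) (simp add: signed_integral_measure \<rho>_finite continuous_bmeas_torus(2)[OF f])
qed

lemma bounded_family_w: "bounded_family T w V"
proof
  fix t assume "t \<in> {0<..<T}"
  then have t: "t \<in> {0..T}" by simp
  show "vector_measure borel (w t)" by (rule vector_measure_w[OF t])
  show "\<bar>w t A\<bar> \<le> V" for A
    using w_integral_le[OF t, of "indicator A" 1] by (simp add: w_def split: split_indicator)
next
  have restrict_UNIV: "restrict_space borel UNIV = (borel :: torus measure)"
    by (rule measure_eqI) (auto simp: sets_restrict_space emeasure_restrict_space)
  fix A :: "torus set" assume A: "A \<in> sets borel"
  have "(\<lambda>t. signed_integral (restrict_space borel UNIV) (w t) (indicator A)) \<in> borel_measurable (restrict_space borel {0<..<T})"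
    using narrow_continuous_w vector_measure_w A
    by (intro narrow_continuous_measurable) (auto simp: restrict_UNIV intro!: bmeas_indicator)
  then have "(\<lambda>t. signed_integral borel (w t) (indicator A)) \<in> borel_measurable (Leb T)"
    by (simp add: restrict_UNIV measurable_Leb)
  then show "(\<lambda>t. w t A) \<in> borel_measurable (Leb T)"
    by (rule measurable_cong[THEN iffD1, rotated]) (use vector_measure_w A in \<open>auto simp: signed_integral_indicator\<close>)
qed

lemma omega_eq_spacetime:
  assumes B: "B \<in> sets (ST T)"
  shows "\<omega> B = spacetime T w B"
proof (rule ST_eqI[OF \<omega> bounded_family.vector_measure_spacetime[OF bounded_family_w] _ B])
  fix f assume f: "f \<in> bcont (space (ST T))"
  note fb = bcont_bmeas_ST(1)[OF f]
  let ?l = "\<lambda>n. inverse (real (Suc n))"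
  obtain K where K: "K > 0" "\<And>z. z \<in> space (ST T) \<Longrightarrow> \<bar>f z\<bar> \<le> K"
    using bmeasE[OF fb] by metis
  have eqW: "W l t (\<lambda>x. f (t, x)) = signed_integral borel (omega_of V (\<sigma> l t)) (\<lambda>x. f (t, x))"
    if "l > 0" "t \<in> space (Leb T)" for l t
    using that bmeas_ST_section[OF fb, of t] velocity_measure[of l t]
    by (intro velocity_measure.signed_integral_omega[symmetric]) auto
  have lim: "(\<lambda>n. W (?l n) t (\<lambda>x. f (t, x))) \<longlonglongrightarrow> w_integral t (\<lambda>x. f (t, x))" if "t \<in> space (Leb T)" for t
    using that bcont_bmeas_ST(3)[OF f, of t] by (intro tendsto_at_right_seq W_tendsto) auto
  have "(\<lambda>n. LINT t|Leb T. W (?l n) t (\<lambda>x. f (t, x))) \<longlonglongrightarrow> (LINT t|Leb T. w_integral t (\<lambda>x. f (t, x)))"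
  proof (rule integral_dominated_convergence[where w = "\<lambda>_. V * K"])
    show m: "(\<lambda>t. W (?l n) t (\<lambda>x. f (t, x))) \<in> borel_measurable (Leb T)" for n
      using bounded_family.section_measurable[OF bounded_family_omega fb, of "?l n"]
      by (rule measurable_cong[THEN iffD1, rotated]) (use eqW in auto)
    show "(\<lambda>t. w_integral t (\<lambda>x. f (t, x))) \<in> borel_measurable (Leb T)"
      using m by (rule borel_measurable_LIMSEQ_real[rotated]) (rule lim)
    show "integrable (Leb T) (\<lambda>_. V * K)"
      by (rule finite_measure.integrable_const[OF finite_measure_Leb])
    show "AE t in Leb T. (\<lambda>n. W (?l n) t (\<lambda>x. f (t, x))) \<longlonglongrightarrow> w_integral t (\<lambda>x. f (t, x))"
      by (intro AE_I2 lim)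
    show "AE t in Leb T. norm (W (?l n) t (\<lambda>x. f (t, x))) \<le> V * K" for n
      using K(2) by (intro AE_I2) (auto simp: space_ST intro!: W_le)
  qed
  moreover have "(\<lambda>n. LINT t|Leb T. W (?l n) t (\<lambda>x. f (t, x))) \<longlonglongrightarrow> signed_integral (ST T) \<omega> f"
    by (rule tendsto_at_right_seq[OF spacetime_omega_tendsto[OF f]])
  ultimately have "signed_integral (ST T) \<omega> f = (LINT t|Leb T. w_integral t (\<lambda>x. f (t, x)))"
    by (rule LIMSEQ_unique[rotated])
  also have "\<dots> = (LINT t|Leb T. signed_integral borel (w t) (\<lambda>x. f (t, x)))"
    using bmeas_ST_section[OF fb] by (intro Bochner_Integration.integral_cong) (auto simp: signed_integral_w)
  also have "\<dots> = signed_integral (ST T) (spacetime T w) f"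
    by (rule bounded_family.signed_integral_spacetime[OF bounded_family_w fb, symmetric])
  finally show "signed_integral (ST T) \<omega> f = signed_integral (ST T) (spacetime T w) f" .
qed

lemma ME_limit: "ME V T \<rho> w (\<lambda>_ _. 0)"
  unfolding ME_def
proof (intro conjI allI impI ballI)
  fix \<phi> s t assume \<phi>: "C1_torus \<phi>" and st: "0 \<le> s" "s \<le> t" "t \<le> T"
  have set: "(LINT r:{s<..<t}|lborel. k r) = (LINT r|Leb T. indicator {s<..<t} r * k r)" for k :: "real \<Rightarrow> real"
    using st by (intro set_LINT_Leb) auto
  have zero: "signed_integral borel (\<lambda>_. 0) \<phi> = 0"
  proof -
    obtain K where "K > 0" "\<And>p. \<bar>\<phi> p\<bar> \<le> K"
      using bounded_torus[OF C1_torus_continuous[OF \<phi>]] by blast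
    then show ?thesis
      using signed_integral_bound[of borel "\<lambda>_. 0" 0 \<phi> K] by simp
  qed
  show "(LINT x|\<rho> t. \<phi> x) - (LINT x|\<rho> s. \<phi> x) = (LINT r:{s<..<t}|lborel. signed_integral borel (w r) (deriv_torus \<phi>))"
    unfolding set mass_balance_limit[OF \<phi> st]
    using continuous_bmeas_torus(2)[OF C1_torus_continuous_deriv[OF \<phi>]]
    by (intro Bochner_Integration.integral_cong) (auto simp: signed_integral_w)
  show "signed_integral borel (w t) \<phi> - signed_integral borel (w s) \<phi> =
      V\<^sup>2 * (LINT r:{s<..<t}|lborel. (LINT x|\<rho> r. deriv_torus \<phi> x))
      - 2 * (LINT r:{s<..<t}|lborel. signed_integral borel (\<lambda>_. 0) \<phi>)"
    using st flux_balance_limit[OF \<phi> st] continuous_bmeas_torus(2)[OF C1_torus_continuous[OF \<phi>]]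
    by (simp add: set zero signed_integral_w)
next
  have "tv_norm borel (\<lambda>_ :: torus set. 0 :: real) \<le> 0"
    unfolding tv_norm_def by (intro SUP_least) simp
  then show "integrable_family borel T (\<lambda>_ (_ :: torus set). 0 :: real)"
    by (simp add: integrable_family_def vector_measure_def)
qed (use \<rho> vector_measure_w narrow_continuous_w narrow_continuous_\<rho> in auto)

lemma Jbar_eq_0: "Jbar V T \<rho> \<omega> J = 0"
proof -
  have "spacetime T (\<lambda>_ _. 0) B = 0" for B by (simp add: spacetime_def)
  then have "\<exists>w' K. (\<forall>B\<in>sets (ST T). \<omega> B = spacetime T w' B) \<and>
      (\<forall>B\<in>sets (ST T). J B = spacetime T K B) \<and> ME V T \<rho> w' K"
    by (intro exI[of _ w] exI[of _ "\<lambda>_ _. 0"] conjI ballI omega_eq_spacetime ME_limit) (simp_all add: J_zero)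
  then show ?thesis
    unfolding Jbar_def by (simp add: J_zero)
qed

end

theorem theorem4p10:
  fixes V T C :: real
    and \<sigma> :: "real \<Rightarrow> real \<Rightarrow> (torus \<times> real) measure"
    and j :: "real \<Rightarrow> real \<Rightarrow> (torus \<times> real) set \<Rightarrow> real \<times> real"
    and \<rho> :: "real \<Rightarrow> torus measure"
    and \<omega> J :: "(real \<times> torus) set \<Rightarrow> real"
  assumes "V > 0" and "T > 0" and "C > 0"
    and "\<And>l. l > 0 \<Longrightarrow> CE V T (\<sigma> l) (j l)"
    and "(SUP l\<in>{0<..}. Ent (measure (\<sigma> l 0)) (pi_measure V) + action V T l (\<sigma> l) (j l)) \<le> ennreal C"
    and "\<And>t. t \<in> {0..T} \<Longrightarrow> prob_measure_on borel (\<rho> t)"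
    and "vector_measure (ST T) \<omega>" and "vector_measure (ST T) J"
    and "narrow_tendsto (ST T) (\<lambda>l. spacetime T (\<lambda>t. rho_of V (\<sigma> l t)))
           (spacetime T (\<lambda>t. measure (\<rho> t))) (at_right 0)"
    and "narrow_tendsto (ST T) (\<lambda>l. spacetime T (\<lambda>t. omega_of V (\<sigma> l t))) \<omega> (at_right 0)"
    and "narrow_tendsto (ST T) (\<lambda>l. spacetime T (\<lambda>t. J_of V (j l t))) J (at_right 0)"
    and "\<And>t. t \<in> {0..T} \<Longrightarrow>
           narrow_tendsto borel (\<lambda>l. rho_of V (\<sigma> l t)) (measure (\<rho> t)) (at_right 0)"
  shows "Liminf (at_right 0) (\<lambda>l. action V T l (\<sigma> l) (j l)) \<ge> Jbar V T \<rho> \<omega> J"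
proof -
  have "action V T l (\<sigma> l) (j l) \<le> ennreal C" if "l > 0" for l
  proof -
    have "action V T l (\<sigma> l) (j l) \<le> Ent (measure (\<sigma> l 0)) (pi_measure V) + action V T l (\<sigma> l) (j l)"
      by simp
    also have "\<dots> \<le> ennreal C"
      using that by (intro order_trans[OF SUP_upper assms(5)]) simp
    finally show ?thesis .
  qed
  then interpret vanishing_rate V T C \<sigma> j \<rho> \<omega> J
    using assms by unfold_locales
  show ?thesis by (simp add: Jbar_eq_0)
qed

end
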